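(* Let $x_1,\dots,x_n\in\mathbb{R}^d$, $X=\mathrm{conv}\{\pm x_1,\dots,\pm x_n\}$, and let $\xi\ge\kappa(X)$. Let $A_n$ be the output of the scale-independent algorithm described in the context, run on $x_1,\dots,x_n$ with parameter $\xi$, and $\mathcal{E}_n=\{x:\|A_nx\|\le1\}$. Then $$\frac{\mathcal{E}_n}{\sqrt{6+28d\log\xi+16d}}\subseteq X\subseteq\mathcal{E}_n .$$ Moreover, the algorithm runs in time $O(nd^2\log^2 d)$ and stores at most $O(d^2)$ floating point numbers.
   Context: $\kappa(X)=R/r$ where $r$ is the radius of the largest origin-centered Euclidean ball contained in $X$ and $R$ the radius of the smallest origin-centered Euclidean ball containing $X$ (assumed finite, so $X$ is full-dimensional); $\log$ is the natural logarithm. Scale-independent algorithm (parameter $\xi$): receive $x_1$; let $V_1$ be orthogonal with $V_1^Tx_1=\|x_1\|e_1$, $U_1=I$, $\Sigma_1=\mathrm{diag}(\|x_1\|,\|x_1\|/\xi,\dots,\|x_1\|/\xi)$, $A_1=U_1\Sigma_1^{-1}V_1^T$. For $t=2,\dots,n$: receive $x_t$. If $\|A_{t-1}x_t\|>1$: let $M_t=\max_{1\le i\le t}\|x_i\|$; let $A_t'=\Big(I-\big(1-\frac{1}{\|A_{t-1}x_t\|}\big)\frac{(A_{t-1}x_t)(A_{t-1}x_t)^T}{\|A_{t-1}x_t\|^2}\Big)A_{t-1}$ and compute its singular value decomposition $A_t'=U_t(\Sigma_t')^{-1}V_t^T$ (by a rank-one SVD update of $U_{t-1}\Sigma_{t-1}^{-1}V_{t-1}^T$,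 which can be done in time $O(d^2\log^2 d)$); set $\Sigma_t=\mathrm{diag}(\tau_{1,t},\dots,\tau_{d,t})$ with $\tau_{i,t}=\max([\Sigma_t']_{ii},M_t/\xi)$. Otherwise set $U_t=U_{t-1},V_t=V_{t-1},\Sigma_t=\Sigma_{t-1}$. Set $A_t=U_t\Sigma_t^{-1}V_t^T$. Output $A_n$. The algorithm stores only $U_t,\Sigma_t,V_t$ between iterations. *)

theory Defs
  imports Complex_Main "Jordan_Normal_Form.Matrix"
begin

section \<open>Geometry in \<open>\<real>\<^sup>d\<close>\<close>

text \<open>
  Points of \<open>\<real>\<^sup>d\<close> are elements of \<^term>\<open>carrier_vec d\<close>, so that \<open>d\<close> is an ordinary
  natural number and the constants hidden in the asymptotic bounds can be quantified
  outside of it.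
\<close>

definition enorm :: "real vec \<Rightarrow> real" where
  "enorm v = sqrt (v \<bullet> v)"

definition origin_ball :: "nat \<Rightarrow> real \<Rightarrow> real vec set" where
  "origin_ball d \<rho> = {v \<in> carrier_vec d. enorm v \<le> \<rho>}"

definition conv_hull :: "nat \<Rightarrow> real vec set \<Rightarrow> real vec set" where
  "conv_hull d S =
     {v. \<exists>W c. finite W \<and> W \<subseteq> S \<and> (\<forall>w\<in>W. 0 \<le> c w) \<and> (\<Sum>w\<in>W. c w) = 1 \<and>
             v = vec d (\<lambda>j. \<Sum>w\<in>W. c w * w $ j)}"

definition sym_hull :: "nat \<Rightarrow> nat \<Rightarrow> (nat \<Rightarrow> real vec) \<Rightarrow> real vec set" where
  "sym_hull d n x = conv_hull d (x ` {1..n} \<union> (\<lambda>i. - x i) ` {1..n})"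

definition inner_radius :: "nat \<Rightarrow> real vec set \<Rightarrow> real" where
  "inner_radius d X = Sup {\<rho>. 0 \<le> \<rho> \<and> origin_ball d \<rho> \<subseteq> X}"

definition outer_radius :: "nat \<Rightarrow> real vec set \<Rightarrow> real" where
  "outer_radius d X = Inf {\<rho>. 0 \<le> \<rho> \<and> X \<subseteq> origin_ball d \<rho>}"

definition aspect_ratio :: "nat \<Rightarrow> real vec set \<Rightarrow> real" where
  "aspect_ratio d X = outer_radius d X / inner_radius d X"

definition mat_ellipsoid :: "nat \<Rightarrow> real mat \<Rightarrow> real vec set" where
  "mat_ellipsoid d A = {v \<in> carrier_vec d. enorm (A *\<^sub>v v) \<le> 1}"

definition shrink :: "real \<Rightarrow> real vec set \<Rightarrow> real vec set" where
  "shrink \<alpha> S = (\<lambda>v. (1 / \<alpha>) \<cdot>\<^sub>v v) ` S"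

text \<open>
  Finiteness of the aspect ratio is positivity of the inner radius (division by zero would
  yield the value 0). The first point must be nonzero for the initial matrix
  \<open>\<Sigma>\<^sub>1\<close> of the algorithm to be invertible.
\<close>

definition valid_input :: "nat \<Rightarrow> nat \<Rightarrow> (nat \<Rightarrow> real vec) \<Rightarrow> real \<Rightarrow> bool" where
  "valid_input d n x \<xi> \<longleftrightarrow>
     1 \<le> d \<and> 1 \<le> n \<and> (\<forall>i\<in>{1..n}. x i \<in> carrier_vec d) \<and> x 1 \<noteq> 0\<^sub>v d \<and>
     0 < inner_radius d (sym_hull d n x) \<and> aspect_ratio d (sym_hull d n x) \<le> \<xi>"


section \<open>The scale-independent algorithm\<close>

definition orthogonal_matrix_of :: "nat \<Rightarrow> real mat \<Rightarrow> bool" where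
  "orthogonal_matrix_of d U \<longleftrightarrow>
     U \<in> carrier_mat d d \<and> U\<^sup>T * U = 1\<^sub>m d \<and> U * U\<^sup>T = 1\<^sub>m d"

text \<open>The matrix \<open>U \<Sigma>\<^sup>-\<^sup>1 V\<^sup>T\<close>, where the vector \<open>s\<close> is the diagonal of \<open>\<Sigma>\<close>.\<close>

definition inv_factored :: "nat \<Rightarrow> real mat \<Rightarrow> real vec \<Rightarrow> real mat \<Rightarrow> real mat" where
  "inv_factored d U s V = U * mat_diag d (\<lambda>i. inverse (s $ i)) * V\<^sup>T"

text \<open>
  \<open>B = U \<Sigma>\<^sup>-\<^sup>1 V\<^sup>T\<close> is a singular value decomposition of the nonsingular matrix \<open>B\<close>.
  No order of the singular values is prescribed.
\<close>

definition svd_inv :: "nat \<Rightarrow> real mat \<Rightarrow> real mat \<Rightarrow> real vec \<Rightarrow> real mat \<Rightarrow> bool" where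
  "svd_inv d B U s V \<longleftrightarrow>
     orthogonal_matrix_of d U \<and> orthogonal_matrix_of d V \<and>
     s \<in> carrier_vec d \<and> (\<forall>i<d. 0 < s $ i) \<and> B = inv_factored d U s V"

definition outer_prod :: "real vec \<Rightarrow> real vec \<Rightarrow> real mat" where
  "outer_prod v w = mat (dim_vec v) (dim_vec w) (\<lambda>(i, j). v $ i * w $ j)"

definition rank_one_step :: "nat \<Rightarrow> real mat \<Rightarrow> real vec \<Rightarrow> real mat" where
  "rank_one_step d A v =
     (let a = A *\<^sub>v v in
      (1\<^sub>m d - ((1 - 1 / enorm a) / (enorm a)\<^sup>2) \<cdot>\<^sub>m outer_prod a a) * A)"

definition max_norm :: "(nat \<Rightarrow> real vec) \<Rightarrow> nat \<Rightarrow> real" where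
  "max_norm x t = Max ((\<lambda>i. enorm (x i)) ` {1..t})"

text \<open>
  The sequences \<open>U\<close>, \<open>s\<close>, \<open>V\<close> (with \<open>s t\<close> the diagonal of \<open>\<Sigma>\<^sub>t\<close>) arise from an execution of
  the algorithm. It is a relation since neither \<open>V\<^sub>1\<close> nor singular value decompositions
  are unique. The index of the first coordinate is 0.
\<close>

definition scale_indep_run ::
  "nat \<Rightarrow> nat \<Rightarrow> (nat \<Rightarrow> real vec) \<Rightarrow> real \<Rightarrow>
   (nat \<Rightarrow> real mat) \<Rightarrow> (nat \<Rightarrow> real vec) \<Rightarrow> (nat \<Rightarrow> real mat) \<Rightarrow> bool" where
  "scale_indep_run d n x \<xi> U s V \<longleftrightarrow>
     orthogonal_matrix_of d (V 1) \<and>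
     (V 1)\<^sup>T *\<^sub>v x 1 = enorm (x 1) \<cdot>\<^sub>v unit_vec d 0 \<and>
     U 1 = 1\<^sub>m d \<and>
     s 1 = vec d (\<lambda>i. if i = 0 then enorm (x 1) else enorm (x 1) / \<xi>) \<and>
     (\<forall>t\<in>{2..n}.
        let A = inv_factored d (U (t - 1)) (s (t - 1)) (V (t - 1)) in
        if enorm (A *\<^sub>v x t) > 1
        then \<exists>s'. svd_inv d (rank_one_step d A (x t)) (U t) s' (V t) \<and>
                  s t = vec d (\<lambda>i. max (s' $ i) (max_norm x t / \<xi>))
        else U t = U (t - 1) \<and> s t = s (t - 1) \<and> V t = V (t - 1))"


section \<open>A real random access machine\<close>

text \<open>
  Time and storage are measured on a real RAM: real arrays, natural number
  variables for loop counters and addresses, and counted loops. Every evaluation of a constant,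
  variable, array access or operator costs one unit, as does every elementary statement and every loop
  iteration; reading an input point costs one unit per coordinate in addition. The only
  non-elementary instruction is the rank-one update of a singular value decomposition.
\<close>

type_synonym name = string

datatype nexp =
    NConst nat
  | NVar name
  | NAdd nexp nexp
  | NSub nexp nexp
  | NMul nexp nexp

datatype rexp =
    RConst real
  | RCell name nexp
  | RAdd rexp rexp
  | RSub rexp rexp
  | RMul rexp rexp
  | RDiv rexp rexp
  | RMax rexp rexp
  | RSqrt rexp

text \<open>\<open>Svd U s V p q\<close> overwrites the arrays \<open>U\<close>, \<open>s\<close>, \<open>V\<close>.\<close>

datatype com =
    Store name nexp rexp
  | Seq com com  (infixr \<open>;;\<close> 60)
  | For name nexp com
  | IfLess rexp rexp com
  | Read name
  | Svd name name name name name

primrec nval :: "nexp \<Rightarrow> (name \<Rightarrow> nat) \<Rightarrow> nat" where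
  "nval (NConst k) \<nu> = k"
| "nval (NVar v) \<nu> = \<nu> v"
| "nval (NAdd a b) \<nu> = nval a \<nu> + nval b \<nu>"
| "nval (NSub a b) \<nu> = nval a \<nu> - nval b \<nu>"
| "nval (NMul a b) \<nu> = nval a \<nu> * nval b \<nu>"

primrec ncost :: "nexp \<Rightarrow> nat" where
  "ncost (NConst k) = 1"
| "ncost (NVar v) = 1"
| "ncost (NAdd a b) = 1 + ncost a + ncost b"
| "ncost (NSub a b) = 1 + ncost a + ncost b"
| "ncost (NMul a b) = 1 + ncost a + ncost b"

primrec rval :: "rexp \<Rightarrow> (name \<Rightarrow> nat) \<Rightarrow> (name \<times> nat \<Rightarrow> real) \<Rightarrow> real" where
  "rval (RConst c) \<nu> \<mu> = c"
| "rval (RCell a e) \<nu> \<mu> = \<mu> (a, nval e \<nu>)"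
| "rval (RAdd a b) \<nu> \<mu> = rval a \<nu> \<mu> + rval b \<nu> \<mu>"
| "rval (RSub a b) \<nu> \<mu> = rval a \<nu> \<mu> - rval b \<nu> \<mu>"
| "rval (RMul a b) \<nu> \<mu> = rval a \<nu> \<mu> * rval b \<nu> \<mu>"
| "rval (RDiv a b) \<nu> \<mu> = rval a \<nu> \<mu> / rval b \<nu> \<mu>"
| "rval (RMax a b) \<nu> \<mu> = max (rval a \<nu> \<mu>) (rval b \<nu> \<mu>)"
| "rval (RSqrt a) \<nu> \<mu> = sqrt (rval a \<nu> \<mu>)"

primrec rcost :: "rexp \<Rightarrow> nat" where
  "rcost (RConst c) = 1"
| "rcost (RCell a e) = 1 + ncost e"
| "rcost (RAdd a b) = 1 + rcost a + rcost b"
| "rcost (RSub a b) = 1 + rcost a + rcost b"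
| "rcost (RMul a b) = 1 + rcost a + rcost b"
| "rcost (RDiv a b) = 1 + rcost a + rcost b"
| "rcost (RMax a b) = 1 + rcost a + rcost b"
| "rcost (RSqrt a) = 1 + rcost a"

primrec rcells :: "rexp \<Rightarrow> (name \<Rightarrow> nat) \<Rightarrow> (name \<times> nat) set" where
  "rcells (RConst c) \<nu> = {}"
| "rcells (RCell a e) \<nu> = {(a, nval e \<nu>)}"
| "rcells (RAdd a b) \<nu> = rcells a \<nu> \<union> rcells b \<nu>"
| "rcells (RSub a b) \<nu> = rcells a \<nu> \<union> rcells b \<nu>"
| "rcells (RMul a b) \<nu> = rcells a \<nu> \<union> rcells b \<nu>"
| "rcells (RDiv a b) \<nu> = rcells a \<nu> \<union> rcells b \<nu>"
| "rcells (RMax a b) \<nu> = rcells a \<nu> \<union> rcells b \<nu>"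
| "rcells (RSqrt a) \<nu> = rcells a \<nu>"

text \<open>\<open>touched\<close> collects every memory cell ever read or written; cells are never released.\<close>

record machine =
  nat_vars :: "name \<Rightarrow> nat"
  memory :: "name \<times> nat \<Rightarrow> real"
  inputs_read :: nat
  time :: nat
  touched :: "(name \<times> nat) set"

definition tick :: "nat \<Rightarrow> machine \<Rightarrow> machine" where
  "tick k m = m\<lparr>time := time m + k\<rparr>"

definition touch :: "(name \<times> nat) set \<Rightarrow> machine \<Rightarrow> machine" where
  "touch C m = m\<lparr>touched := touched m \<union> C\<rparr>"

definition mem_vec :: "nat \<Rightarrow> (name \<times> nat \<Rightarrow> real) \<Rightarrow> name \<Rightarrow> real vec" where
  "mem_vec d \<mu> a = vec d (\<lambda>i. \<mu> (a, i))"

text \<open>Matrices are laid out row by row.\<close>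

definition mem_mat :: "nat \<Rightarrow> (name \<times> nat \<Rightarrow> real) \<Rightarrow> name \<Rightarrow> real mat" where
  "mem_mat d \<mu> a = mat d d (\<lambda>(i, j). \<mu> (a, i * d + j))"

definition put_vec :: "nat \<Rightarrow> name \<Rightarrow> real vec \<Rightarrow> (name \<times> nat \<Rightarrow> real) \<Rightarrow> name \<times> nat \<Rightarrow> real" where
  "put_vec d a v \<mu> = (\<lambda>(b, i). if b = a \<and> i < d then v $ i else \<mu> (b, i))"

definition put_mat :: "nat \<Rightarrow> name \<Rightarrow> real mat \<Rightarrow> (name \<times> nat \<Rightarrow> real) \<Rightarrow> name \<times> nat \<Rightarrow> real" where
  "put_mat d a A \<mu> =
     (\<lambda>(b, i). if b = a \<and> i < d * d then A $$ (i div d, i mod d) else \<mu> (b, i))"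

text \<open>
  An SVD update procedure receives \<open>d\<close>, \<open>U\<close>, \<open>s\<close>, \<open>V\<close>, \<open>p\<close>, \<open>q\<close> and returns a singular value
  decomposition, again in the form \<open>U' \<Sigma>'\<^sup>-\<^sup>1 V'\<^sup>T\<close>, of \<open>U \<Sigma>\<^sup>-\<^sup>1 V\<^sup>T + p q\<^sup>T\<close>, together
  with the time it has used.
\<close>

type_synonym svd_proc =
  "nat \<Rightarrow> real mat \<Rightarrow> real vec \<Rightarrow> real mat \<Rightarrow> real vec \<Rightarrow> real vec
   \<Rightarrow> (real mat \<times> real vec \<times> real mat) \<times> nat"

definition svd_update_input ::
  "nat \<Rightarrow> real mat \<Rightarrow> real vec \<Rightarrow> real mat \<Rightarrow> real vec \<Rightarrow> real vec \<Rightarrow> bool" where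
  "svd_update_input d U s V p q \<longleftrightarrow>
     orthogonal_matrix_of d U \<and> orthogonal_matrix_of d V \<and>
     s \<in> carrier_vec d \<and> (\<forall>i<d. 0 < s $ i) \<and> p \<in> carrier_vec d \<and> q \<in> carrier_vec d \<and>
     invertible_mat (inv_factored d U s V + outer_prod p q)"

definition svd_update_correct :: "svd_proc \<Rightarrow> bool" where
  "svd_update_correct svd \<longleftrightarrow>
     (\<forall>d U s V p q. 1 \<le> d \<and> svd_update_input d U s V p q \<longrightarrow>
        (case fst (svd d U s V p q) of (U', s', V') \<Rightarrow>
           svd_inv d (inv_factored d U s V + outer_prod p q) U' s' V'))"

text \<open>
  Running time \<open>O(d\<^sup>2 log\<^sup>2 d)\<close>. As \<open>ln 1 = 0\<close>, bounds of this form are understood for \<open>d \<ge> 2\<close>.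
\<close>

definition svd_update_fast :: "svd_proc \<Rightarrow> bool" where
  "svd_update_fast svd \<longleftrightarrow>
     (\<exists>c::real. \<forall>d U s V p q. 2 \<le> d \<and> svd_update_input d U s V p q \<longrightarrow>
        real (snd (svd d U s V p q)) \<le> c * (real d)\<^sup>2 * (ln (real d))\<^sup>2)"

primrec exec :: "svd_proc \<Rightarrow> nat \<Rightarrow> (nat \<Rightarrow> real vec) \<Rightarrow> com \<Rightarrow> machine \<Rightarrow> machine" where
  "exec svd d x (Store a e r) m =
     (let c = (a, nval e (nat_vars m)) in
      tick (1 + ncost e + rcost r) (touch (insert c (rcells r (nat_vars m)))
        (m\<lparr>memory := (memory m)(c := rval r (nat_vars m) (memory m))\<rparr>)))"
| "exec svd d x (Seq c1 c2) m = exec svd d x c2 (exec svd d x c1 m)"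
| "exec svd d x (For v e c) m =
     fold (\<lambda>k m. exec svd d x c (tick 1 (m\<lparr>nat_vars := (nat_vars m)(v := k)\<rparr>)))
          [0..<nval e (nat_vars m)] (tick (1 + ncost e) m)"
| "exec svd d x (IfLess r1 r2 c) m =
     (let m' = tick (1 + rcost r1 + rcost r2)
                 (touch (rcells r1 (nat_vars m) \<union> rcells r2 (nat_vars m)) m) in
      if rval r1 (nat_vars m) (memory m) < rval r2 (nat_vars m) (memory m)
      then exec svd d x c m' else m')"
| "exec svd d x (Read a) m =
     tick (1 + d) (touch ({a} \<times> {..<d})
       (m\<lparr>memory := put_vec d a (x (Suc (inputs_read m))) (memory m),
          inputs_read := Suc (inputs_read m)\<rparr>))"
| "exec svd d x (Svd U s V p q) m =
     (let \<mu> = memory m;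
          ((U', s', V'), \<tau>) =
            svd d (mem_mat d \<mu> U) (mem_vec d \<mu> s) (mem_mat d \<mu> V) (mem_vec d \<mu> p) (mem_vec d \<mu> q)
      in tick (1 + \<tau>) (touch ({U, V} \<times> {..<d * d} \<union> {s, p, q} \<times> {..<d})
           (m\<lparr>memory := put_mat d U U' (put_vec d s s' (put_mat d V V' \<mu>))\<rparr>)))"

definition initial_machine :: "nat \<Rightarrow> nat \<Rightarrow> real \<Rightarrow> machine" where
  "initial_machine d n \<xi> =
     \<lparr>nat_vars = (\<lambda>_. 0)(''d'' := d, ''n'' := n),
      memory = (\<lambda>_. 0)((''xi'', 0) := \<xi>),
      inputs_read = 0, time = 0, touched = {}\<rparr>"


section \<open>The algorithm as a program\<close>

abbreviation dim_n :: nexp where "dim_n \<equiv> NVar ''d''"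
abbreviation cell1 :: "name \<Rightarrow> name \<Rightarrow> rexp" where "cell1 a i \<equiv> RCell a (NVar i)"
abbreviation idx2 :: "name \<Rightarrow> name \<Rightarrow> nexp" where
  "idx2 i j \<equiv> NAdd (NMul (NVar i) dim_n) (NVar j)"
abbreviation cell2 :: "name \<Rightarrow> name \<Rightarrow> name \<Rightarrow> rexp" where "cell2 a i j \<equiv> RCell a (idx2 i j)"
abbreviation scalar :: "name \<Rightarrow> rexp" where "scalar a \<equiv> RCell a (NConst 0)"
abbreviation set_scalar :: "name \<Rightarrow> rexp \<Rightarrow> com" where "set_scalar a r \<equiv> Store a (NConst 0) r"
abbreviation set1 :: "name \<Rightarrow> name \<Rightarrow> rexp \<Rightarrow> com" where "set1 a i r \<equiv> Store a (NVar i) r"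
abbreviation set2 :: "name \<Rightarrow> name \<Rightarrow> name \<Rightarrow> rexp \<Rightarrow> com" where
  "set2 a i j r \<equiv> Store a (idx2 i j) r"

text \<open>\<open>c := a \<bullet> b\<close>\<close>

definition dot_code :: "name \<Rightarrow> name \<Rightarrow> name \<Rightarrow> com" where
  "dot_code c a b =
     set_scalar c (RConst 0) ;;
     For ''i'' dim_n (set_scalar c (RAdd (scalar c) (RMul (cell1 a ''i'') (cell1 b ''i''))))"

text \<open>\<open>b := B a\<close> and \<open>b := B\<^sup>T a\<close>\<close>

definition mult_code :: "name \<Rightarrow> name \<Rightarrow> name \<Rightarrow> com" where
  "mult_code b B a =
     For ''i'' dim_n
       (set1 b ''i'' (RConst 0) ;;
        For ''j'' dim_n
          (set1 b ''i'' (RAdd (cell1 b ''i'') (RMul (cell2 B ''i'' ''j'') (cell1 a ''j'')))))"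

definition mult_transpose_code :: "name \<Rightarrow> name \<Rightarrow> name \<Rightarrow> com" where
  "mult_transpose_code b B a =
     For ''i'' dim_n
       (set1 b ''i'' (RConst 0) ;;
        For ''j'' dim_n
          (set1 b ''i'' (RAdd (cell1 b ''i'') (RMul (cell2 B ''j'' ''i'') (cell1 a ''j'')))))"

text \<open>
  \<open>V\<^sub>1\<close> is the Householder reflection \<open>I - 2 h h\<^sup>T / (h \<bullet> h)\<close> with \<open>h = e\<^sub>1 - x\<^sub>1 / \<parallel>x\<^sub>1\<parallel>\<close>, or \<open>I\<close>
  if \<open>h = 0\<close>.
\<close>

definition init_code :: com where
  "init_code =
     Read ''x'' ;;
     dot_code ''c'' ''x'' ''x'' ;;
     set_scalar ''M'' (RSqrt (scalar ''c'')) ;;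
     For ''i'' dim_n (set1 ''h'' ''i'' (RSub (RConst 0) (RDiv (cell1 ''x'' ''i'') (scalar ''M'')))) ;;
     set_scalar ''h'' (RAdd (RConst 1) (scalar ''h'')) ;;
     dot_code ''c'' ''h'' ''h'' ;;
     For ''i'' dim_n
       (For ''j'' dim_n
          (set2 ''U'' ''i'' ''j'' (RConst 0) ;;
           set2 ''V'' ''i'' ''j'' (RConst 0)) ;;
        set2 ''U'' ''i'' ''i'' (RConst 1) ;;
        set2 ''V'' ''i'' ''i'' (RConst 1)) ;;
     IfLess (RConst 0) (scalar ''c'')
       (For ''i'' dim_n
          (For ''j'' dim_n
             (set2 ''V'' ''i'' ''j''
                (RSub (cell2 ''V'' ''i'' ''j'')
                   (RDiv (RMul (RConst 2) (RMul (cell1 ''h'' ''i'') (cell1 ''h'' ''j'')))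
                      (scalar ''c'')))))) ;;
     For ''i'' dim_n (set1 ''s'' ''i'' (RDiv (scalar ''M'') (scalar ''xi''))) ;;
     set_scalar ''s'' (scalar ''M'')"

text \<open>
  With \<open>A = U \<Sigma>\<^sup>-\<^sup>1 V\<^sup>T\<close>, \<open>y = \<Sigma>\<^sup>-\<^sup>1 V\<^sup>T x\<close> and \<open>a = A x = U y\<close>, the matrix \<open>A'\<close> of the algorithm is
  \<open>A + p q\<^sup>T\<close> for \<open>p = - (1 - 1 / \<parallel>a\<parallel>) / \<parallel>a\<parallel>\<^sup>2 a\<close> and \<open>q = A\<^sup>T a = V \<Sigma>\<^sup>-\<^sup>1 y\<close>.
\<close>

definition step_code :: com where
  "step_code =
     Read ''x'' ;;
     dot_code ''c'' ''x'' ''x'' ;;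
     set_scalar ''M'' (RMax (scalar ''M'') (RSqrt (scalar ''c''))) ;;
     mult_transpose_code ''y'' ''V'' ''x'' ;;
     For ''i'' dim_n (set1 ''y'' ''i'' (RDiv (cell1 ''y'' ''i'') (cell1 ''s'' ''i''))) ;;
     mult_code ''a'' ''U'' ''y'' ;;
     dot_code ''c'' ''a'' ''a'' ;;
     set_scalar ''w'' (RSqrt (scalar ''c'')) ;;
     IfLess (RConst 1) (scalar ''w'')
       (For ''i'' dim_n
          (set1 ''p'' ''i''
             (RMul (RDiv (RSub (RDiv (RConst 1) (scalar ''w'')) (RConst 1)) (scalar ''c''))
                (cell1 ''a'' ''i''))) ;;
        For ''i'' dim_n (set1 ''y'' ''i'' (RDiv (cell1 ''y'' ''i'') (cell1 ''s'' ''i''))) ;;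
        mult_code ''q'' ''V'' ''y'' ;;
        Svd ''U'' ''s'' ''V'' ''p'' ''q'' ;;
        For ''i'' dim_n
          (set1 ''s'' ''i'' (RMax (cell1 ''s'' ''i'') (RDiv (scalar ''M'') (scalar ''xi'')))))"

definition output_code :: com where
  "output_code =
     For ''i'' dim_n
       (For ''j'' dim_n
          (set2 ''A'' ''i'' ''j'' (RConst 0) ;;
           For ''k'' dim_n
             (set2 ''A'' ''i'' ''j''
                (RAdd (cell2 ''A'' ''i'' ''j'')
                   (RMul (RDiv (cell2 ''U'' ''i'' ''k'') (cell1 ''s'' ''k''))
                      (cell2 ''V'' ''j'' ''k''))))))"

definition scale_indep_code :: com where
  "scale_indep_code =
     init_code ;;
     For ''t'' (NSub (NVar ''n'') (NConst 1)) step_code ;;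
     output_code"

definition final_machine ::
  "svd_proc \<Rightarrow> nat \<Rightarrow> nat \<Rightarrow> (nat \<Rightarrow> real vec) \<Rightarrow> real \<Rightarrow> machine" where
  "final_machine svd d n x \<xi> = exec svd d x scale_indep_code (initial_machine d n \<xi>)"

text \<open>
  The storage is the number of all real memory cells that the program ever uses, temporaries
  included, so it bounds in particular the number of reals kept between two iterations.
  Working memory internal to the SVD update procedure is not counted.
\<close>

definition running_time ::
  "svd_proc \<Rightarrow> nat \<Rightarrow> nat \<Rightarrow> (nat \<Rightarrow> real vec) \<Rightarrow> real \<Rightarrow> nat" where
  "running_time svd d n x \<xi> = time (final_machine svd d n x \<xi>)"

definition storage ::
  "svd_proc \<Rightarrow> nat \<Rightarrow> nat \<Rightarrow> (nat \<Rightarrow> real vec) \<Rightarrow> real \<Rightarrow> nat" where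
  "storage svd d n x \<xi> = card (touched (final_machine svd d n x \<xi>))"

text \<open>
  The program ends with \<open>U\<^sub>n\<close>, \<open>\<Sigma>\<^sub>n\<close>, \<open>V\<^sub>n\<close> and \<open>A\<^sub>n\<close> of some execution of the algorithm in memory.
\<close>

definition computes_run ::
  "svd_proc \<Rightarrow> nat \<Rightarrow> nat \<Rightarrow> (nat \<Rightarrow> real vec) \<Rightarrow> real \<Rightarrow> bool" where
  "computes_run svd d n x \<xi> \<longleftrightarrow>
     (\<exists>U s V. scale_indep_run d n x \<xi> U s V \<and>
        (let \<mu> = memory (final_machine svd d n x \<xi>) in
           mem_mat d \<mu> ''U'' = U n \<and> mem_vec d \<mu> ''s'' = s n \<and> mem_mat d \<mu> ''V'' = V n \<and>
           mem_mat d \<mu> ''A'' = inv_factored d (U n) (s n) (V n)))"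

end

(*
Let A = U Sigma^-1 V^T describe the current ellipsoid and let q(z) = |A^-T z|^2 be the square
of its support function.  An update by a point x with |A x| = alpha > 1 adds
(1 - 1/alpha^2) <x,z>^2 to q(z) and multiplies the squared volume by alpha^2, and
1 - 1/alpha^2 <= ln(alpha^2).  Clamping the singular values at m = M_t / xi adds at most
c m^2 |z|^2, where c is at most 1 and at most the increase of the logarithm of the squared volume.
If h denotes the support function of X, then <x,z>^2 <= h(z)^2, and m |z| <= h(z) because
kappa(X) <= xi.  Hence q grows by at most h^2 times the growth of the logarithm of the squared
volume, which the inequality of arithmetic and geometric means bounds through the trace, that
is, the sum of the squares of the singular values.

Since |x_1| may be arbitrarily small compared with the later points, this is applied only
after the last time T with M_T < M_n / xi.  Up to T, q(z) <= trace |z|^2 is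
already of order d (ln xi) h(z)^2; from the first update after T on, the clamping bounds the volume
from below.  The trace bound d (8 + 4 ln xi) M_t^2 used here follows in the same way with the
threshold M_t / 2.  The inequality q <= alpha^2 h^2 between support functions gives the inclusion
of the bodies by separation.

For the program, n >= d holds because X is full-dimensional, so that even the final cubic matrix
product costs only O(n d^2).
*)
theory Submission
  imports Defs "Jordan_Normal_Form.Determinant"
begin

section \<open>Euclidean norm, reflections and rank-one matrices\<close>

text \<open>Charging to the logarithm of the volume alone cannot work: up to the first update after
  T the volume has no lower bound in terms of M_n, so the increase of its logarithm is unbounded.
  Every update therefore gets a second, flat bound (\<open>2 h^2\<close> for q,
  \<open>2 d M_t^2\<close> for the trace). It is spent at most once, on that first update or on the
  initial ellipsoid; afterwards the logarithmic charges telescope from a clamped volume.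
  \<open>potential_growth\<close> isolates this bookkeeping for both potentials.

  The threshold M_n / xi is the largest one for which M_T |z| <= h(z) is guaranteed; its price is
  that later clamped values are only known to be at least M_n / xi^2.

  All estimates are made on the dual side because there both operations are additive: the rank-one
  step adds the square of a linear form to q, and clamping adds a form that is diagonal in the basis
  V. On the primal side both would involve inverses.\<close>

lemma enorm_nonneg: "0 \<le> enorm v"
  unfolding enorm_def scalar_prod_def by (simp add: sum_nonneg)

lemma scalar_prod_self_nonneg: "0 \<le> v \<bullet> (v :: real vec)"
  unfolding scalar_prod_def by (simp add: sum_nonneg)

lemma enorm_sq: "(enorm v)\<^sup>2 = v \<bullet> v"
  unfolding enorm_def using scalar_prod_self_nonneg[of v] by simp

lemma enorm_smult: "enorm (c \<cdot>\<^sub>v v) = \<bar>c\<bar> * enorm v"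
proof -
  have "(c \<cdot>\<^sub>v v) \<bullet> (c \<cdot>\<^sub>v v) = c\<^sup>2 * (v \<bullet> v)"
    by (simp add: power2_eq_square)
  then show ?thesis by (simp add: enorm_def real_sqrt_mult)
qed

lemma enorm_eq_0_iff:
  assumes "v \<in> carrier_vec d"
  shows "enorm v = 0 \<longleftrightarrow> v = 0\<^sub>v d"
proof
  assume "enorm v = 0"
  then have "v \<bullet> v = 0" by (metis enorm_sq zero_power2)
  then have "(\<Sum>i\<in>{0..<dim_vec v}. v $ i * v $ i) = 0" by (simp add: scalar_prod_def)
  then have "\<forall>i\<in>{0..<dim_vec v}. v $ i * v $ i = 0"
    by (subst (asm) sum_nonneg_eq_0_iff) auto
  then show "v = 0\<^sub>v d" using assms by auto
qed (simp add: enorm_def)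

text \<open>Cauchy-Schwarz, by expanding \<open>0 \<le> |b v - a w|^2\<close> with
  \<open>a = |v|\<close> and \<open>b = |w|\<close>. The case of a zero norm is split off because
  the expansion is divided by \<open>2 a b\<close>.\<close>

lemma scalar_prod_le_enorm:
  assumes v: "v \<in> carrier_vec d" and w: "w \<in> carrier_vec d"
  shows "v \<bullet> w \<le> enorm v * enorm w"
proof (cases "enorm v = 0 \<or> enorm w = 0")
  case True
  then show ?thesis using v w by (auto simp: enorm_eq_0_iff enorm_nonneg)
next
  case False
  define a where "a = enorm v"
  define b where "b = enorm w"
  have ab: "0 < a" "0 < b" using False enorm_nonneg[of v] enorm_nonneg[of w]
    by (auto simp: a_def b_def)
  have aa: "v \<bullet> v = a\<^sup>2" "w \<bullet> w = b\<^sup>2" by (simp_all add: a_def b_def enorm_sq)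
  let ?u = "b \<cdot>\<^sub>v v - a \<cdot>\<^sub>v w"
  have "0 \<le> ?u \<bullet> ?u" by (rule scalar_prod_self_nonneg)
  also have "?u \<bullet> ?u = b\<^sup>2 * (v \<bullet> v) - 2 * a * b * (v \<bullet> w) + a\<^sup>2 * (w \<bullet> w)"
    using v w comm_scalar_prod[OF v w]
    by (simp add: minus_scalar_prod_distrib[of _ d] scalar_prod_minus_distrib[of _ d] algebra_simps
        power2_eq_square)
  finally have "2 * a * b * (v \<bullet> w) \<le> 2 * a * b * (a * b)"
    by (simp add: aa power2_eq_square algebra_simps)
  then show ?thesis using ab mult_le_cancel_left_pos[of "2 * a * b"]
    by (simp add: a_def b_def)
qed

lemma enorm_uminus: "enorm (- v) = enorm v"
  by (simp add: enorm_def)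

lemma abs_scalar_prod_le_enorm:
  assumes v: "v \<in> carrier_vec d" and w: "w \<in> carrier_vec d"
  shows "\<bar>v \<bullet> w\<bar> \<le> enorm v * enorm w"
  using scalar_prod_le_enorm[OF v w] scalar_prod_le_enorm[of "- v" d w] v w
  by (simp add: enorm_uminus)

lemma mat_eq_vecI:
  assumes A: "(A :: real mat) \<in> carrier_mat d d" and B: "B \<in> carrier_mat d d"
    and eq: "\<And>v. v \<in> carrier_vec d \<Longrightarrow> A *\<^sub>v v = B *\<^sub>v v"
  shows "A = B"
proof (rule eq_matI)
  fix i j assume ij: "i < dim_row B" "j < dim_col B"
  then have i: "i < d" and j: "j < d" using B by auto
  have "(A *\<^sub>v unit_vec d j) $ i = (B *\<^sub>v unit_vec d j) $ i" using eq by simp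
  then show "A $$ (i, j) = B $$ (i, j)"
    using i j A B by simp
qed (use A B in auto)

lemma outer_prod_carrier [simp]:
  "v \<in> carrier_vec d \<Longrightarrow> w \<in> carrier_vec d \<Longrightarrow> outer_prod v w \<in> carrier_mat d d"
  by (auto simp: outer_prod_def)

lemma outer_prod_mult_vec:
  assumes "v \<in> carrier_vec d" "w \<in> carrier_vec d" "u \<in> carrier_vec d"
  shows "outer_prod v w *\<^sub>v u = (w \<bullet> u) \<cdot>\<^sub>v v"
  using assms
  by (intro eq_vecI)
     (auto simp: outer_prod_def scalar_prod_def sum_distrib_left ac_simps intro!: sum.cong)

lemma mat_diag_mult_vec:
  assumes "v \<in> carrier_vec d"
  shows "mat_diag d f *\<^sub>v v = vec d (\<lambda>i. f i * v $ i)"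
proof (rule eq_vecI)
  fix i assume "i < dim_vec (vec d (\<lambda>i. f i * v $ i))"
  then have i: "i < d" by simp
  have "(mat_diag d f *\<^sub>v v) $ i = (\<Sum>j\<in>{0..<d}. (if i = j then f j else 0) * v $ j)"
    using i assms by (simp add: mat_diag_def scalar_prod_def)
  also have "\<dots> = (\<Sum>j\<in>{0..<d}. if i = j then f i * v $ i else 0)"
    by (intro sum.cong) auto
  finally show "(mat_diag d f *\<^sub>v v) $ i = vec d (\<lambda>i. f i * v $ i) $ i" using i by simp
qed (simp add: mat_diag_def)

lemma det_mat_diag: "det (mat_diag d f) = (\<Prod>i<d. f i :: real)"
proof -
  have "det (mat_diag d f) = prod_list (diag_mat (mat_diag d f))"
    by (rule det_upper_triangular[of _ d]) (auto simp: mat_diag_def)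
  also have "diag_mat (mat_diag d f) = map f [0..<d]"
    by (auto simp: diag_mat_def mat_diag_def)
  also have "prod_list \<dots> = (\<Prod>i<d. f i)"
    by (simp add: prod.list_conv_set_nth lessThan_atLeast0)
  finally show ?thesis .
qed

lemma orthogonal_matrixD:
  assumes "orthogonal_matrix_of d U"
  shows "U \<in> carrier_mat d d" "U\<^sup>T \<in> carrier_mat d d" "U\<^sup>T * U = 1\<^sub>m d" "U * U\<^sup>T = 1\<^sub>m d"
  using assms by (auto simp: orthogonal_matrix_of_def)

lemma orthogonal_matrix_transpose:
  "orthogonal_matrix_of d U \<Longrightarrow> orthogonal_matrix_of d U\<^sup>T"
  by (auto simp: orthogonal_matrix_of_def)

lemma orthogonal_cancel:
  assumes "orthogonal_matrix_of d U" "v \<in> carrier_vec d"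
  shows "U *\<^sub>v (U\<^sup>T *\<^sub>v v) = v" "U\<^sup>T *\<^sub>v (U *\<^sub>v v) = v"
  using assms orthogonal_matrixD[OF assms(1)]
  by (metis assoc_mult_mat_vec one_mult_mat_vec)+

lemma orthogonal_scalar_prod:
  assumes "orthogonal_matrix_of d U" "v \<in> carrier_vec d" "w \<in> carrier_vec d"
  shows "(U *\<^sub>v v) \<bullet> (U *\<^sub>v w) = v \<bullet> w"
proof -
  note U = orthogonal_matrixD[OF assms(1)]
  have "(U *\<^sub>v v) \<bullet> (U *\<^sub>v w) = (U\<^sup>T *\<^sub>v (U *\<^sub>v v)) \<bullet> w"
    using transpose_vec_mult_scalar[OF U(1) assms(3), of "U *\<^sub>v v"] U assms(2) by simp
  then show ?thesis by (simp add: orthogonal_cancel(2)[OF assms(1,2)])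
qed

lemma orthogonal_det_sq:
  assumes "orthogonal_matrix_of d U"
  shows "(det U)\<^sup>2 = 1"
proof -
  note U = orthogonal_matrixD[OF assms]
  have "det U * det U = det (U * U\<^sup>T)"
    using det_mult[OF U(1,2)] det_transpose[OF U(1)] by simp
  then show ?thesis by (simp add: U power2_eq_square)
qed

text \<open>For \<open>h = 0\<close> this is the identity, as division by zero yields 0.\<close>

definition householder :: "nat \<Rightarrow> real vec \<Rightarrow> real mat" where
  "householder d h = 1\<^sub>m d - (2 / (h \<bullet> h)) \<cdot>\<^sub>m outer_prod h h"

lemma householder_carrier:
  "h \<in> carrier_vec d \<Longrightarrow> householder d h \<in> carrier_mat d d"
  by (auto simp: householder_def outer_prod_def)

lemma householder_symmetric:
  "h \<in> carrier_vec d \<Longrightarrow> (householder d h)\<^sup>T = householder d h"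
  by (intro eq_matI) (auto simp: householder_def outer_prod_def)

lemma smult_mat_mult_vec:
  assumes "A \<in> carrier_mat d d" "v \<in> carrier_vec d"
  shows "(c \<cdot>\<^sub>m A) *\<^sub>v v = (c :: real) \<cdot>\<^sub>v (A *\<^sub>v v)"
  using assms by (intro eq_vecI) auto

lemma householder_mult_vec:
  assumes h: "h \<in> carrier_vec d" and v: "v \<in> carrier_vec d"
  shows "householder d h *\<^sub>v v = v - (2 * (h \<bullet> v) / (h \<bullet> h)) \<cdot>\<^sub>v h"
proof -
  have "householder d h *\<^sub>v v = v - (2 / (h \<bullet> h)) \<cdot>\<^sub>v (outer_prod h h *\<^sub>v v)"
    unfolding householder_def using h v
    by (subst minus_mult_distrib_mat_vec[of _ d d]) (auto simp: smult_mat_mult_vec[of _ d])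
  then show ?thesis using h v by (simp add: outer_prod_mult_vec smult_smult_assoc)
qed

text \<open>A reflection negates \<open>h \<bullet> v\<close>, so its second application adds back
  what the first one subtracted. If \<open>h \<bullet> h = 0\<close>, both coefficients are
  quotients by zero and vanish.\<close>

lemma householder_orthogonal:
  assumes h: "h \<in> carrier_vec d"
  shows "orthogonal_matrix_of d (householder d h)"
proof -
  note H = householder_carrier[OF h]
  have "householder d h * householder d h = 1\<^sub>m d"
  proof (rule mat_eq_vecI)
    fix v :: "real vec" assume v: "v \<in> carrier_vec d"
    have hc: "h \<bullet> (v - (2 * (h \<bullet> v) / (h \<bullet> h)) \<cdot>\<^sub>v h) = h \<bullet> v - (2 * (h \<bullet> v) / (h \<bullet> h)) * (h \<bullet> h)"
      using h v by (simp add: scalar_prod_minus_distrib[of _ d])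
    have "(householder d h * householder d h) *\<^sub>v v
        = householder d h *\<^sub>v (householder d h *\<^sub>v v)"
      using H v by (simp add: assoc_mult_mat_vec[of _ d d])
    also have "\<dots> = v"
    proof (cases "h \<bullet> h = 0")
      case True
      then show ?thesis using h v by (simp add: householder_mult_vec) (auto intro!: eq_vecI)
    next
      case False
      have "h \<bullet> (householder d h *\<^sub>v v) = - (h \<bullet> v)"
        using False hc h v by (simp add: householder_mult_vec)
      moreover have "householder d h *\<^sub>v v \<in> carrier_vec d" using H v by simp
      ultimately have "householder d h *\<^sub>v (householder d h *\<^sub>v v)
          = (v - (2 * (h \<bullet> v) / (h \<bullet> h)) \<cdot>\<^sub>v h) - (2 * - (h \<bullet> v) / (h \<bullet> h)) \<cdot>\<^sub>v h"
        using h v by (simp add: householder_mult_vec)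
      also have "\<dots> = v" using h v by (auto intro!: eq_vecI)
      finally show ?thesis .
    qed
    finally show "(householder d h * householder d h) *\<^sub>v v = 1\<^sub>m d *\<^sub>v v" using v by simp
  qed (use H in auto)
  then show ?thesis
    using H by (simp add: orthogonal_matrix_of_def householder_symmetric[OF h])
qed

text \<open>For unit vectors, \<open>h = e - w\<close> satisfies
  \<open>h \<bullet> h = - 2 (h \<bullet> w)\<close>, so the reflection adds exactly
  \<open>h\<close> to \<open>w\<close>. This serves the determinant of a rank-one perturbation as
  well as the initial \<open>V 1\<close>.\<close>

lemma householder_maps:
  assumes e: "e \<in> carrier_vec d" "e \<bullet> e = 1" and w: "w \<in> carrier_vec d" "w \<bullet> w = 1"
  shows "householder d (e - w) *\<^sub>v w = e"
proof -
  let ?h = "e - w"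
  have h: "?h \<in> carrier_vec d" using e w by simp
  have hw: "?h \<bullet> w = e \<bullet> w - 1" and hh: "?h \<bullet> ?h = 2 - 2 * (e \<bullet> w)"
    using e w comm_scalar_prod[OF e(1) w(1)]
    by (simp_all add: minus_scalar_prod_distrib[of _ d] scalar_prod_minus_distrib[of _ d])
  show ?thesis
  proof (cases "?h \<bullet> ?h = 0")
    case True
    then have "enorm ?h = 0" by (simp add: enorm_def)
    then have h0: "?h = 0\<^sub>v d" using enorm_eq_0_iff[OF h] by simp
    have "e = w"
    proof (rule eq_vecI)
      fix i assume i: "i < dim_vec w"
      then have "?h $ i = 0" using h0 w by simp
      then show "e $ i = w $ i" using i e w by simp
    qed (use e w in auto)
    then show ?thesis using w True by (simp add: householder_mult_vec) (auto intro!: eq_vecI)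
  next
    case False
    then have "2 * (?h \<bullet> w) / (?h \<bullet> ?h) = -1" by (simp add: hw hh field_simps)
    then have "householder d ?h *\<^sub>v w = w - (-1) \<cdot>\<^sub>v ?h" using h w by (simp add: householder_mult_vec)
    then show ?thesis using e w by (auto intro!: eq_vecI)
  qed
qed

section \<open>Rank-one perturbations of the identity\<close>

lemma rank_one_mult_vec:
  fixes a v :: "real vec"
  assumes a: "a \<in> carrier_vec d" and v: "v \<in> carrier_vec d"
  shows "(1\<^sub>m d - k \<cdot>\<^sub>m outer_prod a a) *\<^sub>v v = v - (k * (a \<bullet> v)) \<cdot>\<^sub>v a"
  using a v
  by (subst minus_mult_distrib_mat_vec[of _ d d])
     (auto simp: smult_mat_mult_vec[of _ d] outer_prod_mult_vec smult_smult_assoc)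

text \<open>Conjugation by a reflection that sends \<open>a\<close> to a multiple of the first unit
  vector makes the matrix diagonal with all entries but the first equal to 1. The squared
  determinant of the reflection is 1.\<close>

lemma det_rank_one:
  fixes a :: "real vec"
  assumes a: "a \<in> carrier_vec d" and d: "1 \<le> d" and a0: "a \<bullet> a \<noteq> 0"
  shows "det (1\<^sub>m d - k \<cdot>\<^sub>m outer_prod a a) = 1 - k * (a \<bullet> a)"
proof -
  let ?P = "1\<^sub>m d - k \<cdot>\<^sub>m outer_prod a a"
  define r where "r = enorm a"
  have r2: "r * r = a \<bullet> a" using enorm_sq[of a] by (simp add: r_def power2_eq_square)
  then have r0: "r \<noteq> 0" using a0 by auto
  define w where "w = (1 / r) \<cdot>\<^sub>v a"
  define e where "e = (unit_vec d 0 :: real vec)"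
  have w: "w \<in> carrier_vec d" and ww: "w \<bullet> w = 1" and aw: "a = r \<cdot>\<^sub>v w"
    using a r0 r2 by (auto simp: w_def smult_smult_assoc)
  have e: "e \<in> carrier_vec d" "e \<bullet> e = 1" using d by (auto simp: e_def)
  have h: "e - w \<in> carrier_vec d" using e w by simp
  define H where "H = householder d (e - w)"
  have oH: "orthogonal_matrix_of d H" and sH: "H\<^sup>T = H"
    using householder_orthogonal[OF h] householder_symmetric[OF h] by (auto simp: H_def)
  note H = orthogonal_matrixD[OF oH]
  have Hw: "H *\<^sub>v w = e" unfolding H_def by (rule householder_maps[OF e w ww])
  then have Ha: "H *\<^sub>v a = r \<cdot>\<^sub>v e" using H w by (simp add: aw mult_mat_vec[of _ d d])
  have P: "?P \<in> carrier_mat d d" using a by (simp add: minus_carrier_mat)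
  have "H * ?P * H = mat_diag d (\<lambda>i. if i = 0 then 1 - k * (a \<bullet> a) else 1)" (is "_ = ?D")
  proof (rule mat_eq_vecI)
    fix v :: "real vec" assume v: "v \<in> carrier_vec d"
    have Hv: "H *\<^sub>v v \<in> carrier_vec d" using H v by simp
    have "a \<bullet> (H *\<^sub>v v) = (r \<cdot>\<^sub>v e) \<bullet> v"
      using transpose_vec_mult_scalar[OF H(1) v a] by (simp add: sH Ha)
    also have "\<dots> = r * v $ 0" using d v e by (simp add: e_def)
    finally have aHv: "a \<bullet> (H *\<^sub>v v) = r * v $ 0" .
    have "(H * ?P * H) *\<^sub>v v = H *\<^sub>v (?P *\<^sub>v (H *\<^sub>v v))"
      using H P v by (simp add: assoc_mult_mat_vec[of _ d d _ d])
    also have "\<dots> = H *\<^sub>v (H *\<^sub>v v - (k * (r * v $ 0)) \<cdot>\<^sub>v a)"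
      by (simp add: rank_one_mult_vec[OF a Hv] aHv)
    also have "\<dots> = v - (k * (r * v $ 0)) \<cdot>\<^sub>v (r \<cdot>\<^sub>v e)"
      using H v a Hv orthogonal_cancel[OF oH v] sH
      by (simp add: mult_minus_distrib_mat_vec[of _ d d] mult_mat_vec[of _ d d] Ha)
    also have "\<dots> = ?D *\<^sub>v v"
      using v d r2[symmetric]
      by (auto intro!: eq_vecI simp: mat_diag_mult_vec e_def algebra_simps)
    finally show "(H * ?P * H) *\<^sub>v v = ?D *\<^sub>v v" .
  qed (use H P in auto)
  then have "det (H * ?P * H) = (\<Prod>i<d. if i = 0 then 1 - k * (a \<bullet> a) else 1)"
    by (simp add: det_mat_diag)
  also have "\<dots> = 1 - k * (a \<bullet> a)" using d by (simp add: prod.delta)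
  also have "det (H * ?P * H) = (det H)\<^sup>2 * det ?P"
    using H P by (simp add: det_mult[of _ d] power2_eq_square)
  finally show ?thesis by (simp add: orthogonal_det_sq[OF oH])
qed

section \<open>Ellipsoids in factored form\<close>

text \<open>\<open>svd_inv\<close> without the decomposed matrix: the part of the state that
  clamping preserves and that serves as the invariant of a run.\<close>

definition svd_factors :: "nat \<Rightarrow> real mat \<Rightarrow> real vec \<Rightarrow> real mat \<Rightarrow> bool" where
  "svd_factors d U s V \<longleftrightarrow> orthogonal_matrix_of d U \<and> orthogonal_matrix_of d V \<and>
     s \<in> carrier_vec d \<and> (\<forall>i<d. 0 < s $ i)"

text \<open>For \<open>A = U \<Sigma>\<^sup>-\<^sup>1 V\<^sup>T\<close>, this is \<open>A\<^sup>-\<^sup>T\<close>.\<close>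

definition inv_transpose :: "nat \<Rightarrow> real mat \<Rightarrow> real vec \<Rightarrow> real mat \<Rightarrow> real mat" where
  "inv_transpose d U s V = U * mat_diag d (\<lambda>i. s $ i) * V\<^sup>T"

text \<open>The square of the support function of the ellipsoid of \<open>U \<Sigma>\<^sup>-\<^sup>1 V\<^sup>T\<close>.\<close>

definition dual_form :: "nat \<Rightarrow> real vec \<Rightarrow> real mat \<Rightarrow> real vec \<Rightarrow> real" where
  "dual_form d s V z = (\<Sum>i<d. (s $ i * (V\<^sup>T *\<^sub>v z) $ i)\<^sup>2)"

lemma scalar_prod_diff_smult:
  fixes a w :: "real vec"
  assumes "w \<in> carrier_vec d" "a \<in> carrier_vec d"
  shows "(w - c \<cdot>\<^sub>v a) \<bullet> (w - c \<cdot>\<^sub>v a) = w \<bullet> w - 2 * c * (w \<bullet> a) + c\<^sup>2 * (a \<bullet> a)"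
  using assms comm_scalar_prod[OF assms]
  by (simp add: minus_scalar_prod_distrib[of _ d] scalar_prod_minus_distrib[of _ d]
      power2_eq_square algebra_simps)

context
  fixes d :: nat and U V :: "real mat" and s :: "real vec"
  assumes factors: "svd_factors d U s V"
begin

private lemma UV:
  "orthogonal_matrix_of d U" "orthogonal_matrix_of d V" "s \<in> carrier_vec d"
  "\<And>i. i < d \<Longrightarrow> 0 < s $ i"
  using factors by (auto simp: svd_factors_def)

private lemmas U = orthogonal_matrixD[OF UV(1)]
private lemmas V = orthogonal_matrixD[OF UV(2)]

lemma inv_factored_carrier: "inv_factored d U s V \<in> carrier_mat d d"
  using U(1) V(1) by (auto simp: inv_factored_def mat_diag_def)

lemma inv_transpose_carrier: "inv_transpose d U s V \<in> carrier_mat d d"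
  using U(1) V(1) by (auto simp: inv_transpose_def mat_diag_def)

lemma inv_factored_mult_vec:
  assumes "v \<in> carrier_vec d"
  shows "inv_factored d U s V *\<^sub>v v = U *\<^sub>v vec d (\<lambda>i. (V\<^sup>T *\<^sub>v v) $ i / s $ i)"
proof -
  have Vv: "V\<^sup>T *\<^sub>v v \<in> carrier_vec d" using V(2) assms by simp
  have "inv_factored d U s V *\<^sub>v v = U *\<^sub>v (mat_diag d (\<lambda>i. inverse (s $ i)) *\<^sub>v (V\<^sup>T *\<^sub>v v))"
    unfolding inv_factored_def using U(1) V(2) assms
    by (simp add: assoc_mult_mat_vec[of _ d d _ d] mult_carrier_mat[of _ d d] del: assoc_mult_mat)
  then show ?thesis using Vv by (simp add: mat_diag_mult_vec divide_inverse mult.commute)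
qed

lemma inv_transpose_mult_vec:
  assumes "v \<in> carrier_vec d"
  shows "inv_transpose d U s V *\<^sub>v v = U *\<^sub>v vec d (\<lambda>i. s $ i * (V\<^sup>T *\<^sub>v v) $ i)"
proof -
  have Vv: "V\<^sup>T *\<^sub>v v \<in> carrier_vec d" using V(2) assms by simp
  have "inv_transpose d U s V *\<^sub>v v = U *\<^sub>v (mat_diag d (\<lambda>i. s $ i) *\<^sub>v (V\<^sup>T *\<^sub>v v))"
    unfolding inv_transpose_def using U(1) V(2) assms
    by (simp add: assoc_mult_mat_vec[of _ d d _ d] mult_carrier_mat[of _ d d] del: assoc_mult_mat)
  then show ?thesis using Vv by (simp add: mat_diag_mult_vec)
qed

lemma inv_factored_norm:
  assumes "v \<in> carrier_vec d"
  shows "(enorm (inv_factored d U s V *\<^sub>v v))\<^sup>2 = (\<Sum>i<d. ((V\<^sup>T *\<^sub>v v) $ i / s $ i)\<^sup>2)"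
  unfolding inv_factored_mult_vec[OF assms] enorm_sq
  by (subst orthogonal_scalar_prod[OF UV(1)]) (simp_all add: scalar_prod_def lessThan_atLeast0 power2_eq_square)

lemma inv_transpose_norm:
  assumes "v \<in> carrier_vec d"
  shows "(enorm (inv_transpose d U s V *\<^sub>v v))\<^sup>2 = dual_form d s V v"
  unfolding inv_transpose_mult_vec[OF assms] enorm_sq
  by (subst orthogonal_scalar_prod[OF UV(1)]) (simp_all add: scalar_prod_def lessThan_atLeast0 power2_eq_square dual_form_def)

text \<open>The diagonals \<open>s\<close> and \<open>1 / s\<close> cancel between equal orthogonal
  factors. This pairing stands in for the matrix identity \<open>(A^-T)^T A = I\<close>.\<close>

lemma inv_transpose_duality:
  assumes z: "z \<in> carrier_vec d" and v: "v \<in> carrier_vec d"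
  shows "(inv_transpose d U s V *\<^sub>v z) \<bullet> (inv_factored d U s V *\<^sub>v v) = z \<bullet> v"
proof -
  have "(inv_transpose d U s V *\<^sub>v z) \<bullet> (inv_factored d U s V *\<^sub>v v)
      = vec d (\<lambda>i. s $ i * (V\<^sup>T *\<^sub>v z) $ i) \<bullet> vec d (\<lambda>i. (V\<^sup>T *\<^sub>v v) $ i / s $ i)"
    by (simp add: inv_transpose_mult_vec[OF z] inv_factored_mult_vec[OF v]
        orthogonal_scalar_prod[OF UV(1)])
  also have "\<dots> = (V\<^sup>T *\<^sub>v z) \<bullet> (V\<^sup>T *\<^sub>v v)"
    using UV(4) V(1) by (auto simp: scalar_prod_def intro!: sum.cong) (metis less_irrefl)
  finally show ?thesis using orthogonal_scalar_prod[OF orthogonal_matrix_transpose[OF UV(2)] z v] by simp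
qed

lemma inv_factored_surj:
  assumes u: "u \<in> carrier_vec d"
  obtains v where "v \<in> carrier_vec d" "inv_factored d U s V *\<^sub>v v = u"
proof
  let ?y = "vec d (\<lambda>i. s $ i * (U\<^sup>T *\<^sub>v u) $ i)"
  show v: "V *\<^sub>v ?y \<in> carrier_vec d" using V(1) by simp
  have "V\<^sup>T *\<^sub>v (V *\<^sub>v ?y) = ?y" by (simp add: orthogonal_cancel[OF UV(2)])
  then have "vec d (\<lambda>i. (V\<^sup>T *\<^sub>v (V *\<^sub>v ?y)) $ i / s $ i) = U\<^sup>T *\<^sub>v u"
    using UV(4) U(1) by (intro eq_vecI) (auto, metis less_irrefl)
  then show "inv_factored d U s V *\<^sub>v (V *\<^sub>v ?y) = u"
    by (simp only: inv_factored_mult_vec[OF v] orthogonal_cancel[OF UV(1) u])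
qed

text \<open>\<open>A\<close> is surjective, so the pairings with all \<open>A v\<close> determine a
  vector. An inverse transpose can thus be verified by testing a candidate instead of inverting a
  matrix.\<close>

lemma inv_transpose_unique:
  assumes y: "y \<in> carrier_vec d" and z: "z \<in> carrier_vec d"
    and eq: "\<And>v. v \<in> carrier_vec d \<Longrightarrow> y \<bullet> (inv_factored d U s V *\<^sub>v v) = z \<bullet> v"
  shows "y = inv_transpose d U s V *\<^sub>v z"
proof (rule eq_vecI)
  let ?w = "inv_transpose d U s V *\<^sub>v z"
  have w: "?w \<in> carrier_vec d" using inv_transpose_carrier z by simp
  fix i assume "i < dim_vec ?w"
  then have i: "i < d" using carrier_vecD[OF w] by simp
  obtain v where v: "v \<in> carrier_vec d" "inv_factored d U s V *\<^sub>v v = unit_vec d i"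
    using inv_factored_surj[of "unit_vec d i"] by auto
  have "y \<bullet> unit_vec d i = ?w \<bullet> unit_vec d i"
    using eq[OF v(1)] inv_transpose_duality[OF z v(1)] v(2) by simp
  then show "y $ i = ?w $ i" using i by simp
qed (use y inv_transpose_carrier z in auto)

text \<open>Only the square is computed, since \<open>det U\<close> and \<open>det V\<close> are
  known up to sign.\<close>

lemma inv_factored_det_sq: "(det (inv_factored d U s V))\<^sup>2 = 1 / (\<Prod>i<d. s $ i)\<^sup>2"
proof -
  have D: "mat_diag d (\<lambda>i. inverse (s $ i)) \<in> carrier_mat d d" by (rule mat_diag_dim)
  have "det (inv_factored d U s V) = det U * (\<Prod>i<d. inverse (s $ i)) * det V"
    unfolding inv_factored_def
    using det_mult[OF mult_carrier_mat[OF U(1) D] V(2)] det_mult[OF U(1) D]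
    by (simp add: det_mat_diag det_transpose[OF V(1)])
  then have "(det (inv_factored d U s V))\<^sup>2
      = (det U)\<^sup>2 * (\<Prod>i<d. inverse (s $ i))\<^sup>2 * (det V)\<^sup>2"
    by (simp add: power_mult_distrib)
  moreover have "(\<Prod>i\<in>I. inverse (s $ i)) = inverse (\<Prod>i\<in>I. s $ i)" if "finite I" for I
    using that by induction auto
  ultimately show ?thesis
    by (simp add: orthogonal_det_sq[OF UV(1)] orthogonal_det_sq[OF UV(2)] inverse_eq_divide
        power_one_over)
qed

lemma factors_prod_pos: "0 < (\<Prod>i<d. s $ i)"
  using UV(4) by (intro prod_pos) auto

text \<open>Both sides are the trace of \<open>V \<Sigma>^2 V^T\<close>. Through it, a formula for
  \<open>dual_form\<close> at single vectors becomes one for the sum of the squared singular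
  values.\<close>

lemma factors_trace: "(\<Sum>k<d. dual_form d s V (unit_vec d k)) = (\<Sum>i<d. (s $ i)\<^sup>2)"
proof -
  have ent: "(V\<^sup>T *\<^sub>v unit_vec d k) $ i = V $$ (k, i)" if "i < d" "k < d" for i k
    using V(1) that by simp
  have one: "(\<Sum>k<d. (V $$ (k, i))\<^sup>2) = 1" if "i < d" for i
  proof -
    have "(V\<^sup>T * V) $$ (i, i) = (\<Sum>k<d. (V $$ (k, i))\<^sup>2)"
      using V(1) that by (simp add: scalar_prod_def lessThan_atLeast0 power2_eq_square)
    then show ?thesis using V(3) that by simp
  qed
  have "(\<Sum>k<d. dual_form d s V (unit_vec d k)) = (\<Sum>k<d. \<Sum>i<d. (s $ i)\<^sup>2 * (V $$ (k, i))\<^sup>2)"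
    unfolding dual_form_def by (intro sum.cong refl) (simp add: ent power_mult_distrib)
  also have "\<dots> = (\<Sum>i<d. (s $ i)\<^sup>2 * (\<Sum>k<d. (V $$ (k, i))\<^sup>2))"
    by (subst sum.swap) (simp add: sum_distrib_left)
  also have "\<dots> = (\<Sum>i<d. (s $ i)\<^sup>2)" by (intro sum.cong refl) (simp add: one)
  finally show ?thesis .
qed

section \<open>Effect of the rank-one step on norms, determinant and dual form\<close>

lemma rank_one_step_mult_vec:
  fixes x :: "real vec" and v :: "real vec"
  defines "a \<equiv> inv_factored d U s V *\<^sub>v x"
  assumes x: "x \<in> carrier_vec d" and v: "v \<in> carrier_vec d"
  shows "rank_one_step d (inv_factored d U s V) x *\<^sub>v v
    = inv_factored d U s V *\<^sub>v v
      - ((1 - 1 / enorm a) / (enorm a)\<^sup>2 * (a \<bullet> (inv_factored d U s V *\<^sub>v v))) \<cdot>\<^sub>v a"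
proof -
  have a: "a \<in> carrier_vec d" using inv_factored_carrier x by (simp add: a_def)
  show ?thesis
    unfolding rank_one_step_def Let_def a_def[symmetric]
    using a v inv_factored_carrier
    by (subst assoc_mult_mat_vec[of _ d d _ d])
       (simp_all add: rank_one_mult_vec minus_carrier_mat)
qed

lemma rank_one_step_carrier:
  "x \<in> carrier_vec d \<Longrightarrow> rank_one_step d (inv_factored d U s V) x \<in> carrier_mat d d"
  unfolding rank_one_step_def Let_def using inv_factored_carrier
  by (intro mult_carrier_mat[of _ d d] minus_carrier_mat smult_carrier_mat outer_prod_carrier
      mult_mat_vec_carrier[of _ d d])

text \<open>Along \<open>a\<close> the step scales by \<open>1 / \<alpha>\<close>, and orthogonally
  to \<open>a\<close> it is the identity. With \<open>k \<alpha>^2 = 1 - 1 / \<alpha>\<close>, the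
  squared norm of \<open>w\<close> drops by
  \<open>k (1 + 1 / \<alpha>) (a \<bullet> w)^2\<close>.\<close>

lemma rank_one_step_norm_le:
  assumes x: "x \<in> carrier_vec d" and v: "v \<in> carrier_vec d"
    and gt: "1 < enorm (inv_factored d U s V *\<^sub>v x)"
  shows "enorm (rank_one_step d (inv_factored d U s V) x *\<^sub>v v) \<le> enorm (inv_factored d U s V *\<^sub>v v)"
    and "enorm (rank_one_step d (inv_factored d U s V) x *\<^sub>v x) = 1"
proof -
  define a where "a = inv_factored d U s V *\<^sub>v x"
  define w where "w = inv_factored d U s V *\<^sub>v v"
  define \<alpha> where "\<alpha> = enorm a"
  define k where "k = (1 - 1 / \<alpha>) / \<alpha>\<^sup>2"
  have \<alpha>: "1 < \<alpha>" using gt by (simp add: \<alpha>_def a_def)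
  have aa: "a \<bullet> a = \<alpha>\<^sup>2" by (simp add: \<alpha>_def enorm_sq)
  have a: "a \<in> carrier_vec d" and w: "w \<in> carrier_vec d"
    using inv_factored_carrier x v by (simp_all add: a_def w_def)
  have k0: "0 \<le> k" and k2: "k * \<alpha>\<^sup>2 = 1 - 1 / \<alpha>" using \<alpha> by (simp_all add: k_def)
  have eq: "rank_one_step d (inv_factored d U s V) x *\<^sub>v v = w - (k * (a \<bullet> w)) \<cdot>\<^sub>v a"
    using rank_one_step_mult_vec[OF x v] by (simp add: a_def w_def \<alpha>_def k_def)
  have "(enorm (w - (k * (a \<bullet> w)) \<cdot>\<^sub>v a))\<^sup>2 = (enorm w)\<^sup>2 - k * (2 - k * \<alpha>\<^sup>2) * (a \<bullet> w)\<^sup>2"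
    using scalar_prod_diff_smult[OF w a, of "k * (a \<bullet> w)"]
    unfolding enorm_sq by (simp add: aa comm_scalar_prod[OF w a] power2_eq_square algebra_simps)
  also have "\<dots> \<le> (enorm w)\<^sup>2" using k0 \<alpha> by (simp add: k2)
  finally show "enorm (rank_one_step d (inv_factored d U s V) x *\<^sub>v v) \<le> enorm (inv_factored d U s V *\<^sub>v v)"
    using power2_le_imp_le[OF _ enorm_nonneg] eq by (simp add: w_def)
  have "rank_one_step d (inv_factored d U s V) x *\<^sub>v x = a - (k * (a \<bullet> a)) \<cdot>\<^sub>v a"
    using rank_one_step_mult_vec[OF x x] by (simp add: a_def \<alpha>_def k_def)
  also have "\<dots> = (1 / \<alpha>) \<cdot>\<^sub>v a" using a by (auto simp: aa k2 algebra_simps intro!: eq_vecI)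
  finally show "enorm (rank_one_step d (inv_factored d U s V) x *\<^sub>v x) = 1"
    using \<alpha> by (simp add: enorm_smult \<alpha>_def)
qed

lemma rank_one_step_det:
  assumes x: "x \<in> carrier_vec d" and d: "1 \<le> d"
    and gt: "1 < enorm (inv_factored d U s V *\<^sub>v x)"
  shows "det (rank_one_step d (inv_factored d U s V) x)
    = det (inv_factored d U s V) / enorm (inv_factored d U s V *\<^sub>v x)"
proof -
  define a where "a = inv_factored d U s V *\<^sub>v x"
  have a: "a \<in> carrier_vec d" using inv_factored_carrier x by (simp add: a_def)
  have gt': "1 < enorm a" using gt by (simp add: a_def)
  have aa: "a \<bullet> a = (enorm a)\<^sup>2" by (simp add: enorm_sq)
  let ?P = "1\<^sub>m d - ((1 - 1 / enorm a) / (enorm a)\<^sup>2) \<cdot>\<^sub>m outer_prod a a"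
  have P: "?P \<in> carrier_mat d d" using a by (simp add: minus_carrier_mat)
  have "det ?P = 1 / enorm a"
    using det_rank_one[OF a d, of "(1 - 1 / enorm a) / (enorm a)\<^sup>2"] gt' by (simp add: aa)
  then show ?thesis
    unfolding rank_one_step_def Let_def a_def[symmetric]
    by (simp add: det_mult[OF P inv_factored_carrier])
qed

end

text \<open>The inverse transpose of \<open>(I - k a a^T) A\<close> is
  \<open>(I + k' a a^T) A^-T\<close>, because the first factor scales \<open>a\<close> by
  \<open>1 / \<alpha>\<close> and the second by \<open>\<alpha>\<close>. Applied to
  \<open>z\<close>, with \<open>c = x \<bullet> z = a \<bullet> A^-T z\<close>, the squared norm
  gains \<open>c^2 (2 k' + k'^2 \<alpha>^2)\<close>, which is
  \<open>(1 - 1 / \<alpha>^2) c^2\<close>.\<close>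

lemma factors_update:
  fixes x :: "real vec"
  assumes F: "svd_factors d U s V" and F': "svd_factors d U' s' V'"
    and step: "inv_factored d U' s' V' = rank_one_step d (inv_factored d U s V) x"
    and x: "x \<in> carrier_vec d" and gt: "1 < enorm (inv_factored d U s V *\<^sub>v x)"
    and \<alpha>_def: "\<alpha> = enorm (inv_factored d U s V *\<^sub>v x)"
  shows dual_form_update: "z \<in> carrier_vec d \<Longrightarrow>
          dual_form d s' V' z = dual_form d s V z + (1 - 1 / \<alpha>\<^sup>2) * (x \<bullet> z)\<^sup>2"
    and trace_update: "(\<Sum>i<d. (s' $ i)\<^sup>2) = (\<Sum>i<d. (s $ i)\<^sup>2) + (1 - 1 / \<alpha>\<^sup>2) * (enorm x)\<^sup>2"
    and prod_update: "1 \<le> d \<Longrightarrow> (\<Prod>i<d. s' $ i) = \<alpha> * (\<Prod>i<d. s $ i)"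
proof -
  define a where "a = inv_factored d U s V *\<^sub>v x"
  define k where "k = (1 - 1 / \<alpha>) / \<alpha>\<^sup>2"
  define k' where "k' = (\<alpha> - 1) / \<alpha>\<^sup>2"
  have \<alpha>: "1 < \<alpha>" using gt by (simp add: \<alpha>_def)
  have aa: "a \<bullet> a = \<alpha>\<^sup>2" by (simp add: \<alpha>_def enorm_sq a_def)
  have a: "a \<in> carrier_vec d" using inv_factored_carrier[OF F] x by (simp add: a_def)
  have kk: "k' * \<alpha>\<^sup>2 = \<alpha> - 1" "k * \<alpha> = k'" using \<alpha> by (simp_all add: k_def k'_def field_simps)
  show *: "dual_form d s' V' z = dual_form d s V z + (1 - 1 / \<alpha>\<^sup>2) * (x \<bullet> z)\<^sup>2"
    if z: "z \<in> carrier_vec d" for z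
  proof -
    define b where "b = inv_transpose d U s V *\<^sub>v z"
    define c where "c = x \<bullet> z"
    have b: "b \<in> carrier_vec d" using inv_transpose_carrier[OF F] z by (simp add: b_def)
    have ba: "b \<bullet> a = c" "a \<bullet> b = c"
      using inv_transpose_duality[OF F z x] comm_scalar_prod[OF x z] comm_scalar_prod[OF a b]
      by (simp_all add: a_def b_def c_def)
    \<comment> \<open>The candidate for the new inverse transpose applied to \<open>z\<close>,
      confirmed below by \<open>inv_transpose_unique\<close>.\<close>
    define y where "y = b + (k' * c) \<cdot>\<^sub>v a"
    have y: "y \<in> carrier_vec d" using a b by (simp add: y_def)
    have "y \<bullet> a = c * (1 + k' * \<alpha>\<^sup>2)"
      using a b ba by (simp add: y_def add_scalar_prod_distrib[of _ d] aa algebra_simps)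
    then have ya: "y \<bullet> a = \<alpha> * c" by (simp add: kk)
    have yy: "y \<bullet> y = b \<bullet> b + c\<^sup>2 * (2 * k' + k' * (k' * \<alpha>\<^sup>2))"
      using a b ba
      by (simp add: y_def add_scalar_prod_distrib[of _ d] scalar_prod_add_distrib[of _ d] aa
          power2_eq_square algebra_simps)
    have "y = inv_transpose d U' s' V' *\<^sub>v z"
    proof (rule inv_transpose_unique[OF F' y z])
      fix v :: "real vec" assume v: "v \<in> carrier_vec d"
      define w where "w = inv_factored d U s V *\<^sub>v v"
      have w: "w \<in> carrier_vec d" using inv_factored_carrier[OF F] v by (simp add: w_def)
      have "inv_factored d U' s' V' *\<^sub>v v = w - (k * (a \<bullet> w)) \<cdot>\<^sub>v a"
        using rank_one_step_mult_vec[OF F x v] by (simp add: step a_def w_def \<alpha>_def k_def)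
      then have "y \<bullet> (inv_factored d U' s' V' *\<^sub>v v) = y \<bullet> w - k * (a \<bullet> w) * (\<alpha> * c)"
        using y w a ya by (simp add: scalar_prod_minus_distrib[of _ d])
      also have "y \<bullet> w = b \<bullet> w + k' * c * (a \<bullet> w)"
        using b a w by (simp add: y_def add_scalar_prod_distrib[of _ d])
      also have "b \<bullet> w + k' * c * (a \<bullet> w) - k * (a \<bullet> w) * (\<alpha> * c)
          = b \<bullet> w + (k' - k * \<alpha>) * (c * (a \<bullet> w))" by (simp add: algebra_simps)
      also have "\<dots> = z \<bullet> v"
        using inv_transpose_duality[OF F z v] by (simp add: kk b_def w_def)
      finally show "y \<bullet> (inv_factored d U' s' V' *\<^sub>v v) = z \<bullet> v" .
    qed
    then have "dual_form d s' V' z = y \<bullet> y"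
      using inv_transpose_norm[OF F' z] by (simp add: enorm_sq)
    moreover have "b \<bullet> b = dual_form d s V z"
      using inv_transpose_norm[OF F z] by (simp add: enorm_sq b_def)
    moreover have "2 * k' + k' * (k' * \<alpha>\<^sup>2) = 1 - 1 / \<alpha>\<^sup>2"
      unfolding kk(1) using \<alpha> by (simp add: k'_def field_simps power2_eq_square)
    ultimately show ?thesis by (simp add: yy c_def mult.commute)
  qed
  \<comment> \<open>Summing the formula just shown over the unit vectors turns
    \<open>(x \<bullet> z)^2\<close> into \<open>|x|^2\<close> and the forms into traces.\<close>
  have "(\<Sum>k<d. (x \<bullet> unit_vec d k)\<^sup>2) = (enorm x)\<^sup>2"
    unfolding enorm_sq using x
    by (simp add: scalar_prod_def[of x x] lessThan_atLeast0 power2_eq_square)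
  then show "(\<Sum>i<d. (s' $ i)\<^sup>2) = (\<Sum>i<d. (s $ i)\<^sup>2) + (1 - 1 / \<alpha>\<^sup>2) * (enorm x)\<^sup>2"
    by (simp add: factors_trace[OF F, symmetric] factors_trace[OF F', symmetric] *
        sum.distrib sum_distrib_left[symmetric])
  show "(\<Prod>i<d. s' $ i) = \<alpha> * (\<Prod>i<d. s $ i)" if d: "1 \<le> d"
  proof -
    let ?p = "\<Prod>i<d. s $ i" and ?p' = "\<Prod>i<d. s' $ i"
    have p: "0 < ?p" "0 < ?p'" using factors_prod_pos[OF F] factors_prod_pos[OF F'] by auto
    \<comment> \<open>The determinants are compared through their squares, and the roots are taken
      afterwards because both products are positive.\<close>
    have "1 / ?p'\<^sup>2 = (1 / ?p\<^sup>2) / \<alpha>\<^sup>2"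
      using inv_factored_det_sq[OF F] inv_factored_det_sq[OF F'] rank_one_step_det[OF F x d gt]
      by (simp add: step power_divide \<alpha>_def)
    then have "?p'\<^sup>2 = (\<alpha> * ?p)\<^sup>2" using p \<alpha> by (simp add: field_simps power_mult_distrib)
    then show ?thesis using p \<alpha> by (simp add: power2_eq_iff_nonneg)
  qed
qed

section \<open>Separation and the radii of the hull\<close>

text \<open>Bolzano-Weierstrass for finitely many coordinates. A bounded monotone subsequence is
  extracted for one coordinate at a time, which preserves the convergence already achieved.\<close>

lemma bounded_pointwise_convergent_subseq:
  fixes f :: "nat \<Rightarrow> 'a \<Rightarrow> real"
  assumes "finite S" "\<And>k s. s \<in> S \<Longrightarrow> \<bar>f k s\<bar> \<le> B"
  obtains r :: "nat \<Rightarrow> nat" where "strict_mono r" "\<And>s. s \<in> S \<Longrightarrow> convergent (\<lambda>k. f (r k) s)"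
proof -
  have "\<exists>r :: nat \<Rightarrow> nat. strict_mono r \<and> (\<forall>s\<in>S. convergent (\<lambda>k. f (r k) s))"
    using assms
  proof (induction rule: finite_induct)
    case empty
    show ?case using strict_mono_id by auto
  next
    case (insert a S)
    then obtain r :: "nat \<Rightarrow> nat"
      where r: "strict_mono r" "\<forall>s\<in>S. convergent (\<lambda>k. f (r k) s)" by auto
    obtain q :: "nat \<Rightarrow> nat" where q: "strict_mono q" "monoseq (\<lambda>k. f (r (q k)) a)"
      using seq_monosub[of "\<lambda>k. f (r k) a"] by auto
    have "Bseq (\<lambda>k. f (r (q k)) a)" using insert.prems by (intro BseqI'[of _ B]) auto
    then have "convergent (\<lambda>k. f (r (q k)) a)" using q(2) by (rule Bseq_monoseq_convergent)
    moreover have "convergent (\<lambda>k. f (r (q k)) s)" if "s \<in> S" for s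
      using convergent_subseq_convergent[OF _ q(1), of "\<lambda>k. f (r k) s"] r(2) that
      by (simp add: comp_def)
    ultimately show ?case
      using strict_mono_o[OF r(1) q(1)] by (intro exI[of _ "r \<circ> q"]) (auto simp: comp_def)
  qed
  then show ?thesis using that by blast
qed

text \<open>Compactness is taken from the simplex of coefficients, so no topology on
  \<open>real vec\<close> is involved. The hypothesis \<open>cont\<close> expresses continuity of
  \<open>F\<close> in the values on \<open>S\<close> alone.\<close>

lemma sum_minimizer_simplex:
  fixes F :: "('a \<Rightarrow> real) \<Rightarrow> real"
  assumes S: "finite S" "S \<noteq> {}" and F0: "\<And>c. 0 \<le> F c"
    and cont: "\<And>f l. (\<And>s. s \<in> S \<Longrightarrow> (\<lambda>k. f k s) \<longlonglongrightarrow> l s) \<Longrightarrow> (\<lambda>k::nat. F (f k)) \<longlonglongrightarrow> F l"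
  defines "\<Delta> \<equiv> {c. (\<forall>s\<in>S. 0 \<le> c s) \<and> (\<Sum>s\<in>S. c s) = 1}"
  obtains l where "l \<in> \<Delta>" "\<And>c. c \<in> \<Delta> \<Longrightarrow> F l \<le> F c"
proof -
  obtain s0 where s0: "s0 \<in> S" using S by auto
  have "(\<lambda>s. if s = s0 then 1 else 0) \<in> \<Delta>" using S s0 by (simp add: \<Delta>_def)
  then have ne: "F ` \<Delta> \<noteq> {}" by auto
  have bdd: "bdd_below (F ` \<Delta>)" using F0 by (intro bdd_belowI[of _ 0]) auto
  define m where "m = Inf (F ` \<Delta>)"
  have "\<exists>c\<in>\<Delta>. F c < m + 1 / real (Suc k)" for k
    using cInf_lessD[OF ne, of "m + 1 / real (Suc k)"] by (auto simp: m_def)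
  then obtain f where f: "\<And>k. f k \<in> \<Delta>" "\<And>k. F (f k) < m + 1 / real (Suc k)" by metis
  have f1: "\<bar>f k s\<bar> \<le> 1" if "s \<in> S" for k s
    using f(1)[of k] that member_le_sum[of s S "f k"] S by (auto simp: \<Delta>_def)
  obtain r :: "nat \<Rightarrow> nat" where r: "strict_mono r" "\<And>s. s \<in> S \<Longrightarrow> convergent (\<lambda>k. f (r k) s)"
    using bounded_pointwise_convergent_subseq[of S f 1] S(1) f1 by blast
  define l where "l s = lim (\<lambda>k. f (r k) s)" for s
  have l: "(\<lambda>k. f (r k) s) \<longlonglongrightarrow> l s" if "s \<in> S" for s
    using r(2)[OF that] by (simp add: l_def convergent_LIMSEQ_iff)
  have lD: "l \<in> \<Delta>"
  proof -
    have "0 \<le> l s" if "s \<in> S" for s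
      using LIMSEQ_le_const[OF l[OF that], of 0] f(1) that by (auto simp: \<Delta>_def)
    moreover have "(\<lambda>k. \<Sum>s\<in>S. f (r k) s) \<longlonglongrightarrow> (\<Sum>s\<in>S. l s)" by (intro tendsto_sum l)
    then have "(\<Sum>s\<in>S. l s) = 1"
      using f(1) LIMSEQ_unique[of "\<lambda>k. 1" 1 "\<Sum>s\<in>S. l s"] by (simp add: \<Delta>_def)
    ultimately show ?thesis by (simp add: \<Delta>_def)
  qed
  have "(\<lambda>k. m + 1 / real (Suc (r k))) \<longlonglongrightarrow> m + 0"
    using LIMSEQ_subseq_LIMSEQ[OF LIMSEQ_inverse_real_of_nat r(1)]
    by (intro tendsto_intros) (simp add: comp_def inverse_eq_divide)
  moreover have "(\<lambda>k. F (f (r k))) \<longlonglongrightarrow> F l" by (intro cont l)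
  ultimately have "F l \<le> m"
    using f(2) by (intro LIMSEQ_le[of "\<lambda>k. F (f (r k))" "F l" "\<lambda>k. m + 1 / real (Suc (r k))" m])
                  (auto intro: less_imp_le)
  then have "F l \<le> F c" if "c \<in> \<Delta>" for c
    using cInf_lower[of "F c" "F ` \<Delta>"] bdd that by (force simp: m_def)
  with lD show ?thesis using that by blast
qed

text \<open>A separating direction is \<open>v - p\<close> with \<open>p\<close> the point of the hull nearest to \<open>v\<close>.\<close>

lemma conv_hull_separation:
  assumes S: "finite S" "S \<noteq> {}" "S \<subseteq> carrier_vec d"
    and v: "v \<in> carrier_vec d" "v \<notin> conv_hull d S"
  obtains z where "z \<in> carrier_vec d" "\<And>w. w \<in> S \<Longrightarrow> z \<bullet> w < z \<bullet> v"
proof -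
  define pt where "pt c = vec d (\<lambda>j. \<Sum>w\<in>S. c w * w $ j)" for c :: "real vec \<Rightarrow> real"
  define F where "F c = (v - pt c) \<bullet> (v - pt c)" for c
  have pt: "pt c \<in> carrier_vec d" for c by (simp add: pt_def)
  have cont: "(\<lambda>k. F (f k)) \<longlonglongrightarrow> F l"
    if "\<And>w. w \<in> S \<Longrightarrow> (\<lambda>k. f k w) \<longlonglongrightarrow> l w" for f :: "nat \<Rightarrow> real vec \<Rightarrow> real" and l
  proof -
    have eq: "F c = (\<Sum>j<d. (v $ j - (\<Sum>w\<in>S. c w * w $ j)) * (v $ j - (\<Sum>w\<in>S. c w * w $ j)))" for c
      using v by (simp add: F_def pt_def scalar_prod_def lessThan_atLeast0)
    show ?thesis unfolding eq by (intro tendsto_intros that)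
  qed
  obtain l where l: "\<forall>s\<in>S. 0 \<le> l s" "(\<Sum>s\<in>S. l s) = 1"
    and min: "\<And>c. \<forall>s\<in>S. 0 \<le> c s \<Longrightarrow> (\<Sum>s\<in>S. c s) = 1 \<Longrightarrow> F l \<le> F c"
  proof (rule sum_minimizer_simplex[of S F, OF S(1,2) _ cont])
    show "0 \<le> F c" for c by (simp add: F_def scalar_prod_self_nonneg)
  qed auto
  define p where "p = pt l"
  define z where "z = v - p"
  have p: "p \<in> carrier_vec d" using pt by (simp add: p_def)
  have z: "z \<in> carrier_vec d" using p v by (simp add: z_def)
  have "p \<in> conv_hull d S" using S(1) l by (auto simp: conv_hull_def p_def pt_def)
  then have "v \<noteq> p" using v(2) by auto
  have "enorm z \<noteq> 0"
  proof
    assume "enorm z = 0"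
    then have "z = 0\<^sub>v d" using enorm_eq_0_iff[OF z] by simp
    then have "v $ j - p $ j = 0" if "j < d" for j
    proof -
      have "v $ j - p $ j = z $ j" using v p that by (simp add: z_def)
      then show ?thesis using \<open>z = 0\<^sub>v d\<close> that by simp
    qed
    then have "v = p" using v p by (intro eq_vecI) auto
    then show False using \<open>v \<noteq> p\<close> by simp
  qed
  then have zz: "0 < z \<bullet> z" using enorm_sq[of z] by (metis zero_less_power2)
  have "z \<bullet> w < z \<bullet> v" if w: "w \<in> S" for w
  proof -
    have wc: "w \<in> carrier_vec d" using w S by auto
    define u where "u = w - p"
    have u: "u \<in> carrier_vec d" using wc p by (simp add: u_def)
    \<comment> \<open>First-order condition at the minimum: shifting the weight
      \<open>\<epsilon>\<close> from \<open>l\<close> to the point \<open>w\<close> replaces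
      \<open>z\<close> by \<open>z - \<epsilon> u\<close>, which must not be shorter than
      \<open>z\<close>.\<close>
    have small: "2 * (z \<bullet> u) \<le> \<epsilon> * (u \<bullet> u)" if \<epsilon>: "0 < \<epsilon>" "\<epsilon> \<le> 1" for \<epsilon>
    proof -
      define c where "c y = (1 - \<epsilon>) * l y + (if y = w then \<epsilon> else 0)" for y
      have "\<forall>s\<in>S. 0 \<le> c s" using l(1) \<epsilon> by (simp add: c_def)
      moreover have "(\<Sum>s\<in>S. c s) = 1"
        using S(1) w l(2) by (simp add: c_def sum.distrib sum_distrib_left[symmetric])
      ultimately have "F l \<le> F c" by (rule min)
      moreover have "v - pt c = z - \<epsilon> \<cdot>\<^sub>v u"
      proof (rule eq_vecI)
        fix j assume "j < dim_vec (z - \<epsilon> \<cdot>\<^sub>v u)"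
        then have j: "j < d" using u by simp
        have "(\<Sum>y\<in>S. c y * y $ j)
            = (\<Sum>y\<in>S. (1 - \<epsilon>) * (l y * y $ j) + (if y = w then \<epsilon> * w $ j else 0))"
          by (intro sum.cong refl) (simp add: c_def algebra_simps)
        also have "\<dots> = (1 - \<epsilon>) * p $ j + \<epsilon> * w $ j"
          using S(1) w j by (simp add: sum.distrib sum_distrib_left[symmetric] p_def pt_def)
        finally show "(v - pt c) $ j = (z - \<epsilon> \<cdot>\<^sub>v u) $ j"
          using j v(1) p wc pt by (simp add: z_def u_def pt_def algebra_simps)
      qed (use z u pt in simp)
      moreover have "F l = z \<bullet> z" by (simp add: F_def z_def p_def)
      ultimately have "z \<bullet> z \<le> z \<bullet> z - 2 * \<epsilon> * (z \<bullet> u) + \<epsilon>\<^sup>2 * (u \<bullet> u)"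
        by (simp add: F_def scalar_prod_diff_smult[OF z u])
      then have "\<epsilon> * (2 * (z \<bullet> u)) \<le> \<epsilon> * (\<epsilon> * (u \<bullet> u))" by (simp add: power2_eq_square algebra_simps)
      then show ?thesis using \<epsilon> by simp
    qed
    have "z \<bullet> u \<le> 0"
    proof (rule ccontr)
      assume "\<not> z \<bullet> u \<le> 0"
      then have a: "0 < z \<bullet> u" by simp
      define b where "b = u \<bullet> u"
      have b: "0 \<le> b" by (simp add: b_def scalar_prod_self_nonneg)
      \<comment> \<open>This choice of \<open>\<epsilon>\<close> lies in (0, 1] and makes
        \<open>\<epsilon> b\<close> at most \<open>z \<bullet> u\<close>, which contradicts the
        factor 2 on the left.\<close>
      have "2 * (z \<bullet> u) \<le> (z \<bullet> u) / (z \<bullet> u + b) * b"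
        using small[of "(z \<bullet> u) / (z \<bullet> u + b)"] a b by (simp add: b_def)
      also have "\<dots> \<le> z \<bullet> u" using a b by (simp add: field_simps)
      finally show False using a by simp
    qed
    then have "z \<bullet> w \<le> z \<bullet> p" using z wc p by (simp add: u_def scalar_prod_minus_distrib[of _ d])
    moreover have "z \<bullet> v = z \<bullet> p + z \<bullet> z" using z v p
      by (simp add: z_def scalar_prod_minus_distrib[of _ d])
    ultimately show ?thesis using zz by simp
  qed
  with z show ?thesis using that by blast
qed

section \<open>Support function and radii of the symmetric hull\<close>

lemma conv_hull_scalar_prod_le:
  assumes S: "S \<subseteq> carrier_vec d" and z: "z \<in> carrier_vec d"
    and h: "\<And>w. w \<in> S \<Longrightarrow> z \<bullet> w \<le> h" and y: "y \<in> conv_hull d S"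
  shows "z \<bullet> y \<le> h"
proof -
  obtain W c where W: "finite W" "W \<subseteq> S" "\<forall>w\<in>W. 0 \<le> c w" "(\<Sum>w\<in>W. c w) = 1"
    and y_eq: "y = vec d (\<lambda>j. \<Sum>w\<in>W. c w * w $ j)"
    using y by (auto simp: conv_hull_def)
  have "z \<bullet> y = (\<Sum>j<d. \<Sum>w\<in>W. c w * (z $ j * w $ j))"
    by (auto simp: y_eq scalar_prod_def lessThan_atLeast0 sum_distrib_left ac_simps intro!: sum.cong)
  also have "\<dots> = (\<Sum>w\<in>W. c w * (\<Sum>j<d. z $ j * w $ j))"
    by (subst sum.swap) (simp add: sum_distrib_left)
  also have "\<dots> = (\<Sum>w\<in>W. c w * (z \<bullet> w))"
  proof (intro sum.cong refl)
    fix w assume "w \<in> W"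
    then have "w \<in> carrier_vec d" using W S by auto
    then show "c w * (\<Sum>j<d. z $ j * w $ j) = c w * (z \<bullet> w)"
      by (simp add: scalar_prod_def lessThan_atLeast0)
  qed
  also have "\<dots> \<le> (\<Sum>w\<in>W. c w * h)"
    using W h by (intro sum_mono mult_left_mono) auto
  also have "\<dots> = h" using W(4) by (simp add: sum_distrib_right[symmetric])
  finally show ?thesis .
qed

text \<open>The support function h of the symmetric hull. A linear form is maximal over the hull at
  some \<open>x i\<close> or \<open>- x i\<close>, so a maximum over the points suffices.\<close>

definition width :: "nat \<Rightarrow> (nat \<Rightarrow> real vec) \<Rightarrow> real vec \<Rightarrow> real" where
  "width n x z = Max ((\<lambda>i. \<bar>z \<bullet> x i\<bar>) ` {1..n})"

lemma width_ge: "i \<in> {1..n} \<Longrightarrow> \<bar>z \<bullet> x i\<bar> \<le> width n x z"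
  by (auto simp: width_def intro: Max_ge)

lemma max_norm_ge: "i \<in> {1..n} \<Longrightarrow> enorm (x i) \<le> max_norm x n"
  by (auto simp: max_norm_def intro: Max_ge)

context
  fixes d n :: nat and x :: "nat \<Rightarrow> real vec" and \<xi> :: real
  assumes valid: "valid_input d n x \<xi>"
begin

private lemma hull_input: "1 \<le> d" "1 \<le> n" "\<And>i. i \<in> {1..n} \<Longrightarrow> x i \<in> carrier_vec d" "x 1 \<noteq> 0\<^sub>v d"
  using valid by (auto simp: valid_input_def)

private abbreviation (input) "S \<equiv> x ` {1..n} \<union> (\<lambda>i. - x i) ` {1..n}"

private lemma S_carrier: "S \<subseteq> carrier_vec d" using hull_input(3) by auto

lemma width_nonneg: "0 \<le> width n x z"
  using width_ge[of 1 n z x] hull_input(2) by force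

lemma sym_hull_scalar_prod_le:
  assumes z: "z \<in> carrier_vec d" and h: "\<And>i. i \<in> {1..n} \<Longrightarrow> \<bar>z \<bullet> x i\<bar> \<le> h"
    and y: "y \<in> sym_hull d n x"
  shows "z \<bullet> y \<le> h"
proof (rule conv_hull_scalar_prod_le[OF S_carrier z _ y[unfolded sym_hull_def]])
  fix w assume "w \<in> S"
  then obtain i where i: "i \<in> {1..n}" and w: "w = x i \<or> w = - x i" by auto
  have "z \<bullet> (- x i) = - (z \<bullet> x i)" using z hull_input(3)[OF i] by simp
  then show "z \<bullet> w \<le> h" using h[OF i] w by auto
qed

lemma sym_hull_carrier: "y \<in> sym_hull d n x \<Longrightarrow> y \<in> carrier_vec d"
  by (auto simp: sym_hull_def conv_hull_def)

lemma zero_in_sym_hull: "0\<^sub>v d \<in> sym_hull d n x"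
proof -
  have x1: "x 1 \<in> carrier_vec d" using hull_input by simp
  \<comment> \<open>\<open>conv_hull\<close> sums over a set, so the weights 1/2 add up to 1 only if
    \<open>x 1\<close> and \<open>- x 1\<close> are different points.\<close>
  have ne: "x 1 \<noteq> - x 1"
  proof
    assume eq: "x 1 = - x 1"
    have "x 1 $ j = 0" if "j < d" for j
      using arg_cong[OF eq, of "\<lambda>v. v $ j"] x1 that by simp
    then show False using hull_input(4) x1 by (metis eq_vecI carrier_vecD index_zero_vec)
  qed
  have "0\<^sub>v d = vec d (\<lambda>j. \<Sum>w\<in>{x 1, - x 1}. 1/2 * w $ j)"
    using ne x1 by (intro eq_vecI) auto
  then show ?thesis
    unfolding sym_hull_def conv_hull_def using hull_input(2) ne
    by (intro CollectI exI[of _ "{x 1, - x 1}"] exI[of _ "\<lambda>_. 1/2"]) auto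
qed

lemma point_in_sym_hull:
  assumes i: "i \<in> {1..n}"
  shows "x i \<in> sym_hull d n x"
proof -
  have "x i = vec d (\<lambda>j. \<Sum>w\<in>{x i}. 1 * w $ j)" using hull_input(3)[OF i] by (intro eq_vecI) auto
  then show ?thesis
    unfolding sym_hull_def conv_hull_def using i
    by (intro CollectI exI[of _ "{x i}"] exI[of _ "\<lambda>_. 1"]) auto
qed

text \<open>A ball of radius \<open>\<rho>\<close> inside the hull contains
  \<open>\<rho> z / |z|\<close>, where the linear form \<open>z\<close> has the value
  \<open>\<rho> |z|\<close>. Radius 0 shows that the set under the supremum is nonempty.\<close>

lemma inner_radius_le_width:
  assumes z: "z \<in> carrier_vec d"
  shows "inner_radius d (sym_hull d n x) * enorm z \<le> width n x z"
proof (cases "enorm z = 0")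
  case True
  then show ?thesis using width_nonneg by simp
next
  case False
  then have e: "0 < enorm z" using enorm_nonneg[of z] by simp
  have "inner_radius d (sym_hull d n x) \<le> width n x z / enorm z"
    unfolding inner_radius_def
  proof (rule cSup_least)
    have "origin_ball d 0 = {0\<^sub>v d}"
      using enorm_eq_0_iff[of _ d] enorm_nonneg
      by (auto simp: origin_ball_def enorm_def[of "0\<^sub>v d"] dest: antisym)
    then show "{\<rho>. 0 \<le> \<rho> \<and> origin_ball d \<rho> \<subseteq> sym_hull d n x} \<noteq> {}"
      using zero_in_sym_hull by auto
  next
    fix \<rho> assume "\<rho> \<in> {\<rho>. 0 \<le> \<rho> \<and> origin_ball d \<rho> \<subseteq> sym_hull d n x}"
    then have \<rho>: "0 \<le> \<rho>" "origin_ball d \<rho> \<subseteq> sym_hull d n x" by auto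
    let ?y = "(\<rho> / enorm z) \<cdot>\<^sub>v z"
    have "?y \<in> origin_ball d \<rho>" using z \<rho> e by (simp add: origin_ball_def enorm_smult)
    then have "z \<bullet> ?y \<le> width n x z"
      using sym_hull_scalar_prod_le[OF z width_ge] \<rho>(2) by blast
    moreover have "z \<bullet> ?y = \<rho> * enorm z"
      using e enorm_sq[of z] by (simp add: power2_eq_square field_simps)
    ultimately show "\<rho> \<le> width n x z / enorm z" using e by (simp add: field_simps)
  qed
  then show ?thesis using e by (simp add: field_simps)
qed

lemma max_norm_pos: "0 < max_norm x n"
proof -
  have "enorm (x 1) \<noteq> 0" using enorm_eq_0_iff[of "x 1" d] hull_input by simp
  then show ?thesis using enorm_nonneg[of "x 1"] max_norm_ge[of 1 n x] hull_input(2) by force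
qed

lemma max_norm_le_outer_radius: "max_norm x n \<le> outer_radius d (sym_hull d n x)"
  unfolding outer_radius_def
proof (rule cInf_greatest)
  \<comment> \<open>A bound on the hull, obtained by testing \<open>y\<close> against itself, shows
    that the set of admissible radii under the infimum is nonempty.\<close>
  have "enorm y \<le> max_norm x n" if y: "y \<in> sym_hull d n x" for y
  proof (cases "enorm y = 0")
    case False
    then have e: "0 < enorm y" using enorm_nonneg[of y] by simp
    have yc: "y \<in> carrier_vec d" using sym_hull_carrier[OF y] .
    have "y \<bullet> y \<le> enorm y * max_norm x n"
    proof (rule sym_hull_scalar_prod_le[OF yc _ y])
      fix i assume i: "i \<in> {1..n}"
      have "\<bar>y \<bullet> x i\<bar> \<le> enorm y * enorm (x i)"
        by (rule abs_scalar_prod_le_enorm[OF yc hull_input(3)[OF i]])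
      then show "\<bar>y \<bullet> x i\<bar> \<le> enorm y * max_norm x n"
        using mult_left_mono[OF max_norm_ge[OF i, of x] enorm_nonneg[of y]] by simp
    qed
    then have "enorm y * enorm y \<le> enorm y * max_norm x n"
      using enorm_sq[of y] by (simp add: power2_eq_square)
    then show ?thesis using e by simp
  qed (use max_norm_pos in simp)
  then show "{\<rho>. 0 \<le> \<rho> \<and> sym_hull d n x \<subseteq> origin_ball d \<rho>} \<noteq> {}"
    using max_norm_pos sym_hull_carrier by (auto simp: origin_ball_def intro!: exI[of _ "max_norm x n"])
next
  fix \<rho> assume "\<rho> \<in> {\<rho>. 0 \<le> \<rho> \<and> sym_hull d n x \<subseteq> origin_ball d \<rho>}"
  then have "enorm (x i) \<le> \<rho>" if "i \<in> {1..n}" for i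
    using point_in_sym_hull[OF that] by (auto simp: origin_ball_def)
  then show "max_norm x n \<le> \<rho>" using hull_input(2) by (simp add: max_norm_def)
qed

text \<open>With the outer radius R and the inner radius r, \<open>M_n \<le> R \<le> \<xi> r\<close>
  and \<open>r |z| \<le> h(z)\<close>. This is the only place where the hypothesis on the aspect
  ratio is unfolded.\<close>

lemma xi_pos: "0 < \<xi>"
  and max_norm_le_width: "z \<in> carrier_vec d \<Longrightarrow> max_norm x n * enorm z \<le> \<xi> * width n x z"
proof -
  define r where "r = inner_radius d (sym_hull d n x)"
  have r: "0 < r" "outer_radius d (sym_hull d n x) / r \<le> \<xi>"
    using valid by (auto simp: valid_input_def aspect_ratio_def r_def)
  then have *: "max_norm x n \<le> \<xi> * r" using max_norm_le_outer_radius by (simp add: field_simps)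
  then have "0 < \<xi> * r" using max_norm_pos by simp
  then show \<xi>: "0 < \<xi>" using r(1) by (simp add: zero_less_mult_iff)
  show "max_norm x n * enorm z \<le> \<xi> * width n x z" if z: "z \<in> carrier_vec d"
  proof -
    have "max_norm x n * enorm z \<le> \<xi> * (r * enorm z)"
      using mult_right_mono[OF * enorm_nonneg[of z]] by (simp add: mult.assoc)
    also have "\<dots> \<le> \<xi> * width n x z"
      using inner_radius_le_width[OF z] \<xi> by (simp add: r_def)
    finally show ?thesis .
  qed
qed

text \<open>For a unit vector \<open>e\<close>, Cauchy-Schwarz gives
  \<open>M_n \<le> \<xi> h(e) \<le> \<xi> M_n\<close>.\<close>

lemma xi_ge_1: "1 \<le> \<xi>"
proof -
  let ?e = "unit_vec d 0 :: real vec"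
  have e: "?e \<in> carrier_vec d" "enorm ?e = 1" using hull_input(1) by (auto simp: enorm_def)
  have "width n x ?e \<le> max_norm x n"
    unfolding width_def
  proof (rule Max.boundedI)
    fix t assume "t \<in> (\<lambda>i. \<bar>?e \<bullet> x i\<bar>) ` {1..n}"
    then obtain i where i: "i \<in> {1..n}" and t: "t = \<bar>?e \<bullet> x i\<bar>" by auto
    have "t \<le> enorm (x i)"
      using abs_scalar_prod_le_enorm[OF e(1) hull_input(3)[OF i]] by (simp add: t e(2) del: scalar_prod_left_unit)
    then show "t \<le> max_norm x n" using max_norm_ge[OF i, of x] by simp
  qed (use hull_input in auto)
  then have "\<xi> * width n x ?e \<le> \<xi> * max_norm x n"
    using xi_pos by simp
  then have "max_norm x n \<le> \<xi> * max_norm x n"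
    using max_norm_le_width[OF e(1)] e(2) by simp
  then show ?thesis using max_norm_pos by simp
qed

text \<open>With fewer than \<open>d\<close> points, the square matrix of the points padded by zero
  rows is singular. A nonzero kernel vector \<open>z\<close> is orthogonal to all points, so its
  width is 0, against \<open>M_n |z| \<le> \<xi> h(z)\<close>.\<close>

lemma dim_le_points: "d \<le> n"
proof (rule ccontr)
  assume "\<not> d \<le> n"
  then have nd: "n < d" by simp
  define A where "A = mat d d (\<lambda>(i, j). if i < n then x (Suc i) $ j else 0)"
  have A: "A \<in> carrier_mat d d" by (simp add: A_def)
  have "row A n = 0\<^sub>v d" using nd by (intro eq_vecI) (auto simp: A_def)
  then have "A\<^sup>T *\<^sub>v unit_vec d n = 0\<^sub>v d" using A nd by (intro eq_vecI) (auto simp: A_def)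
  then have "det A\<^sup>T = 0"
    using det_0_iff_vec_prod_zero[of "A\<^sup>T" d] A nd
    by (metis transpose_carrier_mat unit_vec_carrier unit_vec_nonzero)
  then have "det A = 0" by (simp add: det_transpose[OF A])
  then obtain z where z: "z \<in> carrier_vec d" "z \<noteq> 0\<^sub>v d" "A *\<^sub>v z = 0\<^sub>v d"
    using det_0_iff_vec_prod_zero[OF A] by auto
  have "z \<bullet> x i = 0" if i: "i \<in> {1..n}" for i
  proof -
    have "x i = row A (i - 1)" using hull_input(3)[OF i] i nd by (intro eq_vecI) (auto simp: A_def)
    moreover have "i - 1 < dim_row A" using i nd by (auto simp: A_def)
    ultimately have "x i \<bullet> z = (A *\<^sub>v z) $ (i - 1)" by simp
    moreover have "i - 1 < d" using i nd by auto
    ultimately show ?thesis using z comm_scalar_prod[OF z(1) hull_input(3)[OF i]] by simp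
  qed
  then have "width n x z = 0" using hull_input(2) by (simp add: width_def image_constant_conv)
  then have "max_norm x n * enorm z \<le> 0" using max_norm_le_width[OF z(1)] by simp
  then show False
    using max_norm_pos enorm_nonneg[of z] z enorm_eq_0_iff[OF z(1)]
    by (simp add: mult_le_0_iff)
qed

text \<open>Convexity of the norm by duality: with \<open>q = A y\<close>, the linear form
  \<open>A^T q\<close> is at most \<open>|q|\<close> at the points and their negatives, hence also
  at \<open>y\<close>, where it equals \<open>|q|^2\<close>.\<close>

lemma sym_hull_subset_ellipsoid:
  assumes A: "A \<in> carrier_mat d d" and le: "\<And>i. i \<in> {1..n} \<Longrightarrow> enorm (A *\<^sub>v x i) \<le> 1"
  shows "sym_hull d n x \<subseteq> mat_ellipsoid d A"
proof
  fix y assume y: "y \<in> sym_hull d n x"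
  have yc: "y \<in> carrier_vec d" using sym_hull_carrier[OF y] .
  define q where "q = A *\<^sub>v y"
  have q: "q \<in> carrier_vec d" using A yc by (simp add: q_def)
  have dual: "(A\<^sup>T *\<^sub>v q) \<bullet> w = q \<bullet> (A *\<^sub>v w)" if "w \<in> carrier_vec d" for w
    using transpose_vec_mult_scalar[OF A that q] .
  have "(A\<^sup>T *\<^sub>v q) \<bullet> y \<le> enorm q"
  proof (rule sym_hull_scalar_prod_le[OF _ _ y])
    fix i assume i: "i \<in> {1..n}"
    let ?u = "A *\<^sub>v x i"
    have u: "?u \<in> carrier_vec d" using A hull_input(3)[OF i] by simp
    have "\<bar>q \<bullet> ?u\<bar> \<le> enorm q * enorm ?u" by (rule abs_scalar_prod_le_enorm[OF q u])
    also have "\<dots> \<le> enorm q" using le[OF i] enorm_nonneg[of q] by (simp add: mult_left_le)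
    finally show "\<bar>(A\<^sup>T *\<^sub>v q) \<bullet> x i\<bar> \<le> enorm q" by (simp add: dual[OF hull_input(3)[OF i]])
  qed (use A q in simp)
  then have "q \<bullet> q \<le> enorm q" using dual[OF yc] by (simp add: q_def)
  then have "enorm q * enorm q \<le> enorm q * 1" by (simp add: enorm_sq[symmetric] power2_eq_square)
  then have "enorm q \<le> 1" using enorm_nonneg[of q] by (metis mult_le_cancel_left_pos order_le_less zero_le_one)
  then show "y \<in> mat_ellipsoid d A" using yc by (simp add: mat_ellipsoid_def q_def)
qed

lemma shrunk_ellipsoid_subset:
  assumes F: "svd_factors d U s V" and \<alpha>: "0 < \<alpha>"
    and le: "\<And>z. z \<in> carrier_vec d \<Longrightarrow> dual_form d s V z \<le> (\<alpha> * width n x z)\<^sup>2"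
  shows "shrink \<alpha> (mat_ellipsoid d (inv_factored d U s V)) \<subseteq> sym_hull d n x"
proof
  fix y assume "y \<in> shrink \<alpha> (mat_ellipsoid d (inv_factored d U s V))"
  then obtain v where v: "v \<in> carrier_vec d" "enorm (inv_factored d U s V *\<^sub>v v) \<le> 1"
    and y: "y = (1 / \<alpha>) \<cdot>\<^sub>v v" by (auto simp: shrink_def mat_ellipsoid_def)
  have yc: "y \<in> carrier_vec d" using v y by simp
  show "y \<in> sym_hull d n x"
  proof (rule ccontr)
    assume "y \<notin> sym_hull d n x"
    then obtain z where z: "z \<in> carrier_vec d" and sep: "\<And>w. w \<in> S \<Longrightarrow> z \<bullet> w < z \<bullet> y"
      using conv_hull_separation[of S d y] S_carrier hull_input(2) yc unfolding sym_hull_def by blast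
    have "width n x z \<in> (\<lambda>i. \<bar>z \<bullet> x i\<bar>) ` {1..n}"
      unfolding width_def using hull_input(2) by (intro Max_in) auto
    then obtain i where i: "i \<in> {1..n}" "width n x z = \<bar>z \<bullet> x i\<bar>" by auto
    have "z \<bullet> (- x i) = - (z \<bullet> x i)" using z hull_input(3)[OF i(1)] by simp
    then have lt: "width n x z < z \<bullet> y"
      using sep[of "x i"] sep[of "- x i"] i by (auto simp: abs_if)
    \<comment> \<open>\<open>z \<bullet> v\<close> pairs \<open>A^-T z\<close>, whose squared norm
      is the dual form, with \<open>A v\<close>, whose norm is at most 1.\<close>
    have "\<alpha> * (z \<bullet> y) = z \<bullet> v" using \<alpha> z v by (simp add: y)
    also have "\<dots> = (inv_transpose d U s V *\<^sub>v z) \<bullet> (inv_factored d U s V *\<^sub>v v)"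
      using inv_transpose_duality[OF F z v(1)] by simp
    also have "\<dots> \<le> enorm (inv_transpose d U s V *\<^sub>v z) * enorm (inv_factored d U s V *\<^sub>v v)"
      using inv_transpose_carrier[OF F] inv_factored_carrier[OF F] z v(1)
      by (intro scalar_prod_le_enorm[of _ d]) auto
    also have "\<dots> \<le> enorm (inv_transpose d U s V *\<^sub>v z)"
      using v(2) enorm_nonneg by (simp add: mult_left_le)
    also have "\<dots> \<le> \<alpha> * width n x z"
    proof (rule power2_le_imp_le)
      show "(enorm (inv_transpose d U s V *\<^sub>v z))\<^sup>2 \<le> (\<alpha> * width n x z)\<^sup>2"
        using le[OF z] inv_transpose_norm[OF F z] by simp
    qed (use \<alpha> width_nonneg in simp)
    finally show False using lt \<alpha> by simp
  qed
qed

end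

section \<open>Potentials\<close>

text \<open>The logarithm of the squared volume of the ellipsoid, up to a constant that depends on
  \<open>d\<close> only.\<close>

definition logvol :: "nat \<Rightarrow> real vec \<Rightarrow> real" where
  "logvol d s = 2 * (\<Sum>i<d. ln (s $ i))"

definition trace_sq :: "nat \<Rightarrow> real vec \<Rightarrow> real" where
  "trace_sq d s = (\<Sum>i<d. (s $ i)\<^sup>2)"

lemma logvol_prod:
  assumes "\<forall>i<d. 0 < s $ i"
  shows "logvol d s = 2 * ln (\<Prod>i<d. s $ i)"
proof -
  have "ln (\<Prod>i<d. s $ i) = (\<Sum>i<d. ln (s $ i))" using assms by (intro ln_prod) auto
  then show ?thesis by (simp add: logvol_def)
qed

text \<open>The inequality of arithmetic and geometric means for the squares of \<open>s\<close>.
  With \<open>a\<close> their mean, \<open>ln t \<le> t - 1\<close> is used at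
  \<open>t = (s $ i)^2 / a\<close>; the right-hand sides then sum to 0.\<close>

lemma logvol_le_trace:
  assumes pos: "\<forall>i<d. 0 < s $ i" and d: "1 \<le> d"
  shows "0 < trace_sq d s" "logvol d s \<le> d * ln (trace_sq d s / d)"
proof -
  have "0 < (\<Sum>i<d. (s $ i)\<^sup>2)" using pos d by (intro sum_pos) (auto simp: lessThan_empty_iff)
  then show tr: "0 < trace_sq d s" by (simp add: trace_sq_def)
  define a where "a = trace_sq d s / d"
  have a: "0 < a" using tr d by (simp add: a_def)
  have "2 * ln (s $ i) \<le> ln a + ((s $ i)\<^sup>2 / a - 1)" if "i < d" for i
  proof -
    have p: "0 < s $ i" using pos that by simp
    have "ln ((s $ i)\<^sup>2 / a) \<le> (s $ i)\<^sup>2 / a - 1" using p a by (intro ln_le_minus_one) simp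
    moreover have "ln ((s $ i)\<^sup>2 / a) = 2 * ln (s $ i) - ln a"
      using p a by (simp add: ln_div ln_realpow)
    ultimately show ?thesis by simp
  qed
  then have "(\<Sum>i<d. 2 * ln (s $ i)) \<le> (\<Sum>i<d. ln a + ((s $ i)\<^sup>2 / a - 1))"
    by (intro sum_mono) auto
  also have "\<dots> = d * ln a + (trace_sq d s / a - d)"
    by (simp add: sum.distrib sum_subtractf trace_sq_def sum_divide_distrib)
  also have "trace_sq d s / a = d" using tr d by (simp add: a_def)
  finally show "logvol d s \<le> d * ln (trace_sq d s / d)"
    by (simp add: logvol_def sum_distrib_left a_def)
qed

lemma sum_sq_transpose:
  assumes "orthogonal_matrix_of d V" "z \<in> carrier_vec d"
  shows "(\<Sum>i<d. ((V\<^sup>T *\<^sub>v z) $ i)\<^sup>2) = (enorm z)\<^sup>2"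
proof -
  have "(V\<^sup>T *\<^sub>v z) \<bullet> (V\<^sup>T *\<^sub>v z) = z \<bullet> z"
    by (rule orthogonal_scalar_prod[OF orthogonal_matrix_transpose[OF assms(1)] assms(2,2)])
  then show ?thesis
    using orthogonal_matrixD(1)[OF assms(1)]
    unfolding enorm_sq
    by (simp add: scalar_prod_def[of "V\<^sup>T *\<^sub>v z"] lessThan_atLeast0 power2_eq_square
        del: index_mult_mat_vec)
qed

text \<open>Every coordinate of \<open>V^T z\<close> is at most \<open>|z|\<close> in absolute
  value. The sum of all squared singular values replaces the largest one because that sum is what
  \<open>trace_sq_bound\<close> controls.\<close>

lemma dual_form_le_trace:
  assumes V: "orthogonal_matrix_of d V" and z: "z \<in> carrier_vec d"
  shows "dual_form d s V z \<le> trace_sq d s * (enorm z)\<^sup>2"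
proof -
  have "((V\<^sup>T *\<^sub>v z) $ i)\<^sup>2 \<le> (enorm z)\<^sup>2" if "i < d" for i
    unfolding sum_sq_transpose[OF V z, symmetric]
    using that by (intro member_le_sum) auto
  then show ?thesis
    unfolding dual_form_def trace_sq_def sum_distrib_right power_mult_distrib
    by (intro sum_mono mult_left_mono) auto
qed

text \<open>
  Raising a singular value \<open>s'\<^sub>i < m\<close> to \<open>m\<close> increases its square by at most
  \<open>m\<^sup>2 ln (m\<^sup>2 / s'\<^sub>i\<^sup>2)\<close>, so every increase is paid for by the logarithm of the volume.
\<close>

lemma clamp:
  assumes pos: "\<forall>i<d. 0 < s' $ i" and m: "0 < m"
    and s: "s = vec d (\<lambda>i. max (s' $ i) m)"
    and V: "orthogonal_matrix_of d V"
  obtains c where "0 \<le> c" "c \<le> 1" "c \<le> logvol d s - logvol d s'"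
    "\<And>z. z \<in> carrier_vec d \<Longrightarrow> dual_form d s V z \<le> dual_form d s' V z + c * m\<^sup>2 * (enorm z)\<^sup>2"
    "trace_sq d s \<le> trace_sq d s' + m\<^sup>2 * (logvol d s - logvol d s')"
    "trace_sq d s \<le> trace_sq d s' + m\<^sup>2 * d"
proof -
  define \<delta> where "\<delta> i = 2 * ln (s $ i) - 2 * ln (s' $ i)" for i
  have D: "logvol d s - logvol d s' = (\<Sum>i<d. \<delta> i)"
    by (simp add: logvol_def \<delta>_def sum_subtractf sum_distrib_left)
  have \<delta>: "0 \<le> \<delta> i" "(s $ i)\<^sup>2 - (s' $ i)\<^sup>2 \<le> m\<^sup>2 * \<delta> i" "(s $ i)\<^sup>2 - (s' $ i)\<^sup>2 \<le> m\<^sup>2"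
    if i: "i < d" for i
  proof -
    have p: "0 < s' $ i" using pos i by simp
    have si: "s $ i = max (s' $ i) m" using i by (simp add: s)
    show "0 \<le> \<delta> i" using p by (simp add: \<delta>_def si)
    show "(s $ i)\<^sup>2 - (s' $ i)\<^sup>2 \<le> m\<^sup>2"
      using p m by (cases "s' $ i \<le> m") (auto simp: si max_def)
    show "(s $ i)\<^sup>2 - (s' $ i)\<^sup>2 \<le> m\<^sup>2 * \<delta> i"
    proof (cases "s' $ i \<le> m")
      case True
      have "ln ((s' $ i)\<^sup>2 / m\<^sup>2) \<le> (s' $ i)\<^sup>2 / m\<^sup>2 - 1" using p m by (intro ln_le_minus_one) simp
      moreover have "ln ((s' $ i)\<^sup>2 / m\<^sup>2) = - \<delta> i"
        using p m True by (simp add: ln_div ln_realpow \<delta>_def si max_def)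
      ultimately have "m\<^sup>2 * (1 - (s' $ i)\<^sup>2 / m\<^sup>2) \<le> m\<^sup>2 * \<delta> i"
        by (intro mult_left_mono) auto
      then show ?thesis using m True by (simp add: si max_def algebra_simps)
    qed (simp add: si \<delta>_def)
  qed
  \<comment> \<open>One coefficient for all coordinates: a squared singular value grows by at most
    \<open>m^2\<close> and by at most \<open>m^2 \<delta> i\<close>, and each
    \<open>\<delta> i\<close> is at most the total increase of the logarithmic volume.\<close>
  define c where "c = min 1 (\<Sum>i<d. \<delta> i)"
  have D0: "0 \<le> (\<Sum>i<d. \<delta> i)" using \<delta>(1) by (intro sum_nonneg) auto
  show ?thesis
  proof
    show "0 \<le> c" "c \<le> 1" "c \<le> logvol d s - logvol d s'" using D0 by (auto simp: c_def D)
    show "trace_sq d s \<le> trace_sq d s' + m\<^sup>2 * (logvol d s - logvol d s')"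
      using sum_mono[of "{..<d}" "\<lambda>i. (s $ i)\<^sup>2 - (s' $ i)\<^sup>2" "\<lambda>i. m\<^sup>2 * \<delta> i"] \<delta>(2)
      by (simp add: trace_sq_def D sum_subtractf sum_distrib_left)
    show "trace_sq d s \<le> trace_sq d s' + m\<^sup>2 * d"
      using sum_mono[of "{..<d}" "\<lambda>i. (s $ i)\<^sup>2 - (s' $ i)\<^sup>2" "\<lambda>i. m\<^sup>2"] \<delta>(3)
      by (simp add: trace_sq_def sum_subtractf mult.commute)
    fix z :: "real vec" assume z: "z \<in> carrier_vec d"
    let ?y = "\<lambda>i. ((V\<^sup>T *\<^sub>v z) $ i)\<^sup>2"
    have "dual_form d s V z - dual_form d s' V z = (\<Sum>i<d. ((s $ i)\<^sup>2 - (s' $ i)\<^sup>2) * ?y i)"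
      by (simp add: dual_form_def sum_subtractf[symmetric] power_mult_distrib algebra_simps)
    also have "\<dots> \<le> (\<Sum>i<d. c * m\<^sup>2 * ?y i)"
    proof (intro sum_mono mult_right_mono)
      fix i assume i: "i \<in> {..<d}"
      have "\<delta> i \<le> (\<Sum>i<d. \<delta> i)" using i \<delta>(1) by (intro member_le_sum) auto
      then have "m\<^sup>2 * \<delta> i \<le> m\<^sup>2 * (\<Sum>i<d. \<delta> i)" by (intro mult_left_mono) auto
      then show "(s $ i)\<^sup>2 - (s' $ i)\<^sup>2 \<le> c * m\<^sup>2"
        using \<delta>(2,3)[of i] i by (auto simp: c_def min_def mult.commute)
    qed simp
    also have "\<dots> = c * m\<^sup>2 * (enorm z)\<^sup>2"
      by (simp add: sum_distrib_left[symmetric] sum_sq_transpose[OF V z])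
    finally show "dual_form d s V z \<le> dual_form d s' V z + c * m\<^sup>2 * (enorm z)\<^sup>2" by simp
  qed
qed

text \<open>As long as nothing has changed, \<open>D\<close> has no lower bound, so the first change
  is charged the flat amount \<open>K\<close>. After it \<open>D\<close> is at least
  \<open>L\<close>, and from then on the charges \<open>H * (D t - D (t - 1))\<close> telescope to
  at most \<open>H * (D N - L)\<close>. The second alternative of \<open>init\<close> is for runs in
  which \<open>K\<close> is already spent at time \<open>T\<close>.\<close>

lemma potential_growth:
  fixes Q D :: "nat \<Rightarrow> real"
  assumes H: "0 \<le> H" and TN: "T \<le> N"
    and init: "Q T = Q0 \<or> (Q T \<le> Q0 + K \<and> L \<le> D T)"
    and step: "\<And>t. T < t \<Longrightarrow> t \<le> N \<Longrightarrow> (Q t = Q (t - 1) \<and> D t = D (t - 1)) \<or>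
        (Q t \<le> Q (t - 1) + K \<and> Q t \<le> Q (t - 1) + H * (D t - D (t - 1)) \<and> D (t - 1) \<le> D t \<and> L \<le> D t)"
  shows "Q N = Q0 \<or> (Q N \<le> Q0 + K + H * (D N - L) \<and> L \<le> D N)"
  using TN step
proof (induction N rule: dec_induct)
  case base
  have "0 \<le> H * (D T - L)" if "L \<le> D T" using H that by simp
  with init show ?case by fastforce
next
  case (step t)
  have IH: "Q t = Q0 \<or> (Q t \<le> Q0 + K + H * (D t - L) \<and> L \<le> D t)"
    using step.IH step.prems by simp
  from step.prems[of "Suc t"] step.hyps
  consider "Q (Suc t) = Q t" "D (Suc t) = D t"
    | "Q (Suc t) \<le> Q t + K" "Q (Suc t) \<le> Q t + H * (D (Suc t) - D t)" "L \<le> D (Suc t)"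
    by fastforce
  then show ?case
  proof cases
    case 1
    then show ?thesis using IH by simp
  next
    case 2
    have "0 \<le> H * (D (Suc t) - L)" using H 2(3) by simp
    then show ?thesis using IH 2 by (auto simp: algebra_simps)
  qed
qed

lemma max_norm_mono: "1 \<le> t \<Longrightarrow> t \<le> t' \<Longrightarrow> max_norm x t \<le> max_norm x t'"
  unfolding max_norm_def by (intro Max_mono image_mono) auto

section \<open>The ellipsoid of a run\<close>

context
  fixes d n :: nat and x :: "nat \<Rightarrow> real vec" and \<xi> :: real
    and U :: "nat \<Rightarrow> real mat" and s :: "nat \<Rightarrow> real vec" and V :: "nat \<Rightarrow> real mat"
  assumes valid: "valid_input d n x \<xi>" and run: "scale_indep_run d n x \<xi> U s V"
begin

private lemma run_input: "1 \<le> d" "1 \<le> n" "\<And>i. i \<in> {1..n} \<Longrightarrow> x i \<in> carrier_vec d" "x 1 \<noteq> 0\<^sub>v d"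
  using valid by (auto simp: valid_input_def)

private lemmas run_xi_pos = xi_pos[OF valid]
private lemmas run_xi_ge_1 = xi_ge_1[OF valid]

private abbreviation (input) "A t \<equiv> inv_factored d (U t) (s t) (V t)"
private abbreviation (input) "M t \<equiv> max_norm x t"
private abbreviation (input) "D t \<equiv> logvol d (s t)"

private lemma max_norm_1: "max_norm x 1 = enorm (x 1)" by (simp add: max_norm_def)

lemma max_norm_prefix_pos: "1 \<le> t \<Longrightarrow> 0 < max_norm x t"
  using max_norm_mono[of 1 t x] max_norm_1 run_input enorm_eq_0_iff[of "x 1" d] enorm_nonneg[of "x 1"]
  by fastforce

text \<open>The transpose of \<open>V 1\<close> maps \<open>x 1\<close> to the first axis, whose
  singular value is \<open>|x 1|\<close>, so \<open>A 1\<close> sends \<open>x 1\<close> to a unit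
  vector. The other singular values equal \<open>M_1 / \<xi>\<close>, so the initial state already
  looks clamped.\<close>

lemma run_init:
  "svd_factors d (U 1) (s 1) (V 1)"
  "i < d \<Longrightarrow> max_norm x 1 / \<xi> \<le> s 1 $ i"
  "enorm (A 1 *\<^sub>v x 1) \<le> 1"
  "trace_sq d (s 1) \<le> d * (max_norm x 1)\<^sup>2"
  "z \<in> carrier_vec d \<Longrightarrow> dual_form d (s 1) (V 1) z \<le> (x 1 \<bullet> z)\<^sup>2 + (max_norm x 1 / \<xi> * enorm z)\<^sup>2"
proof -
  have V: "orthogonal_matrix_of d (V 1)" and Vx: "(V 1)\<^sup>T *\<^sub>v x 1 = enorm (x 1) \<cdot>\<^sub>v unit_vec d 0"
    and U: "U 1 = 1\<^sub>m d" and s: "s 1 = vec d (\<lambda>i. if i = 0 then enorm (x 1) else enorm (x 1) / \<xi>)"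
    using run by (auto simp: scale_indep_run_def)
  have x1: "x 1 \<in> carrier_vec d" using run_input by simp
  define \<rho> where "\<rho> = enorm (x 1)"
  have \<rho>: "0 < \<rho>" "max_norm x 1 = \<rho>" using max_norm_prefix_pos[of 1] max_norm_1 by (auto simp: \<rho>_def)
  have \<rho>\<xi>: "\<rho> / \<xi> \<le> \<rho>" "0 < \<rho> / \<xi>" using \<rho> run_xi_ge_1 by (simp_all add: field_simps)
  have si: "s 1 $ i = (if i = 0 then \<rho> else \<rho> / \<xi>)" if "i < d" for i using that s by (simp add: \<rho>_def)
  show F: "svd_factors d (U 1) (s 1) (V 1)"
    using V U s \<rho> \<rho>\<xi> by (auto simp: svd_factors_def orthogonal_matrix_of_def \<rho>_def)
  show "max_norm x 1 / \<xi> \<le> s 1 $ i" if "i < d" for i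
    using si[OF that] \<rho> \<rho>\<xi> by simp
  have "(enorm (A 1 *\<^sub>v x 1))\<^sup>2 = (\<Sum>i<d. if i = 0 then 1 else 0)"
    unfolding inv_factored_norm[OF F x1] using \<rho>
    by (intro sum.cong refl) (auto simp: Vx si \<rho>_def[symmetric] simp del: One_nat_def)
  also have "\<dots> = 1" using run_input(1) by simp
  finally have "(enorm (A 1 *\<^sub>v x 1))\<^sup>2 \<le> 1\<^sup>2" by simp
  then show "enorm (A 1 *\<^sub>v x 1) \<le> 1" by (rule power2_le_imp_le) simp
  have "trace_sq d (s 1) \<le> (\<Sum>i<d. \<rho>\<^sup>2)"
    unfolding trace_sq_def using \<rho> \<rho>\<xi> by (intro sum_mono power_mono) (auto simp: si simp del: One_nat_def)
  then show "trace_sq d (s 1) \<le> d * (max_norm x 1)\<^sup>2" by (simp add: \<rho> del: One_nat_def)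
  show "dual_form d (s 1) (V 1) z \<le> (x 1 \<bullet> z)\<^sup>2 + (max_norm x 1 / \<xi> * enorm z)\<^sup>2"
    if z: "z \<in> carrier_vec d" for z
  proof -
    have "x 1 \<bullet> z = ((V 1)\<^sup>T *\<^sub>v x 1) \<bullet> ((V 1)\<^sup>T *\<^sub>v z)"
      using orthogonal_scalar_prod[OF orthogonal_matrix_transpose[OF V] x1 z] by simp
    also have "\<dots> = \<rho> * ((V 1)\<^sup>T *\<^sub>v z) $ 0"
      unfolding Vx \<rho>_def[symmetric] using run_input(1) orthogonal_matrixD(1)[OF V]
      by (subst smult_scalar_prod_distrib[of _ d]) (auto simp: z)
    finally have x0: "(x 1 \<bullet> z)\<^sup>2 = (\<rho> * ((V 1)\<^sup>T *\<^sub>v z) $ 0)\<^sup>2" by simp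
    \<comment> \<open>For \<open>i = 0\<close> the bound contains an extra term with
      \<open>(\<rho> / \<xi>)^2\<close>, which completes the second part to a multiple of the full
      squared norm of \<open>z\<close>.\<close>
    have "dual_form d (s 1) (V 1) z
        \<le> (\<Sum>i<d. (if i = 0 then (x 1 \<bullet> z)\<^sup>2 else 0) + (\<rho> / \<xi>)\<^sup>2 * (((V 1)\<^sup>T *\<^sub>v z) $ i)\<^sup>2)"
      unfolding dual_form_def by (intro sum_mono) (auto simp: si x0 power_mult_distrib simp del: One_nat_def)
    also have "\<dots> = (x 1 \<bullet> z)\<^sup>2 + (\<rho> / \<xi>)\<^sup>2 * (enorm z)\<^sup>2"
      using run_input(1) sum_sq_transpose[OF V z] by (simp add: sum.distrib sum_distrib_left[symmetric])
    finally show ?thesis by (simp add: \<rho> power_mult_distrib power_divide del: One_nat_def)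
  qed
qed

text \<open>In the second case, \<open>g = 1 - 1 / \<alpha>^2\<close> stems from the rank-one step
  and \<open>c\<close> from clamping, and the growth of the logarithmic volume pays for both. The
  trace is bounded twice, by a flat amount and by that growth, as \<open>potential_growth\<close>
  requires. For \<open>dual_form\<close> both kinds of bound follow from the conditions on
  \<open>g\<close> and \<open>c\<close>.\<close>

lemma run_step:
  assumes t: "t \<in> {2..n}" and F: "svd_factors d (U (t - 1)) (s (t - 1)) (V (t - 1))"
  shows "svd_factors d (U t) (s t) (V t)" (is ?factors)
    and "enorm (A t *\<^sub>v x t) \<le> 1" (is ?covers)
    and "v \<in> carrier_vec d \<Longrightarrow> enorm (A t *\<^sub>v v) \<le> enorm (A (t - 1) *\<^sub>v v)" (is "_ \<Longrightarrow> ?mono v")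
    and "(s t = s (t - 1) \<and> V t = V (t - 1)) \<or>
      (\<exists>g c. 0 \<le> g \<and> g \<le> 1 \<and> 0 \<le> c \<and> c \<le> 1 \<and> g + c \<le> D t - D (t - 1) \<and>
        (\<forall>i<d. max_norm x t / \<xi> \<le> s t $ i) \<and>
        (\<forall>z\<in>carrier_vec d. dual_form d (s t) (V t) z
           \<le> dual_form d (s (t - 1)) (V (t - 1)) z + g * (x t \<bullet> z)\<^sup>2 + c * (M t / \<xi> * enorm z)\<^sup>2) \<and>
        trace_sq d (s t) \<le> trace_sq d (s (t - 1)) + 2 * d * (M t)\<^sup>2 \<and>
        trace_sq d (s t) \<le> trace_sq d (s (t - 1)) + (M t)\<^sup>2 * (D t - D (t - 1)))" (is ?cases)
proof -
  have xt: "x t \<in> carrier_vec d" using t run_input(3) by auto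
  have "?factors \<and> ?covers \<and> (\<forall>v\<in>carrier_vec d. ?mono v) \<and> ?cases"
  proof (cases "1 < enorm (A (t - 1) *\<^sub>v x t)")
    case False
    then have "U t = U (t - 1)" "s t = s (t - 1)" "V t = V (t - 1)"
      using run t by (auto simp: scale_indep_run_def Let_def)
    then show ?thesis using F False by simp
  next
    case True
    have "if 1 < enorm (A (t - 1) *\<^sub>v x t)
      then \<exists>s'. svd_inv d (rank_one_step d (A (t - 1)) (x t)) (U t) s' (V t) \<and>
                s t = vec d (\<lambda>i. max (s' $ i) (max_norm x t / \<xi>))
      else U t = U (t - 1) \<and> s t = s (t - 1) \<and> V t = V (t - 1)"
      using run t unfolding scale_indep_run_def Let_def by blast
    then obtain s' where S: "svd_inv d (rank_one_step d (A (t - 1)) (x t)) (U t) s' (V t)"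
      and st: "s t = vec d (\<lambda>i. max (s' $ i) (max_norm x t / \<xi>))"
      unfolding if_P[OF True] by blast
    from S have F': "svd_factors d (U t) s' (V t)"
      and A': "inv_factored d (U t) s' (V t) = rank_one_step d (A (t - 1)) (x t)"
      by (auto simp: svd_inv_def svd_factors_def)
    have VT: "orthogonal_matrix_of d (V t)" "\<forall>i<d. 0 < s' $ i" using F' by (auto simp: svd_factors_def)
    define m where "m = M t / \<xi>"
    have Mt: "0 < M t" using max_norm_prefix_pos[of t] t by simp
    have m: "0 < m" "m \<le> M t" using Mt run_xi_pos run_xi_ge_1 by (simp_all add: m_def field_simps)
    have m2: "m\<^sup>2 \<le> (M t)\<^sup>2" using m by (intro power_mono) auto
    have FT: "svd_factors d (U t) (s t) (V t)"
      using F' m by (auto simp: svd_factors_def st m_def[symmetric])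
    \<comment> \<open>Clamping can only enlarge the entries of \<open>s\<close>, whose inverses
      scale the coordinates of \<open>A v\<close>.\<close>
    have le: "enorm (A t *\<^sub>v v) \<le> enorm (inv_factored d (U t) s' (V t) *\<^sub>v v)" if v: "v \<in> carrier_vec d" for v
    proof (rule power2_le_imp_le)
      show "(enorm (A t *\<^sub>v v))\<^sup>2 \<le> (enorm (inv_factored d (U t) s' (V t) *\<^sub>v v))\<^sup>2"
        unfolding inv_factored_norm[OF FT v] inv_factored_norm[OF F' v] power_divide
      proof (intro sum_mono divide_left_mono)
        fix i assume i: "i \<in> {..<d}"
        then have p: "0 < s' $ i" "s' $ i \<le> s t $ i" using VT(2) by (auto simp: st)
        show "(s' $ i)\<^sup>2 \<le> (s t $ i)\<^sup>2" using p by (intro power_mono) auto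
        show "0 < (s t $ i)\<^sup>2 * (s' $ i)\<^sup>2" using p by simp
      qed simp
    qed (rule enorm_nonneg)
    define \<alpha> where "\<alpha> = enorm (A (t - 1) *\<^sub>v x t)"
    have \<alpha>: "1 < \<alpha>" using True by (simp add: \<alpha>_def)
    note upd = factors_update[OF F F' A' xt True \<alpha>_def]
    define g where "g = 1 - 1 / \<alpha>\<^sup>2"
    have g: "0 \<le> g" "g \<le> 1" using \<alpha> by (simp_all add: g_def field_simps)
    have sp: "\<forall>i<d. 0 < s (t - 1) $ i" using F by (auto simp: svd_factors_def)
    have "logvol d s' = 2 * ln (\<alpha> * (\<Prod>i<d. s (t - 1) $ i))"
      by (simp only: logvol_prod[OF VT(2)] upd(3)[OF run_input(1)])
    also have "\<dots> = 2 * ln \<alpha> + D (t - 1)"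
      using factors_prod_pos[OF F] \<alpha> by (simp only: ln_mult_pos logvol_prod[OF sp]) simp
    finally have "logvol d s' = 2 * ln \<alpha> + D (t - 1)" .
    \<comment> \<open>\<open>ln t \<le> t - 1\<close> at \<open>t = 1 / \<alpha>^2\<close>, which
      amounts to \<open>g \<le> ln (\<alpha>^2)\<close>.\<close>
    moreover have "- ln (\<alpha>\<^sup>2) \<le> 1 / \<alpha>\<^sup>2 - 1"
      using ln_le_minus_one[of "1 / \<alpha>\<^sup>2"] \<alpha> by (simp add: ln_div)
    then have "g \<le> 2 * ln \<alpha>" using \<alpha> by (simp add: g_def ln_realpow)
    ultimately have gD: "g \<le> logvol d s' - D (t - 1)" by simp
    obtain c where c: "0 \<le> c" "c \<le> 1" "c \<le> D t - logvol d s'"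
      and cq: "\<And>z. z \<in> carrier_vec d \<Longrightarrow> dual_form d (s t) (V t) z \<le> dual_form d s' (V t) z + c * m\<^sup>2 * (enorm z)\<^sup>2"
      and ct: "trace_sq d (s t) \<le> trace_sq d s' + m\<^sup>2 * (D t - logvol d s')"
        "trace_sq d (s t) \<le> trace_sq d s' + m\<^sup>2 * d"
      using clamp[OF VT(2) m(1) st[folded m_def] VT(1)] by metis
    have xM: "(enorm (x t))\<^sup>2 \<le> (M t)\<^sup>2"
      using max_norm_ge[of t t x] t enorm_nonneg by (intro power_mono) auto
    have tr: "trace_sq d s' \<le> trace_sq d (s (t - 1)) + g * (M t)\<^sup>2"
      using upd(2) mult_left_mono[OF xM g(1)] by (simp add: trace_sq_def g_def)
    have tr1: "trace_sq d (s t) \<le> trace_sq d (s (t - 1)) + 2 * d * (M t)\<^sup>2"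
    proof -
      have "g * (M t)\<^sup>2 \<le> d * (M t)\<^sup>2" using g run_input(1) by (intro mult_right_mono) auto
      moreover have "m\<^sup>2 * d \<le> (M t)\<^sup>2 * d" using m2 by (intro mult_right_mono) auto
      ultimately show ?thesis using tr ct(2) by (simp add: algebra_simps)
    qed
    have tr2: "trace_sq d (s t) \<le> trace_sq d (s (t - 1)) + (M t)\<^sup>2 * (D t - D (t - 1))"
    proof -
      have "g * (M t)\<^sup>2 \<le> (logvol d s' - D (t - 1)) * (M t)\<^sup>2" using gD by (intro mult_right_mono) auto
      moreover have "m\<^sup>2 * (D t - logvol d s') \<le> (M t)\<^sup>2 * (D t - logvol d s')"
        using m2 c by (intro mult_right_mono) auto
      ultimately show ?thesis using tr ct(1) by (simp add: algebra_simps)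
    qed
    have q: "dual_form d (s t) (V t) z
        \<le> dual_form d (s (t - 1)) (V (t - 1)) z + g * (x t \<bullet> z)\<^sup>2 + c * (m * enorm z)\<^sup>2"
      if "z \<in> carrier_vec d" for z
      using cq[OF that] upd(1)[OF that] by (simp add: g_def power_mult_distrib mult.assoc)
    have "?mono v" if "v \<in> carrier_vec d" for v
      using le[OF that] rank_one_step_norm_le(1)[OF F xt that True] by (simp add: A')
    moreover have ?covers
      using le[OF xt] rank_one_step_norm_le(2)[OF F xt xt True] by (simp add: A')
    moreover have ?cases
      using g c gD tr1 tr2 q
      by (intro disjI2 exI[of _ g] exI[of _ c]) (auto simp: st m_def[symmetric])
    ultimately show ?thesis using FT by blast
  qed
  then show ?factors ?covers "v \<in> carrier_vec d \<Longrightarrow> ?mono v" ?cases by blast+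
qed

lemma run_factors:
  assumes "t \<in> {1..n}"
  shows "svd_factors d (U t) (s t) (V t)"
proof -
  have "1 \<le> t" "t \<le> n" using assms by auto
  then show ?thesis
  proof (induction t rule: dec_induct)
    case (step t)
    then show ?case using run_step(1)[of "Suc t"] by simp
  qed (rule run_init(1))
qed

text \<open>A point is covered as soon as it has been processed, and no later step increases the
  norm of its image.\<close>

lemma run_covers:
  assumes i: "i \<in> {1..n}" and t: "i \<le> t" "t \<le> n"
  shows "enorm (A t *\<^sub>v x i) \<le> 1"
  using t
proof (induction t rule: dec_induct)
  case base
  show ?case
  proof (cases "i = 1")
    case True
    then show ?thesis using run_init(3) by simp
  next
    case False
    then have "i - 1 \<in> {1..n}" "i \<in> {2..n}" using i by auto
    then show ?thesis using run_step(2)[of i] run_factors[of "i - 1"] by simp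
  qed
next
  case (step t)
  then show ?case
    using run_step(3)[of "Suc t" "x i"] run_factors[of t] i run_input(3)[OF i] by simp
qed

private lemma step_cases:
  assumes "t \<in> {2..n}"
  obtains (unchanged) "s t = s (t - 1)" "V t = V (t - 1)"
  | (update) g c where "0 \<le> g" "g \<le> 1" "0 \<le> c" "c \<le> 1" "g + c \<le> D t - D (t - 1)"
      "\<forall>i<d. M t / \<xi> \<le> s t $ i"
      "\<And>z. z \<in> carrier_vec d \<Longrightarrow> dual_form d (s t) (V t) z
         \<le> dual_form d (s (t - 1)) (V (t - 1)) z + g * (x t \<bullet> z)\<^sup>2 + c * (M t / \<xi> * enorm z)\<^sup>2"
      "trace_sq d (s t) \<le> trace_sq d (s (t - 1)) + 2 * d * (M t)\<^sup>2"
      "trace_sq d (s t) \<le> trace_sq d (s (t - 1)) + (M t)\<^sup>2 * (D t - D (t - 1))"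
proof -
  have "svd_factors d (U (t - 1)) (s (t - 1)) (V (t - 1))"
    using assms by (intro run_factors) auto
  from run_step(4)[OF assms this] show ?thesis using that by blast
qed

text \<open>\<open>1 + x + x^2 / 2\<close> already exceeds 2 at \<open>x = 3/4\<close>. With this
  value the inequality that ends the proof of \<open>trace_sq_bound\<close> closes exactly.\<close>

lemma ln_2_le: "ln 2 \<le> (3/4 :: real)"
proof -
  have "2 \<le> exp (3/4 :: real)"
    using exp_lower_Taylor_quadratic[of "3/4 :: real"] by (simp add: power2_eq_square)
  then show ?thesis using ln_ge_iff[of 2 "3/4"] ln_le_cancel_iff[of 2 "exp (3/4)"] by simp
qed

section \<open>Bounds on the trace and on the support function of the ellipsoid\<close>

lemma logvol_ge:
  assumes "0 < a" "\<forall>i<d. a \<le> v $ i"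
  shows "2 * d * ln a \<le> logvol d v"
proof -
  have "(\<Sum>i<d. ln a) \<le> (\<Sum>i<d. ln (v $ i))"
    using assms by (intro sum_mono ln_mono) fastforce+
  then show ?thesis by (simp add: logvol_def)
qed

text \<open>
  The last time \<open>T\<close> at which \<open>M\<close> is below a threshold splits the run: before \<open>T\<close> the potential
  is small because the points are, and from the first update after \<open>T\<close> on the volume is
  bounded below because the singular values are clamped.
\<close>

private lemma threshold_split:
  assumes t: "t \<in> {1..n}" and \<theta>: "0 < \<theta>"  and \<theta>M: "\<theta> \<le> M t"
  obtains (early) T where "1 \<le> T" "T < t" "M T < \<theta>" "\<And>\<tau>. T < \<tau> \<Longrightarrow> \<tau> \<le> t \<Longrightarrow> \<theta> \<le> M \<tau>"
  | (never) "\<And>\<tau>. 1 \<le> \<tau> \<Longrightarrow> \<tau> \<le> t \<Longrightarrow> \<theta> \<le> M \<tau>"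
proof (cases "\<theta> \<le> M 1")
  case True
  then show ?thesis using never max_norm_mono[of 1 _ x] by force
next
  case False
  define T where "T = Max {\<tau>\<in>{1..t}. M \<tau> < \<theta>}"
  have "1 \<in> {\<tau>\<in>{1..t}. M \<tau> < \<theta>}" using False t by auto
  then have T: "T \<in> {\<tau>\<in>{1..t}. M \<tau> < \<theta>}" unfolding T_def by (intro Max_in) auto
  have "T \<noteq> t" using T \<theta>M by auto
  moreover have "\<theta> \<le> M \<tau>" if "T < \<tau>" "\<tau> \<le> t" for \<tau>
  proof (rule ccontr)
    assume "\<not> \<theta> \<le> M \<tau>"
    then have "\<tau> \<le> T" unfolding T_def using that T by (intro Max_ge) auto
    then show False using that by simp
  qed
  ultimately show ?thesis using early[of T] T by auto
qed

text \<open>Strong induction through the threshold \<open>M t / 2\<close>: at the splitting time the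
  induction hypothesis contributes at most a quarter of the claimed bound. The remaining growth is
  controlled by the volume, which is in turn bounded by the trace itself, so an inequality of the
  form \<open>y \<le> b + ln y\<close> for the normalised trace has to be solved.\<close>

lemma trace_sq_bound:
  assumes "t \<in> {1..n}"
  shows "trace_sq d (s t) \<le> (8 + 4 * ln \<xi>) * d * (max_norm x t)\<^sup>2"
  using assms
proof (induction t rule: less_induct)
  case (less t)
  define C where "C = 8 + 4 * ln \<xi>"
  have lnxi: "0 \<le> ln \<xi>" using run_xi_ge_1 by simp
  \<comment> \<open>Once \<open>M \<tau>\<close> is at least \<open>M t / 2\<close>, all clamped
    singular values are at least \<open>M t / (2 \<xi>)\<close>.\<close>
  define L where "L = 2 * d * ln (M t / (2 * \<xi>))"
  have Mt: "0 < M t" using max_norm_prefix_pos less.prems by simp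
  have d: "0 < real d" using run_input(1) by simp
  have Lt: "L \<le> D \<tau>" if "M t / 2 \<le> M \<tau>" "\<forall>i<d. M \<tau> / \<xi> \<le> s \<tau> $ i" for \<tau>
    unfolding L_def
  proof (rule logvol_ge)
    have "M t / (2 * \<xi>) \<le> M \<tau> / \<xi>" using that(1) run_xi_pos by (simp add: field_simps)
    then show "\<forall>i<d. M t / (2 * \<xi>) \<le> s \<tau> $ i" using that(2) by force
  qed (use Mt run_xi_pos in simp)
  \<comment> \<open>The increments at time \<open>\<tau>\<close> are weakened to the scale
    \<open>M t\<close> of the final time, so that the coefficients \<open>K\<close> and
    \<open>H\<close> of \<open>potential_growth\<close> are constant.\<close>
  have step: "(trace_sq d (s \<tau>) = trace_sq d (s (\<tau> - 1)) \<and> D \<tau> = D (\<tau> - 1)) \<or>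
      (trace_sq d (s \<tau>) \<le> trace_sq d (s (\<tau> - 1)) + 2 * d * (M t)\<^sup>2 \<and>
       trace_sq d (s \<tau>) \<le> trace_sq d (s (\<tau> - 1)) + (M t)\<^sup>2 * (D \<tau> - D (\<tau> - 1)) \<and>
       D (\<tau> - 1) \<le> D \<tau> \<and> L \<le> D \<tau>)"
    if \<tau>: "2 \<le> \<tau>" "\<tau> \<le> t" "M t / 2 \<le> M \<tau>" for \<tau>
  proof -
    have "\<tau> \<in> {2..n}" using \<tau> less.prems by auto
    then show ?thesis
    proof (cases rule: step_cases)
      case (update g c)
      then have D: "0 \<le> D \<tau> - D (\<tau> - 1)" by simp
      have M2: "(M \<tau>)\<^sup>2 \<le> (M t)\<^sup>2"
        using max_norm_mono[of \<tau> t x] max_norm_prefix_pos[of \<tau>] \<tau> by (intro power_mono) auto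
      have "2 * d * (M \<tau>)\<^sup>2 \<le> 2 * d * (M t)\<^sup>2" using M2 by (intro mult_left_mono) auto
      moreover have "(M \<tau>)\<^sup>2 * (D \<tau> - D (\<tau> - 1)) \<le> (M t)\<^sup>2 * (D \<tau> - D (\<tau> - 1))"
        using M2 D by (intro mult_right_mono) auto
      ultimately show ?thesis using update(8,9) D Lt[OF \<tau>(3) update(6)] by auto
    qed simp
  qed
  obtain Q0 where Q0: "0 \<le> Q0" "Q0 \<le> C * d * (M t)\<^sup>2 / 4" and tr_t:
    "trace_sq d (s t) = Q0 \<or> (trace_sq d (s t) \<le> Q0 + 2 * d * (M t)\<^sup>2 + (M t)\<^sup>2 * (D t - L) \<and> L \<le> D t)"
  proof -
    have "0 < M t / 2" "M t / 2 \<le> M t" using Mt by auto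
    with less.prems show ?thesis
    proof (cases rule: threshold_split)
      case (early T)
      have "trace_sq d (s T) \<le> C * d * (M T)\<^sup>2"
        using less.IH[of T] early less.prems by (simp add: C_def)
      also have "\<dots> \<le> C * d * (M t / 2)\<^sup>2"
        using early lnxi max_norm_prefix_pos[of T] by (intro mult_left_mono power_mono) (auto simp: C_def)
      finally have T: "trace_sq d (s T) \<le> C * d * (M t)\<^sup>2 / 4" by (simp add: power_divide)
      show ?thesis
      proof (rule that[OF _ T])
        show "0 \<le> trace_sq d (s T)" by (simp add: trace_sq_def sum_nonneg)
        show "trace_sq d (s t) = trace_sq d (s T) \<or>
          (trace_sq d (s t) \<le> trace_sq d (s T) + 2 * d * (M t)\<^sup>2 + (M t)\<^sup>2 * (D t - L) \<and> L \<le> D t)"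
          using early step by (intro potential_growth[where T = T and Q = "\<lambda>t. trace_sq d (s t)"]) auto
      qed
    next
      \<comment> \<open>The run starts in the second phase. With \<open>Q0 = 0\<close>, the trace of
        \<open>s 1\<close> is charged to the flat amount, as if the initial ellipsoid came from an
        update.\<close>
      case never
      have t: "1 \<le> t" using less.prems by simp
      have "(M 1)\<^sup>2 \<le> (M t)\<^sup>2"
        using max_norm_mono[of 1 t x] max_norm_prefix_pos[of 1] t by (intro power_mono) auto
      then have "d * (M 1)\<^sup>2 \<le> d * (M t)\<^sup>2" by (rule mult_left_mono) simp
      moreover have "0 \<le> d * (M t)\<^sup>2" by simp
      ultimately have "d * (M 1)\<^sup>2 \<le> 2 * d * (M t)\<^sup>2" by linarith
      then have "trace_sq d (s 1) \<le> 0 + 2 * d * (M t)\<^sup>2" using run_init(4) by simp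
      moreover have "L \<le> D 1" using Lt[of 1] never[of 1] t run_init(2) by simp
      ultimately have "trace_sq d (s t) = 0 \<or>
          (trace_sq d (s t) \<le> 0 + 2 * d * (M t)\<^sup>2 + (M t)\<^sup>2 * (D t - L) \<and> L \<le> D t)"
        using never step t
        by (intro potential_growth[where T = 1 and Q = "\<lambda>t. trace_sq d (s t)"]) auto
      then show ?thesis using that[of 0] lnxi by (simp add: C_def)
    qed
  qed
  from tr_t show ?case
  proof
    assume "trace_sq d (s t) = Q0"
    also note Q0(2)
    also have "C * d * (M t)\<^sup>2 / 4 \<le> C * d * (M t)\<^sup>2" using lnxi by (simp add: C_def)
    finally show ?thesis by (simp add: C_def)
  next
    assume *: "trace_sq d (s t) \<le> Q0 + 2 * d * (M t)\<^sup>2 + (M t)\<^sup>2 * (D t - L) \<and> L \<le> D t"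
    have pos: "\<forall>i<d. 0 < s t $ i" using run_factors[OF less.prems] by (auto simp: svd_factors_def)
    \<comment> \<open>The quotient \<open>y\<close> of the trace and \<open>N\<close> is the mean
      squared singular value in units of \<open>(M t)^2\<close>; in these units the scale cancels
      between \<open>D t\<close> and \<open>L\<close>.\<close>
    define N where "N = d * (M t)\<^sup>2"
    have N: "0 < N" using d Mt by (simp add: N_def)
    define y where "y = trace_sq d (s t) / N"
    have tr: "trace_sq d (s t) = y * N" using N by (simp add: y_def)
    have y: "0 < y" using logvol_le_trace(1)[OF pos run_input(1)] N by (simp add: y_def)
    have "D t \<le> d * ln (y * (M t)\<^sup>2)"
      using logvol_le_trace(2)[OF pos run_input(1)] d by (simp add: tr N_def)
    also have "ln (y * (M t)\<^sup>2) = ln y + 2 * ln (M t)" using y Mt by (simp add: ln_mult ln_realpow)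
    finally have "D t - L \<le> d * (ln y + 2 * ln 2 + 2 * ln \<xi>)"
      using Mt run_xi_pos by (simp add: L_def ln_div ln_mult algebra_simps)
    then have "(M t)\<^sup>2 * (D t - L) \<le> (M t)\<^sup>2 * (d * (ln y + 2 * ln 2 + 2 * ln \<xi>))"
      by (intro mult_left_mono) auto
    then have "y * N \<le> (C / 4 + 2 + (ln y + 2 * ln 2 + 2 * ln \<xi>)) * N"
      using * Q0(2) by (simp add: tr N_def algebra_simps)
    then have "y \<le> C / 4 + 2 + (ln y + 2 * ln 2 + 2 * ln \<xi>)" using N by simp
    \<comment> \<open>The tangent to \<open>ln\<close> at 4. Its slope leaves
      \<open>3 y / 4 \<le> 3 + 4 ln 2 + 3 ln \<xi>\<close>, and \<open>ln 2 \<le> 3/4\<close> turns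
      this into \<open>y \<le> 8 + 4 ln \<xi>\<close>, which is the origin of the constants 8 and
      4.\<close>
    moreover have "ln y \<le> y / 4 - 1 + 2 * ln 2"
    proof -
      have "ln (y / 4) \<le> y / 4 - 1" using y by (intro ln_le_minus_one) simp
      moreover have "ln (y / 4) = ln y - 2 * ln 2" using y ln_realpow[of 2 2] by (simp add: ln_div)
      ultimately show ?thesis by simp
    qed
    moreover have "C / 4 = 2 + ln \<xi>" by (simp add: C_def)
    ultimately have "y \<le> 8 + 4 * ln \<xi>" using ln_2_le by linarith
    then have "y * N \<le> (8 + 4 * ln \<xi>) * N" using N by (intro mult_right_mono) auto
    then show ?thesis by (simp add: tr N_def mult.assoc)
  qed
qed

text \<open>\<open>trace_sq_bound\<close> enters twice: at the splitting time \<open>T\<close>,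
  where \<open>M T < M n / \<xi>\<close> turns the trace into a multiple of \<open>h^2\<close>, and
  at time \<open>n\<close>, where it bounds the final volume. The flat amount is
  \<open>2 h^2\<close>, because the rank-one step and the clamping each add at most
  \<open>h^2\<close>.\<close>

lemma dual_form_bound:
  assumes z: "z \<in> carrier_vec d"
  shows "dual_form d (s n) (V n) z \<le> (6 + 28 * d * ln \<xi> + 16 * d) * (width n x z)\<^sup>2"
proof -
  define h where "h = width n x z"
  define C where "C = 8 + 4 * ln \<xi>"
  have lnxi: "0 \<le> ln \<xi>" using run_xi_ge_1 by simp
  have n: "n \<in> {1..n}" using run_input(2) by simp
  have Mn: "0 < M n" using max_norm_prefix_pos n by simp
  have d: "0 < real d" using run_input(1) by simp
  have h0: "0 \<le> h" using width_nonneg[OF valid] by (simp add: h_def)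
  have Mh: "M t / \<xi> * enorm z \<le> h" if "1 \<le> t" "t \<le> n" for t
  proof -
    have "M t * enorm z \<le> M n * enorm z"
      using max_norm_mono[of t n x] that enorm_nonneg[of z] by (intro mult_right_mono) auto
    also have "\<dots> \<le> \<xi> * h" using max_norm_le_width[OF valid z] by (simp add: h_def)
    finally show ?thesis using run_xi_pos by (simp add: field_simps)
  qed
  have Mh2: "(M t / \<xi> * enorm z)\<^sup>2 \<le> h\<^sup>2" if "1 \<le> t" "t \<le> n" for t
    using Mh[OF that] max_norm_prefix_pos[of t] that run_xi_pos enorm_nonneg[of z] by (intro power_mono) auto
  have xh: "(x t \<bullet> z)\<^sup>2 \<le> h\<^sup>2" if "t \<in> {1..n}" for t
    using width_ge[OF that, of z x] h0 comm_scalar_prod[OF z run_input(3)[OF that]]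
    by (simp add: abs_le_square_iff[symmetric] h_def)
  \<comment> \<open>Past the threshold, clamped values are at least
    \<open>(M n / \<xi>) / \<xi>\<close>. This square produces the term \<open>4 d ln \<xi>\<close>
    in the bound on \<open>D n - L\<close>.\<close>
  define L where "L = 2 * d * ln (M n / \<xi>\<^sup>2)"
  have Lt: "L \<le> D \<tau>" if "M n / \<xi> \<le> M \<tau>" "\<forall>i<d. M \<tau> / \<xi> \<le> s \<tau> $ i" for \<tau>
    unfolding L_def
  proof (rule logvol_ge)
    have "M n / \<xi>\<^sup>2 \<le> M \<tau> / \<xi>" using that(1) run_xi_pos by (simp add: field_simps power2_eq_square)
    then show "\<forall>i<d. M n / \<xi>\<^sup>2 \<le> s \<tau> $ i" using that(2) by force
  qed (use Mn run_xi_pos in simp)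
  let ?q = "\<lambda>t. dual_form d (s t) (V t) z"
  have step: "(?q \<tau> = ?q (\<tau> - 1) \<and> D \<tau> = D (\<tau> - 1)) \<or>
      (?q \<tau> \<le> ?q (\<tau> - 1) + 2 * h\<^sup>2 \<and> ?q \<tau> \<le> ?q (\<tau> - 1) + h\<^sup>2 * (D \<tau> - D (\<tau> - 1)) \<and>
       D (\<tau> - 1) \<le> D \<tau> \<and> L \<le> D \<tau>)"
    if \<tau>: "2 \<le> \<tau>" "\<tau> \<le> n" "M n / \<xi> \<le> M \<tau>" for \<tau>
  proof -
    have "\<tau> \<in> {2..n}" using \<tau> by auto
    then show ?thesis
    proof (cases rule: step_cases)
      case (update g c)
      note gc = update(1-5)
      have "g * (x \<tau> \<bullet> z)\<^sup>2 \<le> g * h\<^sup>2" "c * (M \<tau> / \<xi> * enorm z)\<^sup>2 \<le> c * h\<^sup>2"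
        using xh[of \<tau>] Mh2[of \<tau>] \<tau> gc by (auto intro!: mult_left_mono)
      then have q': "?q \<tau> \<le> ?q (\<tau> - 1) + (g + c) * h\<^sup>2" using update(7)[OF z] by (simp add: algebra_simps)
      have "(g + c) * h\<^sup>2 \<le> 2 * h\<^sup>2" "(g + c) * h\<^sup>2 \<le> (D \<tau> - D (\<tau> - 1)) * h\<^sup>2"
        using gc by (auto intro!: mult_right_mono)
      then show ?thesis using q' gc Lt[OF \<tau>(3) update(6)] by (auto simp: mult.commute)
    qed simp
  qed
  obtain Q0 where Q0: "Q0 \<le> C * d * h\<^sup>2" and Qn:
    "?q n = Q0 \<or> (?q n \<le> Q0 + 2 * h\<^sup>2 + h\<^sup>2 * (D n - L) \<and> L \<le> D n)"
  proof -
    have "0 < M n / \<xi>" "M n / \<xi> \<le> M n" using Mn run_xi_pos run_xi_ge_1 by (auto simp: field_simps)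
    with n show ?thesis
    proof (cases rule: threshold_split)
      case (early T)
      have T: "T \<in> {1..n}" using early by auto
      have "?q T \<le> trace_sq d (s T) * (enorm z)\<^sup>2"
        using run_factors[OF T] z by (intro dual_form_le_trace) (auto simp: svd_factors_def)
      also have "\<dots> \<le> C * d * (M T)\<^sup>2 * (enorm z)\<^sup>2"
        using trace_sq_bound[OF T] by (intro mult_right_mono) (auto simp: C_def)
      also have "\<dots> \<le> C * d * (M n / \<xi>)\<^sup>2 * (enorm z)\<^sup>2"
        using early lnxi max_norm_prefix_pos[of T]
        by (intro mult_right_mono mult_left_mono power_mono) (auto simp: C_def)
      also have "\<dots> = C * d * (M n / \<xi> * enorm z)\<^sup>2" by (simp only: power_mult_distrib mult.assoc)
      also have "\<dots> \<le> C * d * h\<^sup>2"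
        using Mh2[of n] n lnxi by (intro mult_left_mono) (auto simp: C_def)
      finally have Q: "?q T \<le> C * d * h\<^sup>2" .
      have "?q n = ?q T \<or> (?q n \<le> ?q T + 2 * h\<^sup>2 + h\<^sup>2 * (D n - L) \<and> L \<le> D n)"
        using early step by (intro potential_growth[where T = T and Q = ?q]) auto
      then show ?thesis using that[OF Q] by blast
    next
      case never
      \<comment> \<open>The start is charged to the flat amount: both terms of the initial dual form
        are at most \<open>h^2\<close>.\<close>
      have "?q 1 \<le> 0 + 2 * h\<^sup>2"
        using run_init(5)[OF z] xh[of 1] Mh2[of 1] n by simp
      moreover have "L \<le> D 1" using Lt[of 1] never[of 1] n run_init(2) by simp
      ultimately have "?q n = 0 \<or> (?q n \<le> 0 + 2 * h\<^sup>2 + h\<^sup>2 * (D n - L) \<and> L \<le> D n)"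
        using never step n by (intro potential_growth[where T = 1 and Q = ?q]) auto
      then show ?thesis using that[of 0] lnxi by (simp add: C_def)
    qed
  qed
  from Qn have "?q n \<le> (C * d + 2 + d * (ln C + 4 * ln \<xi>)) * h\<^sup>2"
  proof
    assume "?q n = Q0"
    moreover have "0 \<le> (2 + d * (ln C + 4 * ln \<xi>)) * h\<^sup>2"
      using lnxi by (simp add: C_def)
    ultimately show ?thesis using Q0 by (simp add: algebra_simps)
  next
    assume *: "?q n \<le> Q0 + 2 * h\<^sup>2 + h\<^sup>2 * (D n - L) \<and> L \<le> D n"
    have pos: "\<forall>i<d. 0 < s n $ i" using run_factors[OF n] by (auto simp: svd_factors_def)
    have C: "0 < C" using lnxi by (simp add: C_def)
    \<comment> \<open>Here the trace bounds the volume from above; the resulting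
      \<open>2 d ln (M n)\<close> cancels against the same term in \<open>L\<close>.\<close>
    have "trace_sq d (s n) / d \<le> C * (M n)\<^sup>2"
      using trace_sq_bound[OF n] d by (simp add: C_def field_simps)
    then have "ln (trace_sq d (s n) / d) \<le> ln (C * (M n)\<^sup>2)"
      using logvol_le_trace(1)[OF pos run_input(1)] d by (intro ln_mono) auto
    also have "\<dots> = ln C + 2 * ln (M n)" using C Mn by (simp add: ln_mult ln_realpow)
    finally have "D n \<le> d * (ln C + 2 * ln (M n))"
      using logvol_le_trace(2)[OF pos run_input(1)] d by (meson mult_left_mono of_nat_0_le_iff order_trans)
    then have "D n - L \<le> d * (ln C + 4 * ln \<xi>)"
      using Mn run_xi_pos by (simp add: L_def ln_div ln_realpow algebra_simps)
    then have "h\<^sup>2 * (D n - L) \<le> h\<^sup>2 * (d * (ln C + 4 * ln \<xi>))" by (intro mult_left_mono) auto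
    then show ?thesis using * Q0 by (simp add: algebra_simps)
  qed
  \<comment> \<open>With \<open>ln C \<le> 3 + ln \<xi>\<close> the factor on the left is at most
    \<open>2 + 11 d + 9 d ln \<xi>\<close>, so the stated constants leave room.\<close>
  also have "\<dots> \<le> (6 + 28 * d * ln \<xi> + 16 * d) * h\<^sup>2"
  proof (intro mult_right_mono)
    have "ln (C / 8) \<le> C / 8 - 1" using lnxi by (intro ln_le_minus_one) (simp add: C_def)
    moreover have "ln (C / 8) = ln C - 3 * ln 2"
      using lnxi ln_realpow[of 2 3] by (simp add: ln_div C_def)
    moreover have "C / 8 = 1 + ln \<xi> / 2" by (simp add: C_def)
    ultimately have "ln C \<le> 3 + ln \<xi>" using ln_2_le lnxi by linarith
    then have "C + (ln C + 4 * ln \<xi>) \<le> 28 * ln \<xi> + 16" using lnxi by (simp add: C_def)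
    then have "d * (C + (ln C + 4 * ln \<xi>)) \<le> d * (28 * ln \<xi> + 16)" by (intro mult_left_mono) auto
    then show "C * d + 2 + d * (ln C + 4 * ln \<xi>) \<le> 6 + 28 * d * ln \<xi> + 16 * d"
      by (simp add: algebra_simps)
  qed simp
  finally show ?thesis by (simp add: h_def)
qed

lemma run_ellipsoid:
  "shrink (sqrt (6 + 28 * real d * ln \<xi> + 16 * real d)) (mat_ellipsoid d (A n)) \<subseteq> sym_hull d n x"
  "sym_hull d n x \<subseteq> mat_ellipsoid d (A n)"
proof -
  have n: "n \<in> {1..n}" using run_input(2) by simp
  note F = run_factors[OF n]
  let ?\<alpha> = "6 + 28 * real d * ln \<xi> + 16 * real d"
  have \<alpha>: "0 < ?\<alpha>" using run_xi_ge_1 by (intro add_pos_nonneg) auto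
  show "shrink (sqrt ?\<alpha>) (mat_ellipsoid d (A n)) \<subseteq> sym_hull d n x"
    by (rule shrunk_ellipsoid_subset[OF valid F])
       (use \<alpha> dual_form_bound in \<open>auto simp: power_mult_distrib\<close>)
  show "sym_hull d n x \<subseteq> mat_ellipsoid d (A n)"
    using run_covers by (intro sym_hull_subset_ellipsoid[OF valid inv_factored_carrier[OF F]]) auto
qed

end

section \<open>Effect of programs on the memory\<close>

lemma machine_simps [simp]:
  "nat_vars (tick k m) = nat_vars m" "memory (tick k m) = memory m"
  "inputs_read (tick k m) = inputs_read m" "time (tick k m) = time m + k"
  "touched (tick k m) = touched m"
  "nat_vars (touch C m) = nat_vars m" "memory (touch C m) = memory m"
  "inputs_read (touch C m) = inputs_read m" "time (touch C m) = time m"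
  "touched (touch C m) = touched m \<union> C"
  by (simp_all add: tick_def touch_def)

text \<open>The loop bound is evaluated once, on entry, so an assignment in the body cannot change
  the number of iterations. \<open>I k\<close> describes the state before iteration
  \<open>k\<close>.\<close>

lemma For_invariant:
  assumes "I 0 (tick (1 + ncost e) m)"
    and "\<And>k m'. k < nval e (nat_vars m) \<Longrightarrow> I k m' \<Longrightarrow>
      I (Suc k) (exec svd d x c (tick 1 (m'\<lparr>nat_vars := (nat_vars m')(v := k)\<rparr>)))"
  shows "I (nval e (nat_vars m)) (exec svd d x (For v e c) m)"
proof -
  define K where "K = nval e (nat_vars m)"
  have "I k (fold (\<lambda>k m. exec svd d x c (tick 1 (m\<lparr>nat_vars := (nat_vars m)(v := k)\<rparr>)))
      [0..<k] (tick (1 + ncost e) m))" if "k \<le> K" for k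
    using that
  proof (induction k)
    case (Suc k)
    then show ?case using assms(2)[of k] by (simp add: K_def del: fun_upd_apply)
  qed (use assms(1) in simp)
  then show ?thesis by (simp add: K_def)
qed

text \<open>A program as a function on memories. \<open>E\<close> lists variables with known values,
  such as the indices of enclosing loops, and \<open>L\<close> the variables that may be
  overwritten. If the two are disjoint, the facts in \<open>E\<close> survive a sequence of
  programs.\<close>

definition effect ::
  "svd_proc \<Rightarrow> nat \<Rightarrow> (nat \<Rightarrow> real vec) \<Rightarrow> (name \<times> nat) list \<Rightarrow> name set \<Rightarrow> com \<Rightarrow>
   ((name \<times> nat \<Rightarrow> real) \<Rightarrow> (name \<times> nat \<Rightarrow> real)) \<Rightarrow> bool" where
  "effect svd d x E L c f \<longleftrightarrow>
     (\<forall>m. (\<forall>(v, k)\<in>set E. nat_vars m v = k) \<longrightarrow>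
        memory (exec svd d x c m) = f (memory m) \<and>
        inputs_read (exec svd d x c m) = inputs_read m \<and>
        (\<forall>v. v \<notin> L \<longrightarrow> nat_vars (exec svd d x c m) v = nat_vars m v))"

lemma effectD:
  assumes "effect svd d x E L c f" "\<forall>(v, k)\<in>set E. nat_vars m v = k"
  shows "memory (exec svd d x c m) = f (memory m)"
    "inputs_read (exec svd d x c m) = inputs_read m"
    "v \<notin> L \<Longrightarrow> nat_vars (exec svd d x c m) v = nat_vars m v"
  using assms by (auto simp: effect_def)

lemma effect_cong:
  "effect svd d x E L c f \<Longrightarrow> (\<And>\<mu>. f \<mu> = g \<mu>) \<Longrightarrow> effect svd d x E L c g"
  by (simp add: effect_def)

lemma effect_Store:
  assumes "\<And>\<nu>. \<forall>(v, k)\<in>set E. \<nu> v = k \<Longrightarrow> nval e \<nu> = p"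
    and "\<And>\<nu> \<mu>. \<forall>(v, k)\<in>set E. \<nu> v = k \<Longrightarrow> rval r \<nu> \<mu> = g \<mu>"
  shows "effect svd d x E L (Store a e r) (\<lambda>\<mu>. \<mu>((a, p) := g \<mu>))"
  unfolding effect_def using assms by (auto simp: Let_def)

lemma effect_Seq:
  assumes "effect svd d x E L c f" "effect svd d x E L c' g" "L \<inter> fst ` set E = {}"
  shows "effect svd d x E L (c ;; c') (\<lambda>\<mu>. g (f \<mu>))"
  unfolding effect_def
proof (intro allI impI)
  fix m :: machine assume m: "\<forall>(v, k)\<in>set E. nat_vars m v = k"
  let ?m = "exec svd d x c m"
  note 1 = effectD[OF assms(1) m]
  have "nat_vars ?m v = k" if "(v, k) \<in> set E" for v k
  proof -
    have "v \<in> fst ` set E" using that by force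
    then have "v \<notin> L" using assms(3) by blast
    then show ?thesis using 1(3) m that by auto
  qed
  then have "\<forall>(v, k)\<in>set E. nat_vars ?m v = k" by blast
  note 2 = effectD[OF assms(2) this]
  show "memory (exec svd d x (c ;; c') m) = g (f (memory m)) \<and>
      inputs_read (exec svd d x (c ;; c') m) = inputs_read m \<and>
      (\<forall>v. v \<notin> L \<longrightarrow> nat_vars (exec svd d x (c ;; c') m) v = nat_vars m v)"
    using 1 2 by simp
qed

lemma effect_IfLess:
  assumes "effect svd d x E L c f"
    and "\<And>\<nu> \<mu>. \<forall>(v, k)\<in>set E. \<nu> v = k \<Longrightarrow> rval r1 \<nu> \<mu> = g1 \<mu>"
    and "\<And>\<nu> \<mu>. \<forall>(v, k)\<in>set E. \<nu> v = k \<Longrightarrow> rval r2 \<nu> \<mu> = g2 \<mu>"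
  shows "effect svd d x E L (IfLess r1 r2 c) (\<lambda>\<mu>. if g1 \<mu> < g2 \<mu> then f \<mu> else \<mu>)"
  unfolding effect_def
proof (intro allI impI)
  fix m :: machine assume m: "\<forall>(v, k)\<in>set E. nat_vars m v = k"
  let ?m = "tick (1 + rcost r1 + rcost r2)
    (touch (rcells r1 (nat_vars m) \<union> rcells r2 (nat_vars m)) m)"
  have "\<forall>(v, k)\<in>set E. nat_vars ?m v = k" using m by simp
  note 1 = effectD[OF assms(1) this]
  show "memory (exec svd d x (IfLess r1 r2 c) m) = (if g1 (memory m) < g2 (memory m) then f (memory m) else memory m) \<and>
      inputs_read (exec svd d x (IfLess r1 r2 c) m) = inputs_read m \<and>
      (\<forall>v. v \<notin> L \<longrightarrow> nat_vars (exec svd d x (IfLess r1 r2 c) m) v = nat_vars m v)"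
    using 1 assms(2,3)[OF m] by (simp add: Let_def)
qed

text \<open>Within the body the value of \<open>v\<close> is known, so it joins the environment
  there; outside, \<open>v\<close> counts as overwritten, hence it belongs to
  \<open>L\<close>.\<close>

lemma effect_For:
  assumes body: "\<And>k. k < d \<Longrightarrow> effect svd d x ((v, k) # E) L c (f k)"
    and d: "(''d'', d) \<in> set E" and L: "L \<inter> fst ` set E = {}" "v \<in> L"
  shows "effect svd d x E L (For v dim_n c) (fold f [0..<d])"
  unfolding effect_def
proof (intro allI impI)
  fix m :: machine assume m: "\<forall>(v, k)\<in>set E. nat_vars m v = k"
  let ?I = "\<lambda>k m'. memory m' = fold f [0..<k] (memory m) \<and> inputs_read m' = inputs_read m \<and>
    (\<forall>u. u \<notin> L \<longrightarrow> nat_vars m' u = nat_vars m u)"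
  have nd: "nval dim_n (nat_vars m) = d" using m d by auto
  have "?I (nval dim_n (nat_vars m)) (exec svd d x (For v dim_n c) m)"
  proof (rule For_invariant)
    fix k and m' :: machine assume k: "k < nval dim_n (nat_vars m)" and I: "?I k m'"
    let ?m = "tick 1 (m'\<lparr>nat_vars := (nat_vars m')(v := k)\<rparr>)"
    have "nat_vars ?m u = l" if "(u, l) \<in> set E" for u l
    proof -
      have "u \<in> fst ` set E" using that by force
      then have "u \<notin> L" using L by blast
      then have "u \<noteq> v" "nat_vars m' u = nat_vars m u" using L(2) I by auto
      then show ?thesis using m that by auto
    qed
    then have "\<forall>(u, l)\<in>set ((v, k) # E). nat_vars ?m u = l" by auto
    note * = effectD[OF body this]
    show "?I (Suc k) (exec svd d x c ?m)"
      using * I k nd L(2) by auto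
  qed simp
  then show "memory (exec svd d x (For v dim_n c) m) = fold f [0..<d] (memory m) \<and>
      inputs_read (exec svd d x (For v dim_n c) m) = inputs_read m \<and>
      (\<forall>u. u \<notin> L \<longrightarrow> nat_vars (exec svd d x (For v dim_n c) m) u = nat_vars m u)"
    using nd by simp
qed

text \<open>The memory after \<open>n\<close> iterations of a loop that fills the array
  \<open>a\<close> from the front.\<close>

definition set_array ::
  "name \<Rightarrow> nat \<Rightarrow> (nat \<Rightarrow> real) \<Rightarrow> (name \<times> nat \<Rightarrow> real) \<Rightarrow> name \<times> nat \<Rightarrow> real" where
  "set_array a n f \<mu> = (\<lambda>(b, i). if b = a \<and> i < n then f i else \<mu> (b, i))"

lemma set_array_apply [simp]:
  "set_array a n f \<mu> (b, i) = (if b = a \<and> i < n then f i else \<mu> (b, i))"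
  by (simp add: set_array_def)

lemma set_array_0 [simp]: "set_array a 0 f \<mu> = \<mu>"
  by (auto simp: set_array_def)

lemma set_array_Suc: "(set_array a n f \<mu>)((a, n) := f n) = set_array a (Suc n) f \<mu>"
  by (auto simp: set_array_def fun_eq_iff)

lemma fold_set_array:
  assumes "\<And>k. k < n \<Longrightarrow> g k (set_array a k f \<mu>) = f k"
  shows "fold (\<lambda>k \<mu>. \<mu>((a, k) := g k \<mu>)) [0..<n] \<mu> = set_array a n f \<mu>"
  using assms by (induction n) (simp_all add: set_array_Suc)

text \<open>The nested loops visit the addresses in increasing order: when entry
  \<open>(i, j)\<close> is computed, exactly the prefix of length \<open>i * d + j\<close> has been
  written.\<close>

lemma fold_set_array2:
  assumes g: "\<And>i j. i < d \<Longrightarrow> j < d \<Longrightarrow> g i j (set_array a (i * d + j) f \<mu>) = f (i * d + j)"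
  shows "fold (\<lambda>i. fold (\<lambda>j \<mu>. \<mu>((a, i * d + j) := g i j \<mu>)) [0..<d]) [0..<d] \<mu> = set_array a (d * d) f \<mu>"
proof -
  have row: "fold (\<lambda>j \<mu>. \<mu>((a, i * d + j) := g i j \<mu>)) [0..<k] (set_array a (i * d) f \<mu>)
      = set_array a (i * d + k) f \<mu>" if "i < d" "k \<le> d" for i k
    using that(2)
  proof (induction k)
    case (Suc k)
    then show ?case
      using g[OF that(1), of k] set_array_Suc[of a "i * d + k" f \<mu>] by (simp del: fun_upd_apply)
  qed simp
  define G where "G i = fold (\<lambda>j \<mu>. \<mu>((a, i * d + j) := g i j \<mu>)) [0..<d]" for i
  have "fold G [0..<k] \<mu> = set_array a (k * d) f \<mu>" if "k \<le> d" for k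
    using that
  proof (induction k)
    case (Suc k)
    then have "fold G [0..<Suc k] \<mu> = set_array a (k * d + d) f \<mu>"
      using row[of k d] by (simp add: G_def[of k] del: fun_upd_apply)
    then show ?case by (simp only: mult_Suc add.commute)
  qed simp
  then show ?thesis by (simp only: G_def[abs_def])
qed

lemma fold_accumulate:
  assumes "\<And>k r. k < n \<Longrightarrow> g k (\<mu>(c := r)) = g k \<mu>"
  shows "fold (\<lambda>k \<mu>. \<mu>(c := \<mu> c + g k \<mu>)) [0..<n] (\<mu>(c := 0)) = \<mu>(c := \<Sum>k<n. g k \<mu>)"
  using assms by (induction n) simp_all

lemma put_vec_set_array: "put_vec d a v \<mu> = set_array a d (\<lambda>i. v $ i) \<mu>"
  by (simp add: put_vec_def set_array_def)

lemma put_mat_set_array: "put_mat d a A \<mu> = set_array a (d * d) (\<lambda>i. A $$ (i div d, i mod d)) \<mu>"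
  by (simp add: put_mat_def set_array_def)

lemma index_bound: "i < d \<Longrightarrow> j < d \<Longrightarrow> i * d + j < d * (d :: nat)"
proof -
  assume "i < d" "j < d"
  then have "i * d + j < Suc i * d" by simp
  also have "\<dots> \<le> d * d" using \<open>i < d\<close> by (intro mult_right_mono) auto
  finally show ?thesis .
qed

lemma mem_vec_set_array [simp]:
  "mem_vec d (set_array a d f \<mu>) a = vec d f"
  "a \<noteq> b \<Longrightarrow> mem_vec d (set_array a n f \<mu>) b = mem_vec d \<mu> b"
  by (auto simp: mem_vec_def)

lemma mem_mat_set_array [simp]:
  "mem_mat d (set_array a (d * d) f \<mu>) a = mat d d (\<lambda>(i, j). f (i * d + j))"
  "a \<noteq> b \<Longrightarrow> mem_mat d (set_array a n f \<mu>) b = mem_mat d \<mu> b"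
  using index_bound[of _ d] by (auto simp: mem_mat_def)

lemma mem_vec_upd [simp]: "a \<noteq> b \<Longrightarrow> mem_vec d (\<mu>((a, i) := r)) b = mem_vec d \<mu> b"
  by (auto simp: mem_vec_def)

lemma mem_mat_upd [simp]: "a \<noteq> b \<Longrightarrow> mem_mat d (\<mu>((a, i) := r)) b = mem_mat d \<mu> b"
  by (auto simp: mem_mat_def)

lemma mem_vec_carrier [simp]: "mem_vec d \<mu> a \<in> carrier_vec d"
  by (simp add: mem_vec_def)

lemma mem_mat_carrier [simp]: "mem_mat d \<mu> a \<in> carrier_mat d d"
  by (simp add: mem_mat_def)

lemma effect_dot_code:
  assumes "c \<noteq> a" "c \<noteq> b"
  shows "effect svd d x [(''d'', d)] {''i'', ''j'', ''k''} (dot_code c a b)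
    (\<lambda>\<mu>. \<mu>((c, 0) := mem_vec d \<mu> a \<bullet> mem_vec d \<mu> b))"
  unfolding dot_code_def
proof (rule effect_cong)
  show "effect svd d x [(''d'', d)] {''i'', ''j'', ''k''}
    (set_scalar c (RConst 0) ;;
     For ''i'' dim_n (set_scalar c (RAdd (scalar c) (RMul (cell1 a ''i'') (cell1 b ''i'')))))
    (\<lambda>\<mu>. fold (\<lambda>k \<mu>. \<mu>((c, 0) := \<mu> (c, 0) + \<mu> (a, k) * \<mu> (b, k))) [0..<d] (\<mu>((c, 0) := 0)))"
    by (intro effect_Seq effect_For effect_Store) auto
  show "fold (\<lambda>k \<mu>. \<mu>((c, 0) := \<mu> (c, 0) + \<mu> (a, k) * \<mu> (b, k))) [0..<d] (\<mu>((c, 0) := 0))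
      = \<mu>((c, 0) := mem_vec d \<mu> a \<bullet> mem_vec d \<mu> b)" for \<mu>
    by (subst fold_accumulate[where g = "\<lambda>k \<mu>. \<mu> (a, k) * \<mu> (b, k)"])
       (use assms in \<open>simp_all add: mem_vec_def scalar_prod_def lessThan_atLeast0\<close>)
qed

text \<open>The second condition admits updates in place, such as dividing \<open>y\<close> by
  \<open>s\<close> entrywise: the value for entry \<open>k\<close> must be unaffected by the entries
  that earlier iterations have overwritten.\<close>

lemma effect_map_code:
  assumes "\<And>\<nu> \<mu> k. k < d \<Longrightarrow> \<nu> ''i'' = k \<Longrightarrow> \<nu> ''d'' = d \<Longrightarrow> rval r \<nu> \<mu> = g k \<mu>"
    and "\<And>k \<mu>. k < d \<Longrightarrow> g k (set_array a k (\<lambda>k. g k \<mu>) \<mu>) = g k \<mu>"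
  shows "effect svd d x [(''d'', d)] {''i'', ''j'', ''k''} (For ''i'' dim_n (set1 a ''i'' r))
    (\<lambda>\<mu>. set_array a d (\<lambda>k. g k \<mu>) \<mu>)"
proof (rule effect_cong)
  show "effect svd d x [(''d'', d)] {''i'', ''j'', ''k''} (For ''i'' dim_n (set1 a ''i'' r))
    (fold (\<lambda>k \<mu>. \<mu>((a, k) := g k \<mu>)) [0..<d])"
    by (intro effect_For effect_Store) (use assms(1) in auto)
  show "fold (\<lambda>k \<mu>. \<mu>((a, k) := g k \<mu>)) [0..<d] \<mu> = set_array a d (\<lambda>k. g k \<mu>) \<mu>" for \<mu>
    by (rule fold_set_array) (rule assms(2))
qed

lemma effect_mult_code:
  assumes "b \<noteq> a" "b \<noteq> B"
  shows "effect svd d x [(''d'', d)] {''i'', ''j'', ''k''} (mult_code b B a)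
    (\<lambda>\<mu>. set_array b d (\<lambda>i. (mem_mat d \<mu> B *\<^sub>v mem_vec d \<mu> a) $ i) \<mu>)"
  unfolding mult_code_def
proof (rule effect_cong)
  let ?g = "\<lambda>i \<mu>. \<Sum>j<d. \<mu> (B, i * d + j) * \<mu> (a, j)"
  let ?body = "set1 b ''i'' (RConst 0) ;;
        For ''j'' dim_n
          (set1 b ''i'' (RAdd (cell1 b ''i'') (RMul (cell2 B ''i'' ''j'') (cell1 a ''j''))))"
  show "effect svd d x [(''d'', d)] {''i'', ''j'', ''k''} (For ''i'' dim_n ?body)
    (fold (\<lambda>i \<mu>. \<mu>((b, i) := ?g i \<mu>)) [0..<d])"
  proof (rule effect_For)
    fix i assume "i < d"
    \<comment> \<open>Shown first with the smaller set \<open>{''j''}\<close>, because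
      \<open>effect_Seq\<close> requires that the known index \<open>''i''\<close> not be
      overwritten; enlarging the set afterwards is harmless.\<close>
    have "effect svd d x [(''i'', i), (''d'', d)] {''j''} ?body
      (\<lambda>\<mu>. fold (\<lambda>j \<mu>. \<mu>((b, i) := \<mu> (b, i) + \<mu> (B, i * d + j) * \<mu> (a, j))) [0..<d] (\<mu>((b, i) := 0)))"
      by (intro effect_Seq effect_For effect_Store) auto
    then have "effect svd d x [(''i'', i), (''d'', d)] {''j''} ?body (\<lambda>\<mu>. \<mu>((b, i) := ?g i \<mu>))"
      by (rule effect_cong) (subst fold_accumulate[where g = "\<lambda>j \<mu>. \<mu> (B, i * d + j) * \<mu> (a, j)"],
        use assms in auto)
    then show "effect svd d x [(''i'', i), (''d'', d)] {''i'', ''j'', ''k''} ?body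
      (\<lambda>\<mu>. \<mu>((b, i) := ?g i \<mu>))" by (auto simp: effect_def)
  qed auto
  show "fold (\<lambda>i \<mu>. \<mu>((b, i) := ?g i \<mu>)) [0..<d] \<mu>
      = set_array b d (\<lambda>i. (mem_mat d \<mu> B *\<^sub>v mem_vec d \<mu> a) $ i) \<mu>" for \<mu>
    by (rule fold_set_array)
       (use assms in \<open>auto simp: mem_mat_def mem_vec_def scalar_prod_def lessThan_atLeast0\<close>)
qed

lemma effect_mult_transpose_code:
  assumes "b \<noteq> a" "b \<noteq> B"
  shows "effect svd d x [(''d'', d)] {''i'', ''j'', ''k''} (mult_transpose_code b B a)
    (\<lambda>\<mu>. set_array b d (\<lambda>i. ((mem_mat d \<mu> B)\<^sup>T *\<^sub>v mem_vec d \<mu> a) $ i) \<mu>)"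
  unfolding mult_transpose_code_def
proof (rule effect_cong)
  let ?g = "\<lambda>i \<mu>. \<Sum>j<d. \<mu> (B, j * d + i) * \<mu> (a, j)"
  let ?body = "set1 b ''i'' (RConst 0) ;;
        For ''j'' dim_n
          (set1 b ''i'' (RAdd (cell1 b ''i'') (RMul (cell2 B ''j'' ''i'') (cell1 a ''j''))))"
  show "effect svd d x [(''d'', d)] {''i'', ''j'', ''k''} (For ''i'' dim_n ?body)
    (fold (\<lambda>i \<mu>. \<mu>((b, i) := ?g i \<mu>)) [0..<d])"
  proof (rule effect_For)
    fix i assume "i < d"
    have "effect svd d x [(''i'', i), (''d'', d)] {''j''} ?body
      (\<lambda>\<mu>. fold (\<lambda>j \<mu>. \<mu>((b, i) := \<mu> (b, i) + \<mu> (B, j * d + i) * \<mu> (a, j))) [0..<d] (\<mu>((b, i) := 0)))"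
      by (intro effect_Seq effect_For effect_Store) auto
    then have "effect svd d x [(''i'', i), (''d'', d)] {''j''} ?body (\<lambda>\<mu>. \<mu>((b, i) := ?g i \<mu>))"
      by (rule effect_cong) (subst fold_accumulate[where g = "\<lambda>j \<mu>. \<mu> (B, j * d + i) * \<mu> (a, j)"],
        use assms in auto)
    then show "effect svd d x [(''i'', i), (''d'', d)] {''i'', ''j'', ''k''} ?body
      (\<lambda>\<mu>. \<mu>((b, i) := ?g i \<mu>))" by (auto simp: effect_def)
  qed auto
  show "fold (\<lambda>i \<mu>. \<mu>((b, i) := ?g i \<mu>)) [0..<d] \<mu>
      = set_array b d (\<lambda>i. ((mem_mat d \<mu> B)\<^sup>T *\<^sub>v mem_vec d \<mu> a) $ i) \<mu>" for \<mu>
    by (rule fold_set_array)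
       (use assms in \<open>auto simp: mem_mat_def mem_vec_def scalar_prod_def lessThan_atLeast0\<close>)
qed

lemma effect_output_code:
  "effect svd d x [(''d'', d)] {''i'', ''j'', ''k''} output_code
    (\<lambda>\<mu>. set_array ''A'' (d * d) (\<lambda>q. \<Sum>k<d. \<mu> (''U'', q div d * d + k) / \<mu> (''s'', k) * \<mu> (''V'', q mod d * d + k)) \<mu>)"
  unfolding output_code_def
proof (rule effect_cong)
  let ?t = "\<lambda>i j k \<mu>. \<mu> (''U'', i * d + k) / \<mu> (''s'', k) * \<mu> (''V'', j * d + k)"
  let ?body = "set2 ''A'' ''i'' ''j'' (RConst 0) ;;
           For ''k'' dim_n
             (set2 ''A'' ''i'' ''j''
                (RAdd (cell2 ''A'' ''i'' ''j'')
                   (RMul (RDiv (cell2 ''U'' ''i'' ''k'') (cell1 ''s'' ''k''))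
                      (cell2 ''V'' ''j'' ''k''))))"
  show "effect svd d x [(''d'', d)] {''i'', ''j'', ''k''} (For ''i'' dim_n (For ''j'' dim_n ?body))
    (fold (\<lambda>i. fold (\<lambda>j \<mu>. \<mu>((''A'', i * d + j) := \<Sum>k<d. ?t i j k \<mu>)) [0..<d]) [0..<d])"
  proof (rule effect_For)
    fix i assume "i < d"
    have "effect svd d x [(''i'', i), (''d'', d)] {''j'', ''k''} (For ''j'' dim_n ?body)
      (fold (\<lambda>j \<mu>. \<mu>((''A'', i * d + j) := \<Sum>k<d. ?t i j k \<mu>)) [0..<d])"
    proof (rule effect_For)
      fix j assume "j < d"
      have "effect svd d x [(''j'', j), (''i'', i), (''d'', d)] {''k''} ?body
        (\<lambda>\<mu>. fold (\<lambda>k \<mu>. \<mu>((''A'', i * d + j) := \<mu> (''A'', i * d + j) + ?t i j k \<mu>)) [0..<d] (\<mu>((''A'', i * d + j) := 0)))"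
        by (intro effect_Seq effect_For effect_Store) auto
      then have "effect svd d x [(''j'', j), (''i'', i), (''d'', d)] {''k''} ?body
        (\<lambda>\<mu>. \<mu>((''A'', i * d + j) := \<Sum>k<d. ?t i j k \<mu>))"
        by (rule effect_cong) (subst fold_accumulate[where g = "?t i j"], auto)
      then show "effect svd d x [(''j'', j), (''i'', i), (''d'', d)] {''j'', ''k''} ?body
        (\<lambda>\<mu>. \<mu>((''A'', i * d + j) := \<Sum>k<d. ?t i j k \<mu>))" by (auto simp: effect_def)
    qed auto
    then show "effect svd d x [(''i'', i), (''d'', d)] {''i'', ''j'', ''k''} (For ''j'' dim_n ?body)
      (fold (\<lambda>j \<mu>. \<mu>((''A'', i * d + j) := \<Sum>k<d. ?t i j k \<mu>)) [0..<d])" by (auto simp: effect_def)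
  qed auto
  show "fold (\<lambda>i. fold (\<lambda>j \<mu>. \<mu>((''A'', i * d + j) := \<Sum>k<d. ?t i j k \<mu>)) [0..<d]) [0..<d] \<mu>
    = set_array ''A'' (d * d) (\<lambda>q. \<Sum>k<d. ?t (q div d) (q mod d) k \<mu>) \<mu>" for \<mu>
    by (rule fold_set_array2) simp
qed

section \<open>Time and storage of programs\<close>

lemma effect_mono: "effect svd d x E L c f \<Longrightarrow> L \<subseteq> L' \<Longrightarrow> effect svd d x E L' c f"
  by (auto simp: effect_def)

section \<open>Identity matrix and reflection in memory\<close>

definition ident_code :: com where
  "ident_code =
     For ''i'' dim_n
       (For ''j'' dim_n
          (set2 ''U'' ''i'' ''j'' (RConst 0) ;;
           set2 ''V'' ''i'' ''j'' (RConst 0)) ;;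
        set2 ''U'' ''i'' ''i'' (RConst 1) ;;
        set2 ''V'' ''i'' ''i'' (RConst 1))"

definition reflect_code :: com where
  "reflect_code =
       (For ''i'' dim_n
          (For ''j'' dim_n
             (set2 ''V'' ''i'' ''j''
                (RSub (cell2 ''V'' ''i'' ''j'')
                   (RDiv (RMul (RConst 2) (RMul (cell1 ''h'' ''i'') (cell1 ''h'' ''j'')))
                      (scalar ''c''))))))"

definition ident_array :: "nat \<Rightarrow> nat \<Rightarrow> real" where
  "ident_array d q = (if q div d = q mod d then 1 else 0)"

lemma effect_set2:
  assumes "\<And>\<nu>. \<forall>(v, k)\<in>set E. \<nu> v = k \<Longrightarrow> nval e \<nu> = p" "L \<inter> fst ` set E = {}"
  shows "effect svd d x E L (Store a e (RConst r) ;; Store b e (RConst r))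
    (\<lambda>\<mu>. (\<mu>((a, p) := r))((b, p) := r))"
  by (rule effect_Seq[where f = "\<lambda>\<mu>. \<mu>((a, p) := r)" and g = "\<lambda>\<mu>. \<mu>((b, p) := r)"];
      (rule effect_Store)?) (use assms in auto)

text \<open>\<open>fold_set_array2\<close> does not fit here: the loop writes two arrays at once and
  visits each diagonal cell twice. Instead, the first \<open>k\<close> rows of both arrays are
  tracked together.\<close>

lemma effect_ident_code:
  "effect svd d x [(''d'', d)] {''i'', ''j'', ''k''} ident_code
    (\<lambda>\<mu>. set_array ''U'' (d * d) (ident_array d) (set_array ''V'' (d * d) (ident_array d) \<mu>))"
  unfolding ident_code_def
proof (rule effect_cong)
  let ?z = "\<lambda>i. fold (\<lambda>j \<mu>. (\<mu>((''U'', i * d + j) := 0))((''V'', i * d + j) := (0 :: real)))"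
  let ?row = "\<lambda>i \<mu>. (?z i [0..<d] \<mu>)((''U'', i * d + i) := 1, (''V'', i * d + i) := 1)"
  let ?zero = "For ''j'' dim_n (set2 ''U'' ''i'' ''j'' (RConst 0) ;; set2 ''V'' ''i'' ''j'' (RConst 0))"
  let ?body = "?zero ;; set2 ''U'' ''i'' ''i'' (RConst 1) ;; set2 ''V'' ''i'' ''i'' (RConst 1)"
  show "effect svd d x [(''d'', d)] {''i'', ''j'', ''k''} (For ''i'' dim_n ?body) (fold ?row [0..<d])"
  proof (rule effect_For)
    fix i assume "i < d"
    have "effect svd d x [(''i'', i), (''d'', d)] {''j''} ?zero (?z i [0..<d])"
    proof (rule effect_For)
      fix j assume "j < d"
      show "effect svd d x [(''j'', j), (''i'', i), (''d'', d)] {''j''}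
        (set2 ''U'' ''i'' ''j'' (RConst 0) ;; set2 ''V'' ''i'' ''j'' (RConst 0))
        (\<lambda>\<mu>. (\<mu>((''U'', i * d + j) := 0))((''V'', i * d + j) := 0))"
        by (rule effect_mono, rule effect_set2[where p = "i * d + j" and L = "{}"]) auto
    qed auto
    moreover have "effect svd d x [(''i'', i), (''d'', d)] {''j''}
        (set2 ''U'' ''i'' ''i'' (RConst 1) ;; set2 ''V'' ''i'' ''i'' (RConst 1))
        (\<lambda>\<mu>. (\<mu>((''U'', i * d + i) := 1))((''V'', i * d + i) := 1))"
      by (rule effect_set2[where p = "i * d + i"]) auto
    ultimately have "effect svd d x [(''i'', i), (''d'', d)] {''j''} ?body (?row i)"
      by (rule effect_Seq) auto
    then show "effect svd d x [(''i'', i), (''d'', d)] {''i'', ''j'', ''k''} ?body (?row i)"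
      by (rule effect_mono) auto
  qed auto
  have zero: "?z i [0..<k] \<mu> = (\<lambda>(a, q). if (a = ''U'' \<or> a = ''V'') \<and> i * d \<le> q \<and> q < i * d + k then 0 else \<mu> (a, q))"
    for i k \<mu> by (induction k) (auto simp: fun_eq_iff)
  have row: "?row i (set_array ''U'' (i * d) (ident_array d) (set_array ''V'' (i * d) (ident_array d) \<mu>))
      = set_array ''U'' (Suc i * d) (ident_array d) (set_array ''V'' (Suc i * d) (ident_array d) \<mu>)"
    if "i < d" for i \<mu>
  proof (rule ext, clarify)
    fix a q
    have "q div d = i \<and> q mod d = q - i * d" if "i * d \<le> q" "q < i * d + d"
    proof -
      define r where "r = q - i * d"
      have "q = i * d + r" "r < d" using that by (auto simp: r_def)
      then show ?thesis by simp
    qed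
    then show "?row i (set_array ''U'' (i * d) (ident_array d) (set_array ''V'' (i * d) (ident_array d) \<mu>)) (a, q)
      = set_array ''U'' (Suc i * d) (ident_array d) (set_array ''V'' (Suc i * d) (ident_array d) \<mu>) (a, q)"
      unfolding zero using that by (auto simp: ident_array_def)
  qed
  have "fold ?row [0..<k] \<mu>
      = set_array ''U'' (k * d) (ident_array d) (set_array ''V'' (k * d) (ident_array d) \<mu>)" if "k \<le> d" for k \<mu>
    using that
  proof (induction k)
    case (Suc k)
    then show ?case using row[of k \<mu>] by (simp del: fun_upd_apply mult_Suc)
  qed simp
  then show "fold ?row [0..<d] \<mu>
      = set_array ''U'' (d * d) (ident_array d) (set_array ''V'' (d * d) (ident_array d) \<mu>)" for \<mu>
    by blast
qed

lemma effect_reflect_code: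
  "effect svd d x [(''d'', d)] {''i'', ''j'', ''k''} reflect_code
    (\<lambda>\<mu>. set_array ''V'' (d * d)
       (\<lambda>q. \<mu> (''V'', q) - 2 * (\<mu> (''h'', q div d) * \<mu> (''h'', q mod d)) / \<mu> (''c'', 0)) \<mu>)"
  unfolding reflect_code_def
proof (rule effect_cong)
  let ?g = "\<lambda>i j \<mu>. \<mu> (''V'', i * d + j) - 2 * (\<mu> (''h'', i) * \<mu> (''h'', j)) / \<mu> (''c'', 0)"
  let ?body = "set2 ''V'' ''i'' ''j''
                (RSub (cell2 ''V'' ''i'' ''j'')
                   (RDiv (RMul (RConst 2) (RMul (cell1 ''h'' ''i'') (cell1 ''h'' ''j'')))
                      (scalar ''c'')))"
  show "effect svd d x [(''d'', d)] {''i'', ''j'', ''k''} (For ''i'' dim_n (For ''j'' dim_n ?body))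
    (fold (\<lambda>i. fold (\<lambda>j \<mu>. \<mu>((''V'', i * d + j) := ?g i j \<mu>)) [0..<d]) [0..<d])"
  proof (rule effect_For)
    fix i assume "i < d"
    have "effect svd d x [(''i'', i), (''d'', d)] {''j''} (For ''j'' dim_n ?body)
      (fold (\<lambda>j \<mu>. \<mu>((''V'', i * d + j) := ?g i j \<mu>)) [0..<d])"
      by (intro effect_For effect_Store) auto
    then show "effect svd d x [(''i'', i), (''d'', d)] {''i'', ''j'', ''k''} (For ''j'' dim_n ?body)
      (fold (\<lambda>j \<mu>. \<mu>((''V'', i * d + j) := ?g i j \<mu>)) [0..<d])" by (rule effect_mono) auto
  qed auto
  show "fold (\<lambda>i. fold (\<lambda>j \<mu>. \<mu>((''V'', i * d + j) := ?g i j \<mu>)) [0..<d]) [0..<d] \<mu>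
    = set_array ''V'' (d * d) (\<lambda>q. \<mu> (''V'', q) - 2 * (\<mu> (''h'', q div d) * \<mu> (''h'', q mod d)) / \<mu> (''c'', 0)) \<mu>"
    for \<mu>
    by (rule fold_set_array2) simp
qed

section \<open>Running time of programs without SVD updates\<close>

primrec pure_code :: "com \<Rightarrow> bool" where
  "pure_code (Store a e r) \<longleftrightarrow> True"
| "pure_code (Seq c1 c2) \<longleftrightarrow> pure_code c1 \<and> pure_code c2"
| "pure_code (For v e c) \<longleftrightarrow> v \<noteq> ''d'' \<and> e = dim_n \<and> pure_code c"
| "pure_code (IfLess r1 r2 c) \<longleftrightarrow> pure_code c"
| "pure_code (Read a) \<longleftrightarrow> True"
| "pure_code (Svd U s V p q) \<longleftrightarrow> False"

primrec code_cost :: "nat \<Rightarrow> com \<Rightarrow> nat" where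
  "code_cost d (Store a e r) = 1 + ncost e + rcost r"
| "code_cost d (Seq c1 c2) = code_cost d c1 + code_cost d c2"
| "code_cost d (For v e c) = 1 + ncost e + d * (1 + code_cost d c)"
| "code_cost d (IfLess r1 r2 c) = 1 + rcost r1 + rcost r2 + code_cost d c"
| "code_cost d (Read a) = 1 + d"
| "code_cost d (Svd U s V p q) = 0"

text \<open>The condition on loops in \<open>pure_code\<close> keeps \<open>''d''\<close> constant,
  so every loop runs exactly \<open>d\<close> times. A conditional is charged as if its branch were
  taken.\<close>

lemma pure_code_time:
  assumes "pure_code c" "nat_vars m ''d'' = d"
  shows "time (exec svd d x c m) \<le> time m + code_cost d c \<and> nat_vars (exec svd d x c m) ''d'' = d"
  using assms
proof (induction c arbitrary: m)
  case (Seq c1 c2)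
  then have 1: "time (exec svd d x c1 m) \<le> time m + code_cost d c1" "nat_vars (exec svd d x c1 m) ''d'' = d"
    by auto
  then show ?case using Seq.IH(2)[of "exec svd d x c1 m"] Seq.prems by auto
next
  case (For v e c)
  let ?I = "\<lambda>k m'. time m' \<le> time m + (1 + ncost e) + k * (1 + code_cost d c) \<and> nat_vars m' ''d'' = d"
  have e: "nval e (nat_vars m) = d" using For.prems by simp
  have "?I (nval e (nat_vars m)) (exec svd d x (For v e c) m)"
  proof (rule For_invariant)
    fix k and m' :: machine assume I: "?I k m'"
    let ?m = "tick 1 (m'\<lparr>nat_vars := (nat_vars m')(v := k)\<rparr>)"
    have "nat_vars ?m ''d'' = d" using I For.prems by auto
    then show "?I (Suc k) (exec svd d x c ?m)"
      using For.IH[of ?m] For.prems I by (simp del: fun_upd_apply)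
  qed (use For.prems in simp)
  then show ?case unfolding e by simp
next
  case (IfLess r1 r2 c)
  let ?m = "tick (1 + rcost r1 + rcost r2) (touch (rcells r1 (nat_vars m) \<union> rcells r2 (nat_vars m)) m)"
  show ?case using IfLess.IH[of ?m] IfLess.prems by (simp add: Let_def)
qed (auto simp: Let_def)

section \<open>Addresses and storage\<close>

definition addr_ok :: "nexp \<Rightarrow> bool" where
  "addr_ok e \<longleftrightarrow> e = NConst 0 \<or> (\<exists>v\<in>{''i'', ''j'', ''k''}. e = NVar v) \<or>
     (\<exists>v\<in>{''i'', ''j'', ''k''}. \<exists>w\<in>{''i'', ''j'', ''k''}. e = idx2 v w)"

primrec rexp_ok :: "name set \<Rightarrow> rexp \<Rightarrow> bool" where
  "rexp_ok N (RConst c) \<longleftrightarrow> True"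
| "rexp_ok N (RCell a e) \<longleftrightarrow> a \<in> N \<and> addr_ok e"
| "rexp_ok N (RAdd a b) \<longleftrightarrow> rexp_ok N a \<and> rexp_ok N b"
| "rexp_ok N (RSub a b) \<longleftrightarrow> rexp_ok N a \<and> rexp_ok N b"
| "rexp_ok N (RMul a b) \<longleftrightarrow> rexp_ok N a \<and> rexp_ok N b"
| "rexp_ok N (RDiv a b) \<longleftrightarrow> rexp_ok N a \<and> rexp_ok N b"
| "rexp_ok N (RMax a b) \<longleftrightarrow> rexp_ok N a \<and> rexp_ok N b"
| "rexp_ok N (RSqrt a) \<longleftrightarrow> rexp_ok N a"

text \<open>The loop over \<open>''t''\<close> may have any bound, because \<open>addr_ok\<close>
  admits no address that contains \<open>''t''\<close>.\<close>

primrec code_ok :: "name set \<Rightarrow> com \<Rightarrow> bool" where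
  "code_ok N (Store a e r) \<longleftrightarrow> a \<in> N \<and> addr_ok e \<and> rexp_ok N r"
| "code_ok N (Seq c1 c2) \<longleftrightarrow> code_ok N c1 \<and> code_ok N c2"
| "code_ok N (For v e c) \<longleftrightarrow> (v \<in> {''i'', ''j'', ''k''} \<and> e = dim_n \<or> v = ''t'') \<and> code_ok N c"
| "code_ok N (IfLess r1 r2 c) \<longleftrightarrow> rexp_ok N r1 \<and> rexp_ok N r2 \<and> code_ok N c"
| "code_ok N (Read a) \<longleftrightarrow> a \<in> N"
| "code_ok N (Svd U s V p q) \<longleftrightarrow> {U, s, V, p, q} \<subseteq> N"

text \<open>This holds outside of loops too: for positive \<open>d\<close>, the variables start at 0
  and afterwards keep the last value of a loop, which is below \<open>d\<close>.\<close>

definition index_vars_ok :: "nat \<Rightarrow> (name \<Rightarrow> nat) \<Rightarrow> bool" where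
  "index_vars_ok d \<nu> \<longleftrightarrow> \<nu> ''d'' = d \<and> (\<forall>v\<in>{''i'', ''j'', ''k''}. \<nu> v < d)"

lemma addr_ok_bound:
  assumes "addr_ok e" "index_vars_ok d \<nu>"
  shows "nval e \<nu> < d * d"
proof -
  have d: "0 < d" and b: "\<And>v. v \<in> {''i'', ''j'', ''k''} \<Longrightarrow> \<nu> v < d" and dd: "\<nu> ''d'' = d"
    using assms(2) by (auto simp: index_vars_ok_def)
  from assms(1) consider "e = NConst 0" | v where "v \<in> {''i'', ''j'', ''k''}" "e = NVar v"
    | v w where "v \<in> {''i'', ''j'', ''k''}" "w \<in> {''i'', ''j'', ''k''}" "e = idx2 v w"
    unfolding addr_ok_def by blast
  then show ?thesis
  proof cases
    case 2
    then have "nval e \<nu> < d" using b by simp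
    then show ?thesis using index_bound[of 0 d "nval e \<nu>"] d by simp
  next
    case 3
    then show ?thesis using index_bound[OF b b] dd by simp
  qed (use d in simp)
qed

lemma rexp_ok_cells:
  "rexp_ok N r \<Longrightarrow> index_vars_ok d \<nu> \<Longrightarrow> rcells r \<nu> \<subseteq> N \<times> {..<d * d}"
  by (induction r) (auto intro: addr_ok_bound)

lemma code_ok_touched:
  assumes "code_ok N c" "index_vars_ok d (nat_vars m)" "touched m \<subseteq> N \<times> {..<d * d}"
  shows "index_vars_ok d (nat_vars (exec svd d x c m)) \<and> touched (exec svd d x c m) \<subseteq> N \<times> {..<d * d}"
  using assms
proof (induction c arbitrary: m)
  case (Store a e r)
  then show ?case
    using addr_ok_bound[of e d] rexp_ok_cells[of N r d] by (auto simp: Let_def)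
next
  case (For v e c)
  let ?I = "\<lambda>k m'. index_vars_ok d (nat_vars m') \<and> touched m' \<subseteq> N \<times> {..<d * d}"
  have "?I (nval e (nat_vars m)) (exec svd d x (For v e c) m)"
  proof (rule For_invariant)
    fix k and m' :: machine assume k: "k < nval e (nat_vars m)" and I: "?I k m'"
    let ?m = "tick 1 (m'\<lparr>nat_vars := (nat_vars m')(v := k)\<rparr>)"
    have "v \<in> {''i'', ''j'', ''k''} \<longrightarrow> k < d" "v \<noteq> ''d''"
      using For.prems k by (auto simp: index_vars_ok_def)
    then have "index_vars_ok d (nat_vars ?m)" using I by (auto simp: index_vars_ok_def)
    then show "?I (Suc k) (exec svd d x c ?m)"
      using For.IH[of ?m] For.prems I by (simp del: fun_upd_apply)
  qed (use For.prems in simp)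
  then show ?case by blast
next
  case (IfLess r1 r2 c)
  let ?m = "tick (1 + rcost r1 + rcost r2) (touch (rcells r1 (nat_vars m) \<union> rcells r2 (nat_vars m)) m)"
  have "touched ?m \<subseteq> N \<times> {..<d * d}"
    using IfLess.prems rexp_ok_cells[of N r1 d "nat_vars m"] rexp_ok_cells[of N r2 d "nat_vars m"] by auto
  then show ?case using IfLess.IH[of ?m] IfLess.prems by (simp add: Let_def)
next
  case (Read a)
  have "{a} \<times> {..<d} \<subseteq> N \<times> {..<d * d}"
    using Read.prems by (cases d) (auto intro: less_le_trans)
  then show ?case using Read.prems by simp
next
  case (Svd U s V p q)
  have "d \<le> d * d" by (cases d) auto
  then have "{..<d} \<subseteq> {..<d * d}" by auto
  then have "{U, V} \<times> {..<d * d} \<union> {s, p, q} \<times> {..<d} \<subseteq> N \<times> {..<d * d}"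
    using Svd.prems by (intro Un_least Sigma_mono) auto
  then show ?case using Svd.prems by (auto simp: Let_def split: prod.splits)
qed auto

definition array_names :: "name set" where
  "array_names = {''x'', ''c'', ''M'', ''h'', ''U'', ''V'', ''s'', ''xi'', ''y'', ''a'', ''w'', ''p'', ''q'', ''A''}"

lemma scale_indep_code_ok: "code_ok array_names scale_indep_code"
  unfolding scale_indep_code_def init_code_def step_code_def output_code_def dot_code_def
    mult_code_def mult_transpose_code_def array_names_def
  by (simp add: addr_ok_def)

text \<open>Each of the 14 arrays, scalars included, is credited with \<open>d^2\<close> cells. The
  hypothesis on \<open>d\<close> makes the initial index values 0 admissible.\<close>

lemma storage_le:
  assumes "1 \<le> d"
  shows "storage svd d n x \<xi> \<le> 14 * d\<^sup>2"
proof -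
  have "touched (final_machine svd d n x \<xi>) \<subseteq> array_names \<times> {..<d * d}"
    unfolding final_machine_def
    using assms by (intro conjunct2[OF code_ok_touched[OF scale_indep_code_ok]])
      (auto simp: initial_machine_def index_vars_ok_def)
  moreover have "finite array_names" by (simp add: array_names_def)
  ultimately have "storage svd d n x \<xi> \<le> card (array_names \<times> {..<d * d})"
    unfolding storage_def by (intro card_mono) auto
  also have "\<dots> = card array_names * d\<^sup>2" by (simp add: power2_eq_square card_cartesian_product)
  also have "card array_names \<le> 14"
    using card_length[of "[''x'', ''c'', ''M'', ''h'', ''U'', ''V'', ''s'', ''xi'', ''y'', ''a'', ''w'', ''p'', ''q'', ''A'']"]
    by (simp only: array_names_def list.set list.size)
  finally show ?thesis by simp
qed

section \<open>The initialisation and one iteration\<close>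

lemma invertible_mat_of_det:
  assumes A: "(A :: real mat) \<in> carrier_mat d d" and det: "det A \<noteq> 0"
  shows "invertible_mat A"
proof -
  have "A \<in> Units (ring_mat TYPE(real) d ())" by (rule det_non_zero_imp_unit[OF A det])
  then obtain B where "B \<in> carrier_mat d d" "B * A = 1\<^sub>m d" "A * B = 1\<^sub>m d"
    by (auto simp: Units_def ring_mat_def)
  then show ?thesis using A unfolding invertible_mat_def inverts_mat_def
    by (intro conjI exI[of _ B]) auto
qed

text \<open>\<open>q = V \<Sigma>^-2 V^T x = A^T A x\<close>, so
  \<open>q \<bullet> v = a \<bullet> A v\<close>, and adding \<open>p q^T\<close> subtracts from
  \<open>A v\<close> the same multiple of \<open>a\<close> as the rank-one step. The sum is
  invertible because the step merely divides the nonzero determinant by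
  \<open>\<alpha>\<close>.\<close>

lemma rank_one_step_svd_update_input:
  fixes x :: "real vec"
  assumes F: "svd_factors d U s V" and d: "1 \<le> d" and x: "x \<in> carrier_vec d"
    and \<alpha>_def: "\<alpha> = enorm (inv_factored d U s V *\<^sub>v x)" and gt: "1 < \<alpha>"
    and p: "p = vec d (\<lambda>i. (1 / \<alpha> - 1) / \<alpha>\<^sup>2 * (inv_factored d U s V *\<^sub>v x) $ i)"
    and q: "q = V *\<^sub>v vec d (\<lambda>i. (V\<^sup>T *\<^sub>v x) $ i / s $ i / s $ i)"
  shows "inv_factored d U s V + outer_prod p q = rank_one_step d (inv_factored d U s V) x"
    and "svd_update_input d U s V p q"
proof -
  note A = inv_factored_carrier[OF F]
  have oU: "orthogonal_matrix_of d U" and oV: "orthogonal_matrix_of d V"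
    and s: "s \<in> carrier_vec d" "\<And>i. i < d \<Longrightarrow> 0 < s $ i"
    using F by (auto simp: svd_factors_def)
  note V = orthogonal_matrixD[OF oV]
  define a where "a = inv_factored d U s V *\<^sub>v x"
  have a: "a \<in> carrier_vec d" using A x by (simp add: a_def)
  have pa: "p = (- ((1 - 1 / \<alpha>) / \<alpha>\<^sup>2)) \<cdot>\<^sub>v a"
    using a by (intro eq_vecI) (auto simp: p a_def[symmetric] minus_divide_left algebra_simps diff_divide_distrib)
  have pc: "p \<in> carrier_vec d" and qc: "q \<in> carrier_vec d" using V(1) by (simp_all add: p q)
  show eq: "inv_factored d U s V + outer_prod p q = rank_one_step d (inv_factored d U s V) x"
  proof (rule mat_eq_vecI)
    fix v :: "real vec" assume v: "v \<in> carrier_vec d"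
    define w where "w = inv_factored d U s V *\<^sub>v v"
    have w: "w \<in> carrier_vec d" using A v by (simp add: w_def)
    have Vv: "V\<^sup>T *\<^sub>v v \<in> carrier_vec d" using V(2) v by simp
    have "q \<bullet> v = vec d (\<lambda>i. (V\<^sup>T *\<^sub>v x) $ i / s $ i / s $ i) \<bullet> (V\<^sup>T *\<^sub>v v)"
      unfolding q using transpose_vec_mult_scalar[OF V(2) v] by simp
    also have "\<dots> = vec d (\<lambda>i. (V\<^sup>T *\<^sub>v x) $ i / s $ i) \<bullet> vec d (\<lambda>i. (V\<^sup>T *\<^sub>v v) $ i / s $ i)"
      using Vv V(1) by (simp add: scalar_prod_def)
    also have "\<dots> = a \<bullet> w"
      unfolding a_def w_def inv_factored_mult_vec[OF F x] inv_factored_mult_vec[OF F v]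
      by (simp add: orthogonal_scalar_prod[OF oU])
    finally have qv: "q \<bullet> v = a \<bullet> w" .
    have "(inv_factored d U s V + outer_prod p q) *\<^sub>v v = w + (a \<bullet> w) \<cdot>\<^sub>v p"
      using A pc qc v by (simp add: add_mult_distrib_mat_vec[of _ d d] outer_prod_mult_vec qv w_def)
    also have "\<dots> = w - ((1 - 1 / \<alpha>) / \<alpha>\<^sup>2 * (a \<bullet> w)) \<cdot>\<^sub>v a"
      using a w by (intro eq_vecI) (auto simp: pa)
    also have "\<dots> = rank_one_step d (inv_factored d U s V) x *\<^sub>v v"
      using rank_one_step_mult_vec[OF F x v] by (simp add: a_def w_def \<alpha>_def)
    finally show "(inv_factored d U s V + outer_prod p q) *\<^sub>v v
      = rank_one_step d (inv_factored d U s V) x *\<^sub>v v" .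
  qed (use A pc qc rank_one_step_carrier[OF F x] in auto)
  have "0 < (det (inv_factored d U s V))\<^sup>2"
    unfolding inv_factored_det_sq[OF F]
    by (intro divide_pos_pos zero_less_power factors_prod_pos[OF F]) simp
  then have "det (rank_one_step d (inv_factored d U s V) x) \<noteq> 0"
    using rank_one_step_det[OF F x d] gt by (simp add: \<alpha>_def)
  then have "invertible_mat (rank_one_step d (inv_factored d U s V) x)"
    by (rule invertible_mat_of_det[OF rank_one_step_carrier[OF F x]])
  then show "svd_update_input d U s V p q"
    using F pc qc by (simp add: svd_update_input_def svd_factors_def eq)
qed

text \<open>\<open>init_code\<close> after its \<open>Read\<close>, which is split off because
  \<open>effect\<close> demands that \<open>inputs_read\<close> stay the same.\<close>

definition init_body :: com where
  "init_body =
     dot_code ''c'' ''x'' ''x'' ;;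
     set_scalar ''M'' (RSqrt (scalar ''c'')) ;;
     For ''i'' dim_n (set1 ''h'' ''i'' (RSub (RConst 0) (RDiv (cell1 ''x'' ''i'') (scalar ''M'')))) ;;
     set_scalar ''h'' (RAdd (RConst 1) (scalar ''h'')) ;;
     dot_code ''c'' ''h'' ''h'' ;;
     ident_code ;;
     IfLess (RConst 0) (scalar ''c'') reflect_code ;;
     For ''i'' dim_n (set1 ''s'' ''i'' (RDiv (scalar ''M'') (scalar ''xi''))) ;;
     set_scalar ''s'' (scalar ''M'')"

lemma init_code_eq: "init_code = Read ''x'' ;; init_body"
  by (simp add: init_code_def init_body_def ident_code_def reflect_code_def)

abbreviation "loop_vars \<equiv> {''i'', ''j'', ''k''}"

text \<open>The intermediate memories \<open>\<mu>2\<close>, \<open>\<mu>4\<close>,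
  \<open>\<mu>6\<close> and \<open>\<mu>7\<close> record only cells that matter later, so the nine
  nested transformers never have to be unfolded at once.\<close>

lemma exec_init_code:
  fixes svd :: svd_proc and x :: "nat \<Rightarrow> real vec" and m :: machine
  assumes d: "nat_vars m ''d'' = d" "1 \<le> d" and v: "v = x (Suc (inputs_read m))" "v \<in> carrier_vec d" "v \<noteq> 0\<^sub>v d"
  defines "m' \<equiv> exec svd d x init_code m" and "\<xi> \<equiv> memory m (''xi'', 0)"
  shows "mem_mat d (memory m') ''U'' = 1\<^sub>m d"
    and "orthogonal_matrix_of d (mem_mat d (memory m') ''V'')"
    and "(mem_mat d (memory m') ''V'')\<^sup>T *\<^sub>v v = enorm v \<cdot>\<^sub>v unit_vec d 0"
    and "mem_vec d (memory m') ''s'' = vec d (\<lambda>i. if i = 0 then enorm v else enorm v / \<xi>)"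
    and "memory m' (''M'', 0) = enorm v" "memory m' (''xi'', 0) = \<xi>"
    and "inputs_read m' = Suc (inputs_read m)"
    and "u \<notin> loop_vars \<Longrightarrow> nat_vars m' u = nat_vars m u"
proof -
  have disj: "loop_vars \<inter> fst ` set [(''d'', d)] = {}" by simp
  let ?E = "effect svd d x [(''d'', d)] loop_vars"
  define f1 where "f1 = (\<lambda>\<mu>. \<mu>((''c'', 0 :: nat) := mem_vec d \<mu> ''x'' \<bullet> mem_vec d \<mu> ''x''))"
  define f2 where "f2 = (\<lambda>\<mu>. \<mu>((''M'', 0 :: nat) := sqrt (\<mu> (''c'', 0 :: nat))))"
  define f3 where "f3 = (\<lambda>\<mu>. set_array ''h'' d (\<lambda>k. 0 - \<mu> (''x'', k) / \<mu> (''M'', 0)) \<mu>)"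
  define f4 where "f4 = (\<lambda>\<mu>. \<mu>((''h'', 0 :: nat) := 1 + \<mu> (''h'', 0 :: nat) :: real))"
  define f5 where "f5 = (\<lambda>\<mu>. \<mu>((''c'', 0 :: nat) := mem_vec d \<mu> ''h'' \<bullet> mem_vec d \<mu> ''h''))"
  define f6 where "f6 = (\<lambda>\<mu>. set_array ''U'' (d * d) (ident_array d) (set_array ''V'' (d * d) (ident_array d) \<mu>))"
  define f7 where "f7 = (\<lambda>\<mu>. if 0 < \<mu> (''c'', 0) then set_array ''V'' (d * d)
       (\<lambda>q. \<mu> (''V'', q) - 2 * (\<mu> (''h'', q div d) * \<mu> (''h'', q mod d)) / \<mu> (''c'', 0)) \<mu> else \<mu>)"
  define f8 where "f8 = (\<lambda>\<mu>. set_array ''s'' d (\<lambda>k. \<mu> (''M'', 0) / \<mu> (''xi'', 0)) \<mu>)"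
  define f9 where "f9 = (\<lambda>\<mu>. \<mu>((''s'', 0 :: nat) := \<mu> (''M'', 0 :: nat) :: real))"
  note fs = f1_def f2_def f3_def f4_def f5_def f6_def f7_def f8_def f9_def
  have e1: "?E (dot_code ''c'' ''x'' ''x'') f1" unfolding f1_def by (rule effect_dot_code) auto
  have e2: "?E (set_scalar ''M'' (RSqrt (scalar ''c''))) f2" unfolding f2_def by (rule effect_Store) auto
  have e3: "?E (For ''i'' dim_n (set1 ''h'' ''i'' (RSub (RConst 0) (RDiv (cell1 ''x'' ''i'') (scalar ''M''))))) f3"
    unfolding f3_def by (rule effect_map_code) auto
  have e4: "?E (set_scalar ''h'' (RAdd (RConst 1) (scalar ''h''))) f4" unfolding f4_def by (rule effect_Store) auto
  have e5: "?E (dot_code ''c'' ''h'' ''h'') f5" unfolding f5_def by (rule effect_dot_code) auto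
  have e6: "?E ident_code f6" unfolding f6_def by (rule effect_ident_code)
  have e7: "?E (IfLess (RConst 0) (scalar ''c'') reflect_code) f7"
    unfolding f7_def by (rule effect_IfLess[OF effect_reflect_code]) auto
  have e8: "?E (For ''i'' dim_n (set1 ''s'' ''i'' (RDiv (scalar ''M'') (scalar ''xi'')))) f8"
    unfolding f8_def by (rule effect_map_code) auto
  have e9: "?E (set_scalar ''s'' (scalar ''M'')) f9" unfolding f9_def by (rule effect_Store) auto
  have e: "?E init_body (\<lambda>\<mu>. f9 (f8 (f7 (f6 (f5 (f4 (f3 (f2 (f1 \<mu>)))))))))"
    unfolding init_body_def
    by (rule effect_Seq[OF e1 effect_Seq[OF e2 effect_Seq[OF e3 effect_Seq[OF e4 effect_Seq[OF e5
      effect_Seq[OF e6 effect_Seq[OF e7 effect_Seq[OF e8 e9 disj] disj] disj] disj] disj] disj] disj] disj])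
  define m0 where "m0 = exec svd d x (Read ''x'') m"
  define \<mu>0 where "\<mu>0 = put_vec d ''x'' v (memory m)"
  have m0: "memory m0 = \<mu>0" "inputs_read m0 = Suc (inputs_read m)" "nat_vars m0 = nat_vars m"
    by (simp_all add: m0_def \<mu>0_def v(1))
  have m': "m' = exec svd d x init_body m0" by (simp add: m'_def m0_def init_code_eq)
  have d0: "\<forall>(u, k)\<in>set [(''d'', d)]. nat_vars m0 u = k" using d by (simp add: m0)
  note eD = effectD[OF e d0, folded m', unfolded m0]
  show "inputs_read m' = Suc (inputs_read m)" using eD(2) .
  show "u \<notin> loop_vars \<Longrightarrow> nat_vars m' u = nat_vars m u" using eD(3) .
  define \<rho> where "\<rho> = enorm v"
  have \<rho>: "0 < \<rho>" using enorm_eq_0_iff[OF v(2)] v(3) enorm_nonneg[of v] by (simp add: \<rho>_def)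
  have vx: "mem_vec d \<mu>0 ''x'' = v" "\<And>k. k < d \<Longrightarrow> \<mu>0 (''x'', k) = v $ k"
    using v(2) by (auto simp: \<mu>0_def put_vec_set_array)
  have \<xi>: "\<mu>0 (''xi'', 0) = \<xi>" by (simp add: \<mu>0_def put_vec_def \<xi>_def)
  define \<mu>2 where "\<mu>2 = f2 (f1 \<mu>0)"
  have \<mu>2: "\<mu>2 (''M'', 0) = \<rho>" "\<mu>2 (''xi'', 0) = \<xi>" "\<And>k. k < d \<Longrightarrow> \<mu>2 (''x'', k) = v $ k"
    using vx \<xi> by (simp_all add: \<mu>2_def f1_def f2_def \<rho>_def enorm_def)
  define w where "w = (1 / \<rho>) \<cdot>\<^sub>v v"
  define h where "h = unit_vec d 0 - w"
  have w: "w \<in> carrier_vec d" "w \<bullet> w = 1"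
    using v(2) \<rho> enorm_sq[of v, folded \<rho>_def, symmetric]
    by (simp_all add: w_def power2_eq_square)
  have h: "h \<in> carrier_vec d" using w by (simp add: h_def)
  \<comment> \<open>The loop has written the entries of \<open>- w\<close>, and the next instruction
    adds 1 to entry 0, which gives \<open>h\<close>.\<close>
  define \<mu>4 where "\<mu>4 = f4 (f3 \<mu>2)"
  have \<mu>4: "\<mu>4 (''M'', 0) = \<rho>" "\<mu>4 (''xi'', 0) = \<xi>" "\<And>k. k < d \<Longrightarrow> \<mu>4 (''h'', k) = h $ k"
    using \<mu>2 d(2) v(2) by (auto simp: \<mu>4_def f3_def f4_def h_def w_def)
  have h4: "mem_vec d \<mu>4 ''h'' = h" using h \<mu>4(3) by (auto simp: mem_vec_def)
  define \<mu>6 where "\<mu>6 = f6 (f5 \<mu>4)"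
  have \<mu>6: "\<mu>6 (''M'', 0) = \<rho>" "\<mu>6 (''xi'', 0) = \<xi>" "\<mu>6 (''c'', 0) = h \<bullet> h"
    "\<And>k. k < d \<Longrightarrow> \<mu>6 (''h'', k) = h $ k"
    "\<And>q. q < d * d \<Longrightarrow> \<mu>6 (''U'', q) = ident_array d q"
    "\<And>q. q < d * d \<Longrightarrow> \<mu>6 (''V'', q) = ident_array d q"
    using \<mu>4 by (simp_all add: \<mu>6_def f5_def f6_def h4)
  define \<mu>7 where "\<mu>7 = f7 \<mu>6"
  have \<mu>7: "\<mu>7 (''M'', 0) = \<rho>" "\<mu>7 (''xi'', 0) = \<xi>"
    "\<And>q. q < d * d \<Longrightarrow> \<mu>7 (''U'', q) = ident_array d q"
    using \<mu>6 by (simp_all add: \<mu>7_def f7_def)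
  have V7: "\<mu>7 (''V'', q) = ident_array d q - 2 * (h $ (q div d) * h $ (q mod d)) / (h \<bullet> h)"
    if q: "q < d * d" for q
  proof -
    have "q div d < d" "q mod d < d" using q d(2) by (auto simp: less_mult_imp_div_less)
    \<comment> \<open>If the branch is not taken, then \<open>h \<bullet> h = 0\<close> and the
      claimed formula still holds, since its quotient by zero is 0.\<close>
    moreover have "h \<bullet> h = 0 \<or> 0 < h \<bullet> h" using scalar_prod_self_nonneg[of h] by linarith
    ultimately show ?thesis using \<mu>6 q by (auto simp: \<mu>7_def f7_def)
  qed
  have mem: "memory m' = f9 (f8 \<mu>7)"
    using eD(1) by (simp only: \<mu>2_def \<mu>4_def \<mu>6_def \<mu>7_def)
  have V: "mem_mat d (memory m') ''V'' = householder d h"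
  proof (rule eq_matI)
    fix i j assume "i < dim_row (householder d h)" "j < dim_col (householder d h)"
    then have ij: "i < d" "j < d" using householder_carrier[OF h] by auto
    then show "mem_mat d (memory m') ''V'' $$ (i, j) = householder d h $$ (i, j)"
      using V7[OF index_bound[OF ij]] h
      by (simp add: mem f8_def f9_def mem_mat_def householder_def outer_prod_def ident_array_def)
  qed (use householder_carrier[OF h] in \<open>auto simp: mem_mat_def\<close>)
  show "orthogonal_matrix_of d (mem_mat d (memory m') ''V'')"
    using householder_orthogonal[OF h] V by simp
  have "householder d h *\<^sub>v w = unit_vec d 0"
    unfolding h_def using d(2) w by (intro householder_maps) auto
  moreover have "v = \<rho> \<cdot>\<^sub>v w" using \<rho> by (simp add: w_def smult_smult_assoc)
  ultimately show "(mem_mat d (memory m') ''V'')\<^sup>T *\<^sub>v v = enorm v \<cdot>\<^sub>v unit_vec d 0"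
    using mult_mat_vec[OF householder_carrier[OF h] w(1), of \<rho>]
    by (simp add: V householder_symmetric[OF h] \<rho>_def)
  show "mem_mat d (memory m') ''U'' = 1\<^sub>m d"
    using \<mu>7(3)[OF index_bound] by (intro eq_matI) (auto simp: mem f8_def f9_def mem_mat_def ident_array_def)
  show "mem_vec d (memory m') ''s'' = vec d (\<lambda>i. if i = 0 then enorm v else enorm v / \<xi>)"
    using \<mu>7 by (auto simp: mem f8_def f9_def mem_vec_def \<rho>_def)
  show "memory m' (''M'', 0) = enorm v" "memory m' (''xi'', 0) = \<xi>"
    using \<mu>7 by (simp_all add: mem f8_def f9_def \<rho>_def)
qed

text \<open>\<open>step_code\<close> after its \<open>Read\<close> is cut at the test and at the SVD
  update. The three pieces between these cuts are pure code with known effects.\<close>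

definition step_pre :: com where
  "step_pre =
     dot_code ''c'' ''x'' ''x'' ;;
     set_scalar ''M'' (RMax (scalar ''M'') (RSqrt (scalar ''c''))) ;;
     mult_transpose_code ''y'' ''V'' ''x'' ;;
     For ''i'' dim_n (set1 ''y'' ''i'' (RDiv (cell1 ''y'' ''i'') (cell1 ''s'' ''i''))) ;;
     mult_code ''a'' ''U'' ''y'' ;;
     dot_code ''c'' ''a'' ''a'' ;;
     set_scalar ''w'' (RSqrt (scalar ''c''))"

definition step_mid :: com where
  "step_mid =
       For ''i'' dim_n
          (set1 ''p'' ''i''
             (RMul (RDiv (RSub (RDiv (RConst 1) (scalar ''w'')) (RConst 1)) (scalar ''c''))
                (cell1 ''a'' ''i''))) ;;
        For ''i'' dim_n (set1 ''y'' ''i'' (RDiv (cell1 ''y'' ''i'') (cell1 ''s'' ''i''))) ;;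
        mult_code ''q'' ''V'' ''y''"

definition step_post :: com where
  "step_post =
        For ''i'' dim_n
          (set1 ''s'' ''i'' (RMax (cell1 ''s'' ''i'') (RDiv (scalar ''M'') (scalar ''xi''))))"

text \<open>The machine \<open>m2\<close> carries the cost of the test, which is one unit plus 1 for
  the constant and \<open>1 + 1\<close> for the scalar; the sum is left unevaluated to match
  \<open>exec\<close>.\<close>

lemma exec_step_code:
  "exec svd d x step_code m =
    (let m1 = exec svd d x step_pre (exec svd d x (Read ''x'') m);
         m2 = tick (1 + 1 + (1 + 1)) (touch ({} \<union> {(''w'', 0)}) m1)
     in if 1 < memory m1 (''w'', 0)
        then exec svd d x step_post
          (exec svd d x (Svd ''U'' ''s'' ''V'' ''p'' ''q'') (exec svd d x step_mid m2))
        else m2)"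
  unfolding step_code_def step_pre_def step_mid_def step_post_def
  by (simp only: exec.simps(2,4) Let_def rval.simps nval.simps rcost.simps ncost.simps rcells.simps)

lemma step_pre_effect:
  fixes svd :: svd_proc and x :: "nat \<Rightarrow> real vec" and m :: machine
  assumes d: "nat_vars m ''d'' = d" and F: "svd_factors d U s V"
    and U: "mem_mat d (memory m) ''U'' = U" and s: "mem_vec d (memory m) ''s'' = s"
    and V: "mem_mat d (memory m) ''V'' = V" and v: "mem_vec d (memory m) ''x'' = v"
  defines "m' \<equiv> exec svd d x step_pre m"
  shows "mem_mat d (memory m') ''U'' = U" "mem_vec d (memory m') ''s'' = s"
    "mem_mat d (memory m') ''V'' = V"
    "mem_vec d (memory m') ''y'' = vec d (\<lambda>i. (V\<^sup>T *\<^sub>v v) $ i / s $ i)"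
    "mem_vec d (memory m') ''a'' = inv_factored d U s V *\<^sub>v v"
    "memory m' (''c'', 0) = (enorm (inv_factored d U s V *\<^sub>v v))\<^sup>2"
    "memory m' (''w'', 0) = enorm (inv_factored d U s V *\<^sub>v v)"
    "memory m' (''M'', 0) = max (memory m (''M'', 0)) (enorm v)"
    "memory m' (''xi'', 0) = memory m (''xi'', 0)"
    "inputs_read m' = inputs_read m"
    "u \<notin> loop_vars \<Longrightarrow> nat_vars m' u = nat_vars m u"
proof -
  have disj: "loop_vars \<inter> fst ` set [(''d'', d)] = {}" by simp
  let ?E = "effect svd d x [(''d'', d)] loop_vars"
  define f1 where "f1 = (\<lambda>\<mu>. \<mu>((''c'', 0 :: nat) := mem_vec d \<mu> ''x'' \<bullet> mem_vec d \<mu> ''x''))"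
  define f2 where "f2 = (\<lambda>\<mu>. \<mu>((''M'', 0 :: nat) := max (\<mu> (''M'', 0)) (sqrt (\<mu> (''c'', 0 :: nat)))))"
  define f3 where "f3 = (\<lambda>\<mu>. set_array ''y'' d (\<lambda>i. ((mem_mat d \<mu> ''V'')\<^sup>T *\<^sub>v mem_vec d \<mu> ''x'') $ i) \<mu>)"
  define f4 where "f4 = (\<lambda>\<mu>. set_array ''y'' d (\<lambda>k. \<mu> (''y'', k) / \<mu> (''s'', k)) \<mu>)"
  define f5 where "f5 = (\<lambda>\<mu>. set_array ''a'' d (\<lambda>i. (mem_mat d \<mu> ''U'' *\<^sub>v mem_vec d \<mu> ''y'') $ i) \<mu>)"
  define f6 where "f6 = (\<lambda>\<mu>. \<mu>((''c'', 0 :: nat) := mem_vec d \<mu> ''a'' \<bullet> mem_vec d \<mu> ''a''))"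
  define f7 where "f7 = (\<lambda>\<mu>. \<mu>((''w'', 0 :: nat) := sqrt (\<mu> (''c'', 0 :: nat))))"
  have e1: "?E (dot_code ''c'' ''x'' ''x'') f1" unfolding f1_def by (rule effect_dot_code) auto
  have e2: "?E (set_scalar ''M'' (RMax (scalar ''M'') (RSqrt (scalar ''c'')))) f2"
    unfolding f2_def by (rule effect_Store) auto
  have e3: "?E (mult_transpose_code ''y'' ''V'' ''x'') f3"
    unfolding f3_def by (rule effect_mult_transpose_code) auto
  have e4: "?E (For ''i'' dim_n (set1 ''y'' ''i'' (RDiv (cell1 ''y'' ''i'') (cell1 ''s'' ''i'')))) f4"
    unfolding f4_def by (rule effect_map_code) auto
  have e5: "?E (mult_code ''a'' ''U'' ''y'') f5" unfolding f5_def by (rule effect_mult_code) auto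
  have e6: "?E (dot_code ''c'' ''a'' ''a'') f6" unfolding f6_def by (rule effect_dot_code) auto
  have e7: "?E (set_scalar ''w'' (RSqrt (scalar ''c''))) f7" unfolding f7_def by (rule effect_Store) auto
  have e: "?E step_pre (\<lambda>\<mu>. f7 (f6 (f5 (f4 (f3 (f2 (f1 \<mu>)))))))"
    unfolding step_pre_def
    by (rule effect_Seq[OF e1 effect_Seq[OF e2 effect_Seq[OF e3 effect_Seq[OF e4 effect_Seq[OF e5
      effect_Seq[OF e6 e7 disj] disj] disj] disj] disj] disj])
  have d0: "\<forall>(u, k)\<in>set [(''d'', d)]. nat_vars m u = k" using d by simp
  note eD = effectD[OF e d0, folded m'_def]
  show "inputs_read m' = inputs_read m" using eD(2) .
  show "u \<notin> loop_vars \<Longrightarrow> nat_vars m' u = nat_vars m u" using eD(3) .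
  have sc: "s \<in> carrier_vec d" and vc: "v \<in> carrier_vec d"
    using F v by (auto simp: svd_factors_def)
  have oU: "U \<in> carrier_mat d d" and oV: "V \<in> carrier_mat d d" using U V by auto
  define \<mu>3 where "\<mu>3 = f3 (f2 (f1 (memory m)))"
  have \<mu>3: "mem_mat d \<mu>3 ''U'' = U" "mem_vec d \<mu>3 ''s'' = s" "mem_mat d \<mu>3 ''V'' = V"
    "\<And>i. i < d \<Longrightarrow> \<mu>3 (''y'', i) = (V\<^sup>T *\<^sub>v v) $ i"
    "\<mu>3 (''M'', 0) = max (memory m (''M'', 0)) (enorm v)" "\<mu>3 (''xi'', 0) = memory m (''xi'', 0)"
    using U s V v by (simp_all add: \<mu>3_def f1_def f2_def f3_def enorm_def)
  have s3: "\<mu>3 (''s'', i) = s $ i" if "i < d" for i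
    using arg_cong[OF \<mu>3(2), of "\<lambda>v. v $ i"] that by (simp add: mem_vec_def)
  define \<mu>4 where "\<mu>4 = f4 \<mu>3"
  have y4: "mem_vec d \<mu>4 ''y'' = vec d (\<lambda>i. (V\<^sup>T *\<^sub>v v) $ i / s $ i)"
    unfolding \<mu>4_def f4_def using \<mu>3(4) s3 by (auto intro!: eq_vecI simp del: index_mult_mat_vec)
  have \<mu>4: "mem_mat d \<mu>4 ''U'' = U" "mem_vec d \<mu>4 ''s'' = s" "mem_mat d \<mu>4 ''V'' = V"
    "\<mu>4 (''M'', 0) = max (memory m (''M'', 0)) (enorm v)" "\<mu>4 (''xi'', 0) = memory m (''xi'', 0)"
    using \<mu>3 by (simp_all add: \<mu>4_def f4_def)
  have a: "vec d (\<lambda>i. (U *\<^sub>v vec d (\<lambda>i. (V\<^sup>T *\<^sub>v v) $ i / s $ i)) $ i) = inv_factored d U s V *\<^sub>v v"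
    unfolding inv_factored_mult_vec[OF F vc] using oU by (intro eq_vecI) auto
  have mem: "memory m' = f7 (f6 (f5 \<mu>4))" using eD(1) by (simp only: \<mu>3_def \<mu>4_def)
  have a5: "mem_vec d (f5 \<mu>4) ''a'' = inv_factored d U s V *\<^sub>v v"
    unfolding f5_def \<mu>4 y4 mem_vec_set_array(1) by (rule a)
  show "mem_mat d (memory m') ''U'' = U" "mem_vec d (memory m') ''s'' = s"
    "mem_mat d (memory m') ''V'' = V"
    "memory m' (''M'', 0) = max (memory m (''M'', 0)) (enorm v)"
    "memory m' (''xi'', 0) = memory m (''xi'', 0)"
    using \<mu>4 by (simp_all add: mem f5_def f6_def f7_def)
  show "mem_vec d (memory m') ''y'' = vec d (\<lambda>i. (V\<^sup>T *\<^sub>v v) $ i / s $ i)"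
    unfolding y4[symmetric] by (simp add: mem f5_def f6_def f7_def)
  show "mem_vec d (memory m') ''a'' = inv_factored d U s V *\<^sub>v v"
    unfolding a5[symmetric] by (simp add: mem f6_def f7_def)
  show "memory m' (''c'', 0) = (enorm (inv_factored d U s V *\<^sub>v v))\<^sup>2"
    "memory m' (''w'', 0) = enorm (inv_factored d U s V *\<^sub>v v)"
    by (simp_all add: mem f6_def f7_def a5 enorm_sq) (simp add: enorm_def)
qed

lemma step_mid_effect:
  fixes svd :: svd_proc and x :: "nat \<Rightarrow> real vec" and m :: machine
  assumes d: "nat_vars m ''d'' = d"
    and U: "mem_mat d (memory m) ''U'' = U" and s: "mem_vec d (memory m) ''s'' = s"
    and V: "mem_mat d (memory m) ''V'' = V"
    and y: "mem_vec d (memory m) ''y'' = y" and a: "mem_vec d (memory m) ''a'' = a"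
  defines "m' \<equiv> exec svd d x step_mid m"
  shows "mem_mat d (memory m') ''U'' = U" "mem_vec d (memory m') ''s'' = s"
    "mem_mat d (memory m') ''V'' = V"
    "mem_vec d (memory m') ''p''
      = vec d (\<lambda>i. (1 / memory m (''w'', 0) - 1) / memory m (''c'', 0) * a $ i)"
    "mem_vec d (memory m') ''q'' = V *\<^sub>v vec d (\<lambda>i. y $ i / s $ i)"
    "memory m' (''M'', 0) = memory m (''M'', 0)"
    "memory m' (''xi'', 0) = memory m (''xi'', 0)"
    "inputs_read m' = inputs_read m"
    "u \<notin> loop_vars \<Longrightarrow> nat_vars m' u = nat_vars m u"
proof -
  have disj: "loop_vars \<inter> fst ` set [(''d'', d)] = {}" by simp
  let ?E = "effect svd d x [(''d'', d)] loop_vars"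
  define f1 where "f1 = (\<lambda>\<mu>. set_array ''p'' d (\<lambda>k. (1 / \<mu> (''w'', 0) - 1) / \<mu> (''c'', 0) * \<mu> (''a'', k)) \<mu>)"
  define f2 where "f2 = (\<lambda>\<mu>. set_array ''y'' d (\<lambda>k. \<mu> (''y'', k) / \<mu> (''s'', k)) \<mu>)"
  define f3 where "f3 = (\<lambda>\<mu>. set_array ''q'' d (\<lambda>i. (mem_mat d \<mu> ''V'' *\<^sub>v mem_vec d \<mu> ''y'') $ i) \<mu>)"
  have e1: "?E (For ''i'' dim_n
          (set1 ''p'' ''i''
             (RMul (RDiv (RSub (RDiv (RConst 1) (scalar ''w'')) (RConst 1)) (scalar ''c''))
                (cell1 ''a'' ''i'')))) f1"
    unfolding f1_def by (rule effect_map_code) auto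
  have e2: "?E (For ''i'' dim_n (set1 ''y'' ''i'' (RDiv (cell1 ''y'' ''i'') (cell1 ''s'' ''i'')))) f2"
    unfolding f2_def by (rule effect_map_code) auto
  have e3: "?E (mult_code ''q'' ''V'' ''y'') f3" unfolding f3_def by (rule effect_mult_code) auto
  have e: "?E step_mid (\<lambda>\<mu>. f3 (f2 (f1 \<mu>)))"
    unfolding step_mid_def by (rule effect_Seq[OF e1 effect_Seq[OF e2 e3 disj] disj])
  have d0: "\<forall>(u, k)\<in>set [(''d'', d)]. nat_vars m u = k" using d by simp
  note eD = effectD[OF e d0, folded m'_def]
  show "inputs_read m' = inputs_read m" using eD(2) .
  show "u \<notin> loop_vars \<Longrightarrow> nat_vars m' u = nat_vars m u" using eD(3) .
  note mem = eD(1)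
  have cells: "memory m (''s'', i) = s $ i" "memory m (''y'', i) = y $ i" "memory m (''a'', i) = a $ i"
    if "i < d" for i
    using that s y a by (auto simp: mem_vec_def)
  show "mem_mat d (memory m') ''U'' = U" "mem_vec d (memory m') ''s'' = s"
    "mem_mat d (memory m') ''V'' = V"
    "memory m' (''M'', 0) = memory m (''M'', 0)" "memory m' (''xi'', 0) = memory m (''xi'', 0)"
    using U s V by (simp_all add: mem f1_def f2_def f3_def)
  show "mem_vec d (memory m') ''p''
      = vec d (\<lambda>i. (1 / memory m (''w'', 0) - 1) / memory m (''c'', 0) * a $ i)"
    using cells by (auto simp: mem f1_def f2_def f3_def)
  have "mem_vec d (f2 (f1 (memory m))) ''y'' = vec d (\<lambda>i. y $ i / s $ i)"
    using cells by (auto simp: f1_def f2_def)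
  moreover have "mem_mat d (f2 (f1 (memory m))) ''V'' = V" using V by (simp add: f1_def f2_def)
  moreover have "V \<in> carrier_mat d d" using V by auto
  ultimately show "mem_vec d (memory m') ''q'' = V *\<^sub>v vec d (\<lambda>i. y $ i / s $ i)"
    unfolding mem f3_def mem_vec_set_array(1) by (intro eq_vecI) auto
qed

lemma step_post_effect:
  fixes svd :: svd_proc and x :: "nat \<Rightarrow> real vec" and m :: machine
  assumes d: "nat_vars m ''d'' = d" and s: "mem_vec d (memory m) ''s'' = s"
  defines "m' \<equiv> exec svd d x step_post m"
  shows "mem_mat d (memory m') ''U'' = mem_mat d (memory m) ''U''"
    "mem_mat d (memory m') ''V'' = mem_mat d (memory m) ''V''"
    "mem_vec d (memory m') ''s'' = vec d (\<lambda>i. max (s $ i) (memory m (''M'', 0) / memory m (''xi'', 0)))"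
    "memory m' (''M'', 0) = memory m (''M'', 0)"
    "memory m' (''xi'', 0) = memory m (''xi'', 0)"
    "inputs_read m' = inputs_read m"
    "u \<notin> loop_vars \<Longrightarrow> nat_vars m' u = nat_vars m u"
proof -
  have e: "effect svd d x [(''d'', d)] loop_vars step_post
    (\<lambda>\<mu>. set_array ''s'' d (\<lambda>k. max (\<mu> (''s'', k)) (\<mu> (''M'', 0) / \<mu> (''xi'', 0))) \<mu>)"
    unfolding step_post_def by (rule effect_map_code) auto
  have d0: "\<forall>(u, k)\<in>set [(''d'', d)]. nat_vars m u = k" using d by simp
  note eD = effectD[OF e d0, folded m'_def]
  show "inputs_read m' = inputs_read m" using eD(2) .
  show "u \<notin> loop_vars \<Longrightarrow> nat_vars m' u = nat_vars m u" using eD(3) .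
  show "mem_mat d (memory m') ''U'' = mem_mat d (memory m) ''U''"
    "mem_mat d (memory m') ''V'' = mem_mat d (memory m) ''V''"
    "mem_vec d (memory m') ''s'' = vec d (\<lambda>i. max (s $ i) (memory m (''M'', 0) / memory m (''xi'', 0)))"
    "memory m' (''M'', 0) = memory m (''M'', 0)"
    "memory m' (''xi'', 0) = memory m (''xi'', 0)"
    using s by (auto simp: eD(1) mem_vec_def)
qed

lemma put_mat_same:
  assumes "A \<in> carrier_mat d d"
  shows "mem_mat d (put_mat d a A \<mu>) a = A"
  using assms by (intro eq_matI) (auto simp: put_mat_set_array)

lemma put_vec_same:
  assumes "v \<in> carrier_vec d"
  shows "mem_vec d (put_vec d a v \<mu>) a = v"
  using assms by (intro eq_vecI) (auto simp: put_vec_set_array)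

lemma mem_put_other [simp]:
  "a \<noteq> b \<Longrightarrow> mem_vec d (put_vec d a v \<mu>) b = mem_vec d \<mu> b"
  "a \<noteq> b \<Longrightarrow> mem_vec d (put_mat d a A \<mu>) b = mem_vec d \<mu> b"
  "a \<noteq> b \<Longrightarrow> mem_mat d (put_vec d a v \<mu>) b = mem_mat d \<mu> b"
  "a \<noteq> b \<Longrightarrow> mem_mat d (put_mat d a A \<mu>) b = mem_mat d \<mu> b"
  "a \<noteq> b \<Longrightarrow> put_vec d a v \<mu> (b, i) = \<mu> (b, i)"
  "a \<noteq> b \<Longrightarrow> put_mat d a A \<mu> (b, i) = \<mu> (b, i)"
  by (simp_all add: put_vec_set_array put_mat_set_array)

text \<open>Each piece costs a quadratic polynomial in \<open>d\<close>, and 1 and \<open>d\<close>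
  are at most \<open>d * d\<close>. The summand 10 covers the constant charges of
  \<open>Read\<close>, of the test and of the SVD instruction.\<close>

lemma step_cost:
  assumes "1 \<le> d"
  shows "d + code_cost d step_pre + code_cost d step_mid + code_cost d step_post + 10 \<le> 1000 * d\<^sup>2"
    and "pure_code step_pre" "pure_code step_mid" "pure_code step_post"
proof -
  have *: "1 \<le> d * d" "d \<le> d * d" using assms by simp_all
  show "d + code_cost d step_pre + code_cost d step_mid + code_cost d step_post + 10 \<le> 1000 * d\<^sup>2"
    by (simp add: step_pre_def step_mid_def step_post_def dot_code_def mult_code_def
        mult_transpose_code_def power2_eq_square algebra_simps) (use * in linarith)
qed (simp_all add: step_pre_def step_mid_def step_post_def dot_code_def mult_code_def
        mult_transpose_code_def)

lemma init_cost:
  assumes "1 \<le> d"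
  shows "code_cost d init_code \<le> 1000 * d\<^sup>2" and "pure_code init_code"
proof -
  have *: "1 \<le> d * d" "d \<le> d * d" using assms by simp_all
  show "code_cost d init_code \<le> 1000 * d\<^sup>2"
    by (simp add: init_code_def dot_code_def power2_eq_square algebra_simps) (use * in linarith)
qed (simp add: init_code_def dot_code_def)

lemma output_cost:
  assumes "1 \<le> d"
  shows "code_cost d output_code \<le> 100 * d\<^sup>2 * d" and "pure_code output_code"
proof -
  have *: "1 \<le> d * d" "d \<le> d * d" "d * d \<le> d * (d * d)" using assms by simp_all
  show "code_cost d output_code \<le> 100 * d\<^sup>2 * d"
    by (simp add: output_code_def power2_eq_square algebra_simps) (use * in linarith)
qed (simp add: output_code_def)

text \<open>One pass of the loop body is one step of \<open>scale_indep_run\<close>, with the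
  diagonal returned by the SVD update as the unclamped \<open>r\<close>. The factors are shown to be
  valid again, because \<open>svd_update_correct\<close> speaks of valid inputs only. The running
  maximum is updated even if the ellipsoid is not, as \<open>max_norm\<close> ranges over all
  points.\<close>

lemma exec_step_code_correct:
  fixes svd :: svd_proc and x :: "nat \<Rightarrow> real vec" and m :: machine
  assumes correct: "svd_update_correct svd"
    and d: "nat_vars m ''d'' = d" "1 \<le> d"
    and F: "svd_factors d U s V"
    and U: "mem_mat d (memory m) ''U'' = U" and s: "mem_vec d (memory m) ''s'' = s"
    and V: "mem_mat d (memory m) ''V'' = V"
    and v: "v = x (Suc (inputs_read m))" "v \<in> carrier_vec d"
    and \<xi>: "memory m (''xi'', 0) = \<xi>" "0 < \<xi>" and M: "memory m (''M'', 0) = M" "0 < M"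
  defines "m' \<equiv> exec svd d x step_code m"
  defines "U' \<equiv> mem_mat d (memory m') ''U''" and "s' \<equiv> mem_vec d (memory m') ''s''"
    and "V' \<equiv> mem_mat d (memory m') ''V''"
  shows "if enorm (inv_factored d U s V *\<^sub>v v) > 1
         then \<exists>r. svd_inv d (rank_one_step d (inv_factored d U s V) v) U' r V' \<and>
                  s' = vec d (\<lambda>i. max (r $ i) (max M (enorm v) / \<xi>))
         else U' = U \<and> s' = s \<and> V' = V" (is ?step)
    and "svd_factors d U' s' V'" (is ?factors)
    and "memory m' (''M'', 0) = max M (enorm v)" "memory m' (''xi'', 0) = \<xi>"
    and "inputs_read m' = Suc (inputs_read m)"
    and "u \<notin> loop_vars \<Longrightarrow> nat_vars m' u = nat_vars m u"
    and "0 \<le> T \<Longrightarrow> (\<And>U s V p q. svd_update_input d U s V p q \<Longrightarrow> real (snd (svd d U s V p q)) \<le> T) \<Longrightarrow>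
           real (time m') \<le> real (time m) + 1000 * (real d)\<^sup>2 + T"
proof -
  define m0 where "m0 = exec svd d x (Read ''x'') m"
  have m0: "mem_mat d (memory m0) ''U'' = U" "mem_vec d (memory m0) ''s'' = s"
    "mem_mat d (memory m0) ''V'' = V" "mem_vec d (memory m0) ''x'' = v"
    "memory m0 (''xi'', 0) = \<xi>" "memory m0 (''M'', 0) = M"
    "inputs_read m0 = Suc (inputs_read m)" "nat_vars m0 = nat_vars m" "time m0 = time m + 1 + d"
    using U s V v \<xi> M by (simp_all add: m0_def put_vec_same)
  define m1 where "m1 = exec svd d x step_pre m0"
  have d0: "nat_vars m0 ''d'' = d" using d m0(8) by simp
  note m1 = step_pre_effect[OF d0 F m0(1,2,3,4), where svd = svd and x = x, folded m1_def]
  define m2 where "m2 = tick (1 + 1 + (1 + 1)) (touch ({} \<union> {(''w'', 0)}) m1)"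
  have t1: "time m1 \<le> time m + 1 + d + code_cost d step_pre"
    using pure_code_time[OF step_cost(2)[OF d(2)] d0, of svd x] m0(9) by (simp add: m1_def)
  let ?a = "inv_factored d U s V *\<^sub>v v"
  have cost: "real (d + code_cost d step_pre + code_cost d step_mid + code_cost d step_post + 10)
      \<le> 1000 * (real d)\<^sup>2"
    using step_cost(1)[OF d(2)] by (metis (mono_tags, lifting) of_nat_le_iff of_nat_mult of_nat_numeral of_nat_power)
  have "?step \<and> ?factors \<and> memory m' (''M'', 0) = max M (enorm v) \<and> memory m' (''xi'', 0) = \<xi> \<and>
    inputs_read m' = Suc (inputs_read m) \<and> (\<forall>u. u \<notin> loop_vars \<longrightarrow> nat_vars m' u = nat_vars m u) \<and>
    (0 \<le> T \<longrightarrow> (\<forall>U s V p q. svd_update_input d U s V p q \<longrightarrow> real (snd (svd d U s V p q)) \<le> T) \<longrightarrow>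
           real (time m') \<le> real (time m) + 1000 * (real d)\<^sup>2 + T)"
  proof (cases "1 < enorm ?a")
    case False
    then have m': "m' = m2"
      by (simp add: m'_def exec_step_code[of svd d x m] Let_def m0_def[symmetric] m1_def[symmetric]
          m2_def m1(7) del: exec.simps)
    have "real (time m2) \<le> real (time m) + real (d + code_cost d step_pre + code_cost d step_mid + code_cost d step_post + 10)"
      using t1 by (simp add: m2_def)
    then show ?thesis
      using False F m0 m1 cost unfolding m' U'_def s'_def V'_def by (auto simp: m2_def)
  next
    case True
    have dw: "nat_vars m2 ''d'' = d" using m1(11)[of "''d''"] d0 by (simp add: m2_def)
    have m2: "mem_mat d (memory m2) ''U'' = U" "mem_vec d (memory m2) ''s'' = s"
      "mem_mat d (memory m2) ''V'' = V" "mem_vec d (memory m2) ''y'' = vec d (\<lambda>i. (V\<^sup>T *\<^sub>v v) $ i / s $ i)"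
      "mem_vec d (memory m2) ''a'' = ?a"
      using m1 by (simp_all add: m2_def)
    define m3 where "m3 = exec svd d x step_mid m2"
    note m3 = step_mid_effect[OF dw m2, where svd = svd and x = x, folded m3_def]
    define p where "p = mem_vec d (memory m3) ''p''"
    define q where "q = mem_vec d (memory m3) ''q''"
    have p: "p = vec d (\<lambda>i. (1 / enorm ?a - 1) / (enorm ?a)\<^sup>2 * ?a $ i)"
      using m3(4) m1(6,7) by (simp add: p_def m2_def)
    have q: "q = V *\<^sub>v vec d (\<lambda>i. (V\<^sup>T *\<^sub>v v) $ i / s $ i / s $ i)"
      unfolding q_def m3(5) by (intro arg_cong[of _ _ "\<lambda>u. V *\<^sub>v u"] eq_vecI) auto
    note inp = rank_one_step_svd_update_input[OF F d(2) v(2) refl True p q]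
    obtain U4 r V4 \<tau> where svd: "svd d U s V p q = ((U4, r, V4), \<tau>)" by (metis prod.collapse)
    have S: "svd_inv d (rank_one_step d (inv_factored d U s V) v) U4 r V4"
      using correct inp d(2) svd by (fastforce simp: svd_update_correct_def)
    then have F4: "svd_factors d U4 r V4" by (simp add: svd_inv_def svd_factors_def)
    then have c4: "U4 \<in> carrier_mat d d" "r \<in> carrier_vec d" "V4 \<in> carrier_mat d d"
      by (auto simp: svd_factors_def orthogonal_matrix_of_def)
    define m4 where "m4 = exec svd d x (Svd ''U'' ''s'' ''V'' ''p'' ''q'') m3"
    have m4: "memory m4 = put_mat d ''U'' U4 (put_vec d ''s'' r (put_mat d ''V'' V4 (memory m3)))"
      "inputs_read m4 = inputs_read m3" "nat_vars m4 = nat_vars m3" "time m4 = time m3 + 1 + \<tau>"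
      by (simp_all add: m4_def Let_def m3(1,2,3) p_def[symmetric] q_def[symmetric] svd)
    have s4: "mem_vec d (memory m4) ''s'' = r" by (simp add: m4 put_vec_same c4)
    have UV4: "mem_mat d (memory m4) ''U'' = U4" "mem_mat d (memory m4) ''V'' = V4"
      by (simp_all add: m4 put_mat_same c4)
    have nv4: "nat_vars m4 u = nat_vars m u" if "u \<notin> loop_vars" for u
      using m3(9)[OF that] m1(11)[OF that] by (simp add: m4(3) m2_def m0(8))
    then have d4: "nat_vars m4 ''d'' = d" using d by simp
    define m5 where "m5 = exec svd d x step_post m4"
    note m5 = step_post_effect[OF d4 s4, where svd = svd and x = x, folded m5_def]
    have m': "m' = m5"
      using True
      by (simp add: m'_def exec_step_code[of svd d x m] Let_def m0_def[symmetric] m1_def[symmetric]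
          m2_def[simplified, symmetric] m3_def[symmetric] m4_def[symmetric] m5_def[symmetric] m1(7)
          del: exec.simps)
    have M4: "memory m4 (''M'', 0) = max M (enorm v)" "memory m4 (''xi'', 0) = \<xi>"
      using m3(6,7) m1(8,9) m0(5,6) by (simp_all add: m4(1) m2_def)
    have s5: "s' = vec d (\<lambda>i. max (r $ i) (max M (enorm v) / \<xi>))"
      unfolding s'_def m' m5(3) M4 ..
    have UV5: "U' = U4" "V' = V4" unfolding U'_def V'_def m' m5(1,2) UV4 by simp_all
    have "0 < max M (enorm v) / \<xi>" using M \<xi> by simp
    then have ?factors using F4 by (auto simp: svd_factors_def s5 UV5)
    moreover have ?step using True S by (auto simp: s5 UV5)
    moreover have "inputs_read m' = Suc (inputs_read m)"
      using m5(6) m4(2) m3(8) m1(10) m0(7) by (simp add: m' m2_def)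
    moreover have "nat_vars m' u = nat_vars m u" if "u \<notin> loop_vars" for u
      using m5(7)[OF that] nv4[OF that] by (simp add: m')
    moreover have "real (time m') \<le> real (time m) + 1000 * (real d)\<^sup>2 + T"
      if "0 \<le> T" "\<forall>U s V p q. svd_update_input d U s V p q \<longrightarrow> real (snd (svd d U s V p q)) \<le> T"
    proof -
      have "time m3 \<le> time m2 + code_cost d step_mid"
        using pure_code_time[OF step_cost(3)[OF d(2)] dw, of svd x] by (simp add: m3_def)
      moreover have "time m5 \<le> time m4 + code_cost d step_post"
        using pure_code_time[OF step_cost(4)[OF d(2)] d4, of svd x] by (simp add: m5_def)
      moreover have "time m2 = time m1 + 4" by (simp add: m2_def)
      ultimately have "time m5 \<le> time m
          + (d + code_cost d step_pre + code_cost d step_mid + code_cost d step_post + 10) + \<tau>"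
        using t1 m4(4) by linarith
      then have "real (time m5) \<le> real (time m)
          + real (d + code_cost d step_pre + code_cost d step_mid + code_cost d step_post + 10) + real \<tau>"
        by (metis of_nat_add of_nat_le_iff)
      moreover have "real \<tau> \<le> T" using that(2) inp(2) svd by fastforce
      ultimately show ?thesis using cost by (simp add: m')
    qed
    ultimately show ?thesis using m5(4,5) M4 m' by metis
  qed
  then show ?step ?factors "memory m' (''M'', 0) = max M (enorm v)" "memory m' (''xi'', 0) = \<xi>"
    "inputs_read m' = Suc (inputs_read m)" "u \<notin> loop_vars \<Longrightarrow> nat_vars m' u = nat_vars m u"
    "0 \<le> T \<Longrightarrow> (\<And>U s V p q. svd_update_input d U s V p q \<Longrightarrow> real (snd (svd d U s V p q)) \<le> T) \<Longrightarrow>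
           real (time m') \<le> real (time m) + 1000 * (real d)\<^sup>2 + T"
    by blast+
qed

section \<open>The whole program\<close>

lemma max_norm_Suc:
  assumes "1 \<le> t"
  shows "max_norm x (Suc t) = max (max_norm x t) (enorm (x (Suc t)))"
proof -
  have "(\<lambda>i. enorm (x i)) ` {1..Suc t} = insert (enorm (x (Suc t))) ((\<lambda>i. enorm (x i)) ` {1..t})"
    using assms by (simp add: atLeastAtMostSuc_conv)
  then show ?thesis using assms by (simp add: max_norm_def max.commute)
qed

lemma mem_output:
  "mem_mat d (set_array ''A'' (d * d) (\<lambda>q. \<Sum>k<d. \<mu> (''U'', q div d * d + k) / \<mu> (''s'', k) * \<mu> (''V'', q mod d * d + k)) \<mu>) ''A''
    = inv_factored d (mem_mat d \<mu> ''U'') (mem_vec d \<mu> ''s'') (mem_mat d \<mu> ''V'')"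
proof (rule eq_matI)
  let ?A = "mem_mat d (set_array ''A'' (d * d) (\<lambda>q. \<Sum>k<d. \<mu> (''U'', q div d * d + k) / \<mu> (''s'', k) * \<mu> (''V'', q mod d * d + k)) \<mu>) ''A''"
  let ?U = "mem_mat d \<mu> ''U''" and ?s = "mem_vec d \<mu> ''s''" and ?V = "mem_mat d \<mu> ''V''"
  have c: "?U * mat_diag d (\<lambda>i. inverse (?s $ i)) = mat d d (\<lambda>(i, j). ?U $$ (i, j) * inverse (?s $ j))"
    by (rule mat_diag_mult_right) simp
  show "dim_row (?A)
      = dim_row (inv_factored d ?U ?s ?V)"
    "dim_col (?A)
      = dim_col (inv_factored d ?U ?s ?V)"
    by (simp_all add: inv_factored_def mem_mat_def)
  fix i j assume "i < dim_row (inv_factored d ?U ?s ?V)" "j < dim_col (inv_factored d ?U ?s ?V)"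
  then have ij: "i < d" "j < d" by (simp_all add: inv_factored_def mem_mat_def)
  then show "?A $$ (i, j)
      = inv_factored d ?U ?s ?V $$ (i, j)"
    unfolding inv_factored_def c mem_mat_set_array(1)
    by (simp add: scalar_prod_def lessThan_atLeast0 mem_mat_def mem_vec_def divide_inverse)
qed

text \<open>In this state \<open>k + 1\<close> points have been read, so it carries the index \<open>t = k + 1\<close> of the algorithm.\<close>

definition loop_machine ::
  "svd_proc \<Rightarrow> nat \<Rightarrow> nat \<Rightarrow> (nat \<Rightarrow> real vec) \<Rightarrow> real \<Rightarrow> nat \<Rightarrow> machine" where
  "loop_machine svd d n x \<xi> k =
     fold (\<lambda>k m. exec svd d x step_code (tick 1 (m\<lparr>nat_vars := (nat_vars m)(''t'' := k)\<rparr>)))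
       [0..<k] (tick 4 (exec svd d x init_code (initial_machine d n \<xi>)))"

lemma loop_machine_Suc:
  "loop_machine svd d n x \<xi> (Suc k) = exec svd d x step_code
     (tick 1 ((loop_machine svd d n x \<xi> k)\<lparr>nat_vars := (nat_vars (loop_machine svd d n x \<xi> k))(''t'' := k)\<rparr>))"
  by (simp add: loop_machine_def del: fun_upd_apply)

context
  fixes svd :: svd_proc and d n :: nat and x :: "nat \<Rightarrow> real vec" and \<xi> :: real
  assumes correct: "svd_update_correct svd" and valid: "valid_input d n x \<xi>"
begin

private lemma program_input: "1 \<le> d" "1 \<le> n" "\<And>i. i \<in> {1..n} \<Longrightarrow> x i \<in> carrier_vec d" "x 1 \<noteq> 0\<^sub>v d"
  using valid by (auto simp: valid_input_def)

private abbreviation (input) "mach \<equiv> loop_machine svd d n x \<xi>"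
private abbreviation (input) "Um k \<equiv> mem_mat d (memory (mach k)) ''U''"
private abbreviation (input) "sm k \<equiv> mem_vec d (memory (mach k)) ''s''"
private abbreviation (input) "Vm k \<equiv> mem_mat d (memory (mach k)) ''V''"

private lemma init_machine:
  "Um 0 = 1\<^sub>m d" "orthogonal_matrix_of d (Vm 0)" "(Vm 0)\<^sup>T *\<^sub>v x 1 = enorm (x 1) \<cdot>\<^sub>v unit_vec d 0"
  "sm 0 = vec d (\<lambda>i. if i = 0 then enorm (x 1) else enorm (x 1) / \<xi>)"
  "memory (mach 0) (''M'', 0) = enorm (x 1)" "memory (mach 0) (''xi'', 0) = \<xi>"
  "inputs_read (mach 0) = 1" "nat_vars (mach 0) ''d'' = d" "nat_vars (mach 0) ''n'' = n"
  "time (mach 0) \<le> 1000 * d\<^sup>2 + 4"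
proof -
  let ?m = "initial_machine d n \<xi>"
  have m: "nat_vars ?m ''d'' = d" "nat_vars ?m ''n'' = n" "inputs_read ?m = 0" "memory ?m (''xi'', 0) = \<xi>" "time ?m = 0"
    by (simp_all add: initial_machine_def)
  have x1: "x 1 = x (Suc (inputs_read ?m))" "x 1 \<in> carrier_vec d" using m program_input by simp_all
  note init = exec_init_code[where svd = svd and x = x and m = ?m and v = "x 1", OF m(1) program_input(1) x1 program_input(4)]
  have mach0: "mach 0 = tick 4 (exec svd d x init_code ?m)" by (simp add: loop_machine_def)
  show "Um 0 = 1\<^sub>m d" "orthogonal_matrix_of d (Vm 0)" "(Vm 0)\<^sup>T *\<^sub>v x 1 = enorm (x 1) \<cdot>\<^sub>v unit_vec d 0"
    "sm 0 = vec d (\<lambda>i. if i = 0 then enorm (x 1) else enorm (x 1) / \<xi>)"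
    "memory (mach 0) (''M'', 0) = enorm (x 1)" "memory (mach 0) (''xi'', 0) = \<xi>"
    "inputs_read (mach 0) = 1" "nat_vars (mach 0) ''d'' = d" "nat_vars (mach 0) ''n'' = n"
    using init[unfolded m(4)] m unfolding mach0 by simp_all
  show "time (mach 0) \<le> 1000 * d\<^sup>2 + 4"
    using pure_code_time[OF init_cost(2)[OF program_input(1)] m(1), of svd x] init_cost(1)[OF program_input(1)] m(5)
    by (simp add: mach0)
qed

private lemma loop_invariant:
  assumes "k < n"
  shows "svd_factors d (Um k) (sm k) (Vm k) \<and> memory (mach k) (''M'', 0) = max_norm x (Suc k) \<and>
    memory (mach k) (''xi'', 0) = \<xi> \<and> inputs_read (mach k) = Suc k \<and>
    nat_vars (mach k) ''d'' = d \<and> nat_vars (mach k) ''n'' = n \<and> 0 < max_norm x (Suc k)"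
    (is "?I k")
  using assms
proof (induction k)
  case 0
  have "0 < enorm (x 1)" using enorm_eq_0_iff[of "x 1" d] program_input enorm_nonneg[of "x 1"] by fastforce
  moreover have "max_norm x (Suc 0) = enorm (x 1)" by (simp add: max_norm_def)
  moreover have "orthogonal_matrix_of d (1\<^sub>m d)" by (auto simp: orthogonal_matrix_of_def)
  ultimately show ?case
    using init_machine xi_pos[OF valid] by (auto simp: svd_factors_def)
next
  case (Suc k)
  then have I: "?I k" by simp
  let ?m = "tick 1 ((mach k)\<lparr>nat_vars := (nat_vars (mach k))(''t'' := k)\<rparr>)"
  have m: "nat_vars ?m ''d'' = d" "svd_factors d (Um k) (sm k) (Vm k)"
    "mem_mat d (memory ?m) ''U'' = Um k" "mem_vec d (memory ?m) ''s'' = sm k"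
    "mem_mat d (memory ?m) ''V'' = Vm k" "x (Suc (Suc k)) = x (Suc (inputs_read ?m))"
    "x (Suc (Suc k)) \<in> carrier_vec d" "memory ?m (''xi'', 0) = \<xi>"
    "memory ?m (''M'', 0) = max_norm x (Suc k)" "0 < max_norm x (Suc k)"
    using I program_input Suc.prems by auto
  note step = exec_step_code_correct[where x = x and m = ?m and v = "x (Suc (Suc k))", OF correct m(1) program_input(1) m(2-8) xi_pos[OF valid] m(9,10),
      folded loop_machine_Suc]
  have M: "max_norm x (Suc (Suc k)) = max (max_norm x (Suc k)) (enorm (x (Suc (Suc k))))"
    by (rule max_norm_Suc) simp
  show ?case
    using step(2-5) step(6)[of "''d''"] step(6)[of "''n''"] I m(10) by (auto simp: M)
qed

private lemma loop_step:
  assumes "Suc k < n"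
  shows "if enorm (inv_factored d (Um k) (sm k) (Vm k) *\<^sub>v x (Suc (Suc k))) > 1
         then \<exists>r. svd_inv d (rank_one_step d (inv_factored d (Um k) (sm k) (Vm k)) (x (Suc (Suc k)))) (Um (Suc k)) r (Vm (Suc k)) \<and>
                  sm (Suc k) = vec d (\<lambda>i. max (r $ i) (max_norm x (Suc (Suc k)) / \<xi>))
         else Um (Suc k) = Um k \<and> sm (Suc k) = sm k \<and> Vm (Suc k) = Vm k" (is ?step)
    and "0 \<le> T \<Longrightarrow> (\<And>U s V p q. svd_update_input d U s V p q \<Longrightarrow> real (snd (svd d U s V p q)) \<le> T) \<Longrightarrow>
      real (time (mach (Suc k))) \<le> real (time (mach k)) + 1 + 1000 * (real d)\<^sup>2 + T"
proof -
  have I: "svd_factors d (Um k) (sm k) (Vm k)" "memory (mach k) (''M'', 0) = max_norm x (Suc k)"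
    "memory (mach k) (''xi'', 0) = \<xi>" "inputs_read (mach k) = Suc k"
    "nat_vars (mach k) ''d'' = d" "0 < max_norm x (Suc k)"
    using loop_invariant[of k] assms by auto
  let ?m = "tick 1 ((mach k)\<lparr>nat_vars := (nat_vars (mach k))(''t'' := k)\<rparr>)"
  have m: "nat_vars ?m ''d'' = d" "svd_factors d (Um k) (sm k) (Vm k)"
    "mem_mat d (memory ?m) ''U'' = Um k" "mem_vec d (memory ?m) ''s'' = sm k"
    "mem_mat d (memory ?m) ''V'' = Vm k" "x (Suc (Suc k)) = x (Suc (inputs_read ?m))"
    "x (Suc (Suc k)) \<in> carrier_vec d" "memory ?m (''xi'', 0) = \<xi>"
    "memory ?m (''M'', 0) = max_norm x (Suc k)" "0 < max_norm x (Suc k)"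
    using I program_input assms by auto
  note step = exec_step_code_correct[where x = x and m = ?m and v = "x (Suc (Suc k))", OF correct m(1) program_input(1) m(2-8) xi_pos[OF valid] m(9,10),
      folded loop_machine_Suc]
  have M: "max_norm x (Suc (Suc k)) = max (max_norm x (Suc k)) (enorm (x (Suc (Suc k))))"
    by (rule max_norm_Suc) simp
  show ?step unfolding M by (rule step(1))
  show "real (time (mach (Suc k))) \<le> real (time (mach k)) + 1 + 1000 * (real d)\<^sup>2 + T"
    if "0 \<le> T" "\<And>U s V p q. svd_update_input d U s V p q \<Longrightarrow> real (snd (svd d U s V p q)) \<le> T"
    using step(7)[OF that] by simp
qed

private lemma final_machine_eq:
  "final_machine svd d n x \<xi> = exec svd d x output_code (mach (n - 1))"
proof -
  let ?m = "exec svd d x init_code (initial_machine d n \<xi>)"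
  \<comment> \<open>The 4 units pay for the loop and its bound \<open>n - 1\<close>: they are
    \<open>1 + ncost\<close> of an expression of cost 3.\<close>
  have "mach 0 = tick 4 ?m" by (simp add: loop_machine_def)
  then have "nat_vars ?m ''n'' = n" using init_machine(9) by simp
  then have "exec svd d x (For ''t'' (NSub (NVar ''n'') (NConst 1)) step_code) ?m = mach (n - 1)"
    by (simp add: loop_machine_def numeral_eq_Suc)
  then show ?thesis
    by (simp only: final_machine_def scale_indep_code_def exec.simps(2))
qed

lemma program_computes_run: "computes_run svd d n x \<xi>"
proof -
  let ?U = "\<lambda>t. Um (t - 1)" and ?s = "\<lambda>t. sm (t - 1)" and ?V = "\<lambda>t. Vm (t - 1)"
  have "scale_indep_run d n x \<xi> ?U ?s ?V"
    unfolding scale_indep_run_def Let_def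
  proof (intro conjI ballI)
    fix t assume t: "t \<in> {2..n}"
    then obtain k where k: "t = Suc (Suc k)" by (metis Suc_le_D atLeastAtMost_iff numeral_2_eq_2 Suc_le_mono)
    show "if 1 < enorm (inv_factored d (?U (t - 1)) (?s (t - 1)) (?V (t - 1)) *\<^sub>v x t)
      then \<exists>s'. svd_inv d (rank_one_step d (inv_factored d (?U (t - 1)) (?s (t - 1)) (?V (t - 1))) (x t)) (?U t) s' (?V t) \<and>
                ?s t = vec d (\<lambda>i. max (s' $ i) (max_norm x t / \<xi>))
      else ?U t = ?U (t - 1) \<and> ?s t = ?s (t - 1) \<and> ?V t = ?V (t - 1)"
      using loop_step(1)[of k] t unfolding k by simp
  qed (use init_machine in simp_all)
  moreover have "nat_vars (mach (n - 1)) ''d'' = d" using loop_invariant[of "n - 1"] program_input(2) by simp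
  then have mem: "memory (final_machine svd d n x \<xi>) = set_array ''A'' (d * d)
      (\<lambda>q. \<Sum>k<d. memory (mach (n - 1)) (''U'', q div d * d + k) / memory (mach (n - 1)) (''s'', k)
         * memory (mach (n - 1)) (''V'', q mod d * d + k)) (memory (mach (n - 1)))"
    unfolding final_machine_eq by (intro effectD(1)[OF effect_output_code]) simp
  ultimately show ?thesis
    unfolding computes_run_def Let_def mem mem_output
    by (intro exI[of "\<lambda>U. \<exists>s V. P U s V" ?U for P] exI[of "\<lambda>s. \<exists>V. P s V" ?s for P] exI[of _ ?V]) simp
qed

lemma program_time:
  assumes T: "0 \<le> T" "\<And>U s V p q. svd_update_input d U s V p q \<Longrightarrow> real (snd (svd d U s V p q)) \<le> T"
  shows "real (running_time svd d n x \<xi>) \<le> real n * (2105 * (real d)\<^sup>2 + T)"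
proof -
  have loop: "real (time (mach k)) \<le> 1000 * (real d)\<^sup>2 + 4 + k * (1 + 1000 * (real d)\<^sup>2 + T)" if "k < n" for k
    using that
  proof (induction k)
    case 0
    have "real (time (mach 0)) \<le> real (1000 * d\<^sup>2 + 4)" using init_machine(10) by (simp only: of_nat_le_iff)
    then show ?case by simp
  next
    case (Suc k)
    then show ?case using loop_step(2)[OF Suc.prems T] by (simp add: algebra_simps)
  qed
  have D: "1 \<le> (real d)\<^sup>2" using program_input(1) by simp
  have nd: "nat_vars (mach (n - 1)) ''d'' = d" using loop_invariant[of "n - 1"] program_input(2) by simp
  have "running_time svd d n x \<xi> \<le> time (mach (n - 1)) + 100 * d\<^sup>2 * d"
    using pure_code_time[OF output_cost(2)[OF program_input(1)] nd, of svd x] output_cost(1)[OF program_input(1)]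
    by (simp add: running_time_def final_machine_eq)
  also have "\<dots> \<le> time (mach (n - 1)) + 100 * d\<^sup>2 * n"
    using dim_le_points[OF valid] by simp
  finally have "real (running_time svd d n x \<xi>) \<le> real (time (mach (n - 1)) + 100 * d\<^sup>2 * n)"
    by (simp only: of_nat_le_iff)
  also have "\<dots> \<le> 1000 * (real d)\<^sup>2 + 4 + (n - 1) * (1 + 1000 * (real d)\<^sup>2 + T) + 100 * (real d)\<^sup>2 * n"
    using loop[of "n - 1"] program_input(2) by simp
  also have "\<dots> \<le> n * (1000 * (real d)\<^sup>2 + 4) + n * (1 + 1000 * (real d)\<^sup>2 + T) + n * (100 * (real d)\<^sup>2)"
    using T(1) program_input(2) by (intro add_mono mult_right_mono) (auto intro!: mult_right_mono[of 1 "real n", simplified])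
  \<comment> \<open>2100 collects initialisation, iteration and output, and 5 the constant charges
    of the loop, which \<open>1 \<le> d^2\<close> absorbs next.\<close>
  also have "\<dots> = n * (5 + 2100 * (real d)\<^sup>2 + T)" by (simp add: algebra_simps)
  also have "\<dots> \<le> n * (2105 * (real d)\<^sup>2 + T)" using D by (intro mult_left_mono) auto
  finally show ?thesis .
qed

end

theorem theorem16:
  shows "(\<forall>(d::nat) (n::nat) x \<xi> U s V.
            valid_input d n x \<xi> \<and> scale_indep_run d n x \<xi> U s V \<longrightarrow>
              (let E = mat_ellipsoid d (inv_factored d (U n) (s n) (V n)) in
                 shrink (sqrt (6 + 28 * real d * ln \<xi> + 16 * real d)) E \<subseteq> sym_hull d n x \<and>
                 sym_hull d n x \<subseteq> E)) \<and>
         (\<forall>svd. svd_update_correct svd \<and> svd_update_fast svd \<longrightarrow>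
            (\<exists>C::real. \<forall>(d::nat) (n::nat) x \<xi>. valid_input d n x \<xi> \<longrightarrow>
               computes_run svd d n x \<xi> \<and>
               (2 \<le> d \<longrightarrow> real (running_time svd d n x \<xi>)
                            \<le> C * real n * (real d)\<^sup>2 * (ln (real d))\<^sup>2) \<and>
               real (storage svd d n x \<xi>) \<le> C * (real d)\<^sup>2))"
proof (intro conjI allI impI)
  fix d n :: nat and x \<xi> U s V
  assume "valid_input d n x \<xi> \<and> scale_indep_run d n x \<xi> U s V"
  then show "let E = mat_ellipsoid d (inv_factored d (U n) (s n) (V n)) in
      shrink (sqrt (6 + 28 * real d * ln \<xi> + 16 * real d)) E \<subseteq> sym_hull d n x \<and> sym_hull d n x \<subseteq> E"
    using run_ellipsoid[of d n x \<xi> U s V] by (simp add: Let_def)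
next
  fix svd :: svd_proc
  assume svd: "svd_update_correct svd \<and> svd_update_fast svd"
  then obtain c where c: "\<And>d U s V p q. 2 \<le> d \<Longrightarrow> svd_update_input d U s V p q \<Longrightarrow>
      real (snd (svd d U s V p q)) \<le> c * (real d)\<^sup>2 * (ln (real d))\<^sup>2"
    unfolding svd_update_fast_def by blast
  \<comment> \<open>\<open>c\<close> may be negative, whereas \<open>program_time\<close> needs a
    nonnegative bound: an iteration that skips the SVD update is charged \<open>T\<close> as
    well.\<close>
  define c' where "c' = max c 0"
  show "\<exists>C::real. \<forall>(d::nat) (n::nat) x \<xi>. valid_input d n x \<xi> \<longrightarrow>
               computes_run svd d n x \<xi> \<and>
               (2 \<le> d \<longrightarrow> real (running_time svd d n x \<xi>)
                            \<le> C * real n * (real d)\<^sup>2 * (ln (real d))\<^sup>2) \<and>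
               real (storage svd d n x \<xi>) \<le> C * (real d)\<^sup>2"
  \<comment> \<open>8420 is 4 times 2105: for \<open>d\<close> at least 2,
    \<open>1 \<le> 4 (ln d)^2\<close> brings the quadratic part of the time bound into the form
    \<open>d^2 (ln d)^2\<close>. The storage bound fits under the same constant.\<close>
  proof (intro exI[of _ "8420 + c'"] allI impI conjI)
    fix d n :: nat and x \<xi> assume valid: "valid_input d n x \<xi>"
    show "computes_run svd d n x \<xi>" using svd valid by (intro program_computes_run) auto
    have d: "1 \<le> d" using valid by (simp add: valid_input_def)
    have "real (storage svd d n x \<xi>) \<le> real (14 * d\<^sup>2)"
      using storage_le[OF d] by (simp only: of_nat_le_iff)
    also have "\<dots> \<le> (8420 + c') * (real d)\<^sup>2" by (simp add: c'_def mult_right_mono)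
    finally show "real (storage svd d n x \<xi>) \<le> (8420 + c') * (real d)\<^sup>2" .
    assume d2: "2 \<le> d"
    \<comment> \<open>\<open>ln t \<le> t - 1\<close> at \<open>t = 1/2\<close>, where
      \<open>ln t = - ln 2\<close>.\<close>
    have "1 / 2 \<le> ln (2 :: real)" using ln_le_minus_one[of "1 / 2 :: real"] by (simp add: ln_div)
    also have "\<dots> \<le> ln (real d)" using d2 by (intro ln_mono) auto
    finally have "(1 / 2)\<^sup>2 \<le> (ln (real d))\<^sup>2" by (intro power_mono) auto
    then have l: "1 \<le> 4 * (ln (real d))\<^sup>2" by (simp add: power2_eq_square)
    let ?T = "c' * (real d)\<^sup>2 * (ln (real d))\<^sup>2"
    have "real (snd (svd d U s V p q)) \<le> ?T" if "svd_update_input d U s V p q" for U s V p q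
    proof -
      have "c * (real d)\<^sup>2 * (ln (real d))\<^sup>2 \<le> ?T"
        by (intro mult_right_mono) (auto simp: c'_def)
      then show ?thesis using c[OF d2 that] by linarith
    qed
    then have "real (running_time svd d n x \<xi>) \<le> n * (2105 * (real d)\<^sup>2 + ?T)"
      using svd valid by (intro program_time) (auto simp: c'_def)
    also have "\<dots> \<le> n * (2105 * (real d)\<^sup>2 * (4 * (ln (real d))\<^sup>2) + ?T)"
      using mult_left_mono[OF l, of "2105 * (real d)\<^sup>2"] by (intro mult_left_mono) auto
    also have "\<dots> = (8420 + c') * n * (real d)\<^sup>2 * (ln (real d))\<^sup>2" by (simp add: algebra_simps)
    finally show "real (running_time svd d n x \<xi>) \<le> (8420 + c') * real n * (real d)\<^sup>2 * (ln (real d))\<^sup>2" .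
  qed
qed

end
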